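(* There is an absolute constant $\alpha_0>0$ such that for every $0<\alpha\le\alpha_0$ and every $C\ge1$ there exist constants $c,C'>0$ (depending only on $C$ and $\alpha$) such that the following holds for every odd prime power $q$ and every $n\ge1$. Let $F_1,\dots,F_n\subseteq[n]=\{1,\dots,n\}$ be index sets such that $|F_i|<\alpha n$ for every $i$, and for all $i,j\in[n]$ one has $i\in F_j$ if and only if $j\in F_i$. Let $M_n$ be a random alternating $n\times n$ matrix over $\mathbf{F}_q$ (zero diagonal, and $M_n^T=-M_n$) whose entries above the diagonal are independent, with the entry $(i,j)$, $i<j$, near uniform (with constant $C$) whenever $i\notin F_j$, and of arbitrary distribution if $i\in F_j$. Then $$\|Q(M_n)-Q_{alt,e}\|_{TV}\le\Big(\frac{C'}{q}\Big)^{cn}\quad\text{if $n$ is even,}$$ and $$\|Q(M_n)-Q_{alt,o}\|_{TV}\le\Big(\frac{C'}{q}\Big)^{cn}\quad\text{if $n$ is odd.}$$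
   Context: A random variable $\xi\in\mathbf{F}_q$ is near uniform with constant $C\ge1$ if $\mathbf{P}(\xi=k)\le C/q$ for all $k\in\mathbf{F}_q$. For an $n\times n$ matrix $M$, $Q(M)=n-\operatorname{rank}(M)$. $Q_{alt,e}$ and $Q_{alt,o}$ are the random variables on $\{0,1,2,\dots\}$ with $$\mathbf{P}(Q_{alt,e}=k)=\prod_{i=0}^\infty(1-q^{-2i-1})\frac{q^k}{\prod_{i=1}^k(q^i-1)}\ \text{ for $k$ even},\qquad \mathbf{P}(Q_{alt,e}=k)=0\ \text{ for $k$ odd},$$ $$\mathbf{P}(Q_{alt,o}=k)=\prod_{i=0}^\infty(1-q^{-2i-1})\frac{q^k}{\prod_{i=1}^k(q^i-1)}\ \text{ for $k$ odd},\qquad \mathbf{P}(Q_{alt,o}=k)=0\ \text{ for $k$ even}.$$ $\|\cdot-\cdot\|_{TV}$ is the total variation distance between distributions. *)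

theory Defs
  imports "HOL-Probability.Probability" "Jordan_Normal_Form.Missing_VectorSpace"
begin

section \<open>Matrices over a field given by a carrier\<close>

text \<open>
  Fields are records with a carrier, not type-class instances, so that one can quantify over all
  finite fields inside a formula (with constants chosen before the field). Every finite field is
  isomorphic to one with carrier in \<open>nat\<close>, so fields of type \<open>nat ring\<close> suffice for that.

  An \<open>n \<times> n\<close> matrix is a function of two indices in \<open>{1..n}\<close>; its values at other indices are
  irrelevant. The rank is the dimension of the column space inside \<open>K\<^sup>n\<close>, the space of functions
  on \<open>{1..n}\<close>.
\<close>

definition matrix_rank :: "('a, 'b) ring_scheme \<Rightarrow> nat \<Rightarrow> (nat \<Rightarrow> nat \<Rightarrow> 'a) \<Rightarrow> nat" where
  "matrix_rank K n A =
     (let V = ring.func_space K {1..n};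
          columns = (\<lambda>j. \<lambda>i\<in>{1..n}. A i j) ` {1..n}
      in vectorspace.dim K (V\<lparr>carrier := LinearCombinations.module.span K V columns\<rparr>))"

definition corank :: "('a, 'b) ring_scheme \<Rightarrow> nat \<Rightarrow> (nat \<Rightarrow> nat \<Rightarrow> 'a) \<Rightarrow> nat" where
  "corank K n A = n - matrix_rank K n A"

text \<open>The subtraction above is never truncated:\<close>

lemma matrix_rank_le:
  assumes K: "field K" and A: "\<And>i j. i \<in> {1..n} \<Longrightarrow> j \<in> {1..n} \<Longrightarrow> A i j \<in> carrier K"
  shows "matrix_rank K n A \<le> n"
proof -
  interpret K: field K by (rule K)
  define V where "V = K.func_space {1..n}"
  define S where "S = (\<lambda>j. \<lambda>i\<in>{1..n}. A i j) ` {1..n}"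
  interpret V: vectorspace K V
    unfolding V_def vectorspace_def using K.func_space_is_module K by blast
  have S: "S \<subseteq> carrier V" using A by (auto simp: S_def V_def K.func_space_def)
  interpret W: vectorspace K "V.vs (V.span S)"
    by (rule V.subspace_is_vs[OF V.span_is_subspace[OF S]])
  have "W.dim \<le> card S"
  proof (rule W.gen_ge_dim)
    show "W.gen_set S"
      using V.span_li_not_depend(1)[OF V.in_own_span[OF S] V.span_is_submodule[OF S]] by simp
  qed (use V.in_own_span[OF S] in \<open>auto simp: S_def\<close>)
  also have "card S \<le> n" unfolding S_def using card_image_le[of "{1..n}"] by fastforce
  finally show ?thesis by (simp add: matrix_rank_def Let_def V_def S_def)
qed

definition alternating_matrix :: "('a, 'b) ring_scheme \<Rightarrow> nat \<Rightarrow> (nat \<Rightarrow> nat \<Rightarrow> 'a) \<Rightarrow> bool" where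
  "alternating_matrix K n A \<longleftrightarrow>
     (\<forall>i\<in>{1..n}. \<forall>j\<in>{1..n}. A i j \<in> carrier K) \<and>
     (\<forall>i\<in>{1..n}. A i i = \<zero>\<^bsub>K\<^esub>) \<and>
     (\<forall>i\<in>{1..n}. \<forall>j\<in>{1..n}. A j i = \<ominus>\<^bsub>K\<^esub> A i j)"


section \<open>Random matrices\<close>

text \<open>
  A random matrix over a finite field is represented by its law, a probability mass function on
  matrices. Under this law the entry at \<open>(i, j)\<close> is the random variable \<open>\<lambda>A. A i j\<close>, and the law
  of that entry is the corresponding image measure.
\<close>

definition near_uniform :: "('a, 'b) ring_scheme \<Rightarrow> real \<Rightarrow> 'a pmf \<Rightarrow> bool" where
  "near_uniform K C p \<longleftrightarrow> (\<forall>k\<in>carrier K. pmf p k \<le> C / real (card (carrier K)))"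

definition entry_law :: "(nat \<Rightarrow> nat \<Rightarrow> 'a) pmf \<Rightarrow> nat \<Rightarrow> nat \<Rightarrow> 'a pmf" where
  "entry_law P i j = map_pmf (\<lambda>A. A i j) P"

definition upper_entries_indep :: "nat \<Rightarrow> (nat \<Rightarrow> nat \<Rightarrow> 'a) pmf \<Rightarrow> bool" where
  "upper_entries_indep n P \<longleftrightarrow>
     prob_space.indep_vars (measure_pmf P) (\<lambda>_. count_space UNIV) (\<lambda>(i, j) A. A i j)
       {(i, j). 1 \<le> i \<and> i < j \<and> j \<le> n}"

text \<open>
  \<open>F j\<close> contains the indices \<open>i\<close> for which nothing is assumed about the law of entry \<open>(i, j)\<close>.
\<close>

definition random_alternating ::
  "('a, 'b) ring_scheme \<Rightarrow> real \<Rightarrow> nat \<Rightarrow> (nat \<Rightarrow> nat set) \<Rightarrow> (nat \<Rightarrow> nat \<Rightarrow> 'a) pmf \<Rightarrow> bool" where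
  "random_alternating K C n F P \<longleftrightarrow>
     (\<forall>A\<in>set_pmf P. alternating_matrix K n A) \<and>
     upper_entries_indep n P \<and>
     (\<forall>i j. 1 \<le> i \<and> i < j \<and> j \<le> n \<and> i \<notin> F j \<longrightarrow> near_uniform K C (entry_law P i j))"

definition tv_dist :: "'a pmf \<Rightarrow> 'a pmf \<Rightarrow> real" where
  "tv_dist p r = (SUP X. \<bar>measure_pmf.prob p X - measure_pmf.prob r X\<bar>)"


section \<open>The limiting corank distributions\<close>

definition Q_alt_mass :: "nat \<Rightarrow> nat \<Rightarrow> real" where
  "Q_alt_mass q k =
     (\<Prod>i. 1 - 1 / real q ^ (2 * i + 1)) * (real q ^ k / (\<Prod>i=1..k. real q ^ i - 1))"

definition Q_alt_e :: "nat \<Rightarrow> nat pmf" where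
  "Q_alt_e q = embed_pmf (\<lambda>k. if even k then Q_alt_mass q k else 0)"

definition Q_alt_o :: "nat \<Rightarrow> nat pmf" where
  "Q_alt_o q = embed_pmf (\<lambda>k. if odd k then Q_alt_mass q k else 0)"

text \<open>
  The rest of the theory shows that these mass functions do sum to 1, so that \<open>embed_pmf\<close> is
  meaningful. With \<open>t = 1 / q\<close> and \<open>a k = q ^ k / (\<Prod>i=1..k. q ^ i - 1)\<close>, the series
  \<open>f z = (\<Sum>k. a k * z ^ k)\<close> satisfies \<open>f z = (1 + z) * f (t * z)\<close>. Hence \<open>f (-1) = 0\<close> and
  \<open>f 1 = 2 * f t\<close>, so the even and the odd terms each sum to \<open>f t\<close>, and
  \<open>f t = (\<Prod>i. 1 + t ^ Suc i) = 1 / (\<Prod>i. 1 - t ^ (2 * i + 1))\<close>.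
\<close>

context
  fixes t :: real and a :: "nat \<Rightarrow> real"
  assumes t: "0 < t" "t < 1"
    and a0: "a 0 = 1"
    and aSuc: "\<And>k. a (Suc k) * (1 - t ^ Suc k) = t ^ k * a k"
begin

lemma alt_tpow: "t ^ Suc k < 1"
  using t by (intro power_Suc_less_one) auto

lemma alt_rec: "a (Suc k) = t ^ k / (1 - t ^ Suc k) * a k"
  using aSuc[of k] alt_tpow[of k] by (simp add: field_simps del: power_Suc)

lemma alt_coeff_pos: "a k > 0"
proof (induction k)
  case (Suc k)
  then show ?case using t alt_tpow[of k] unfolding alt_rec by (intro mult_pos_pos divide_pos_pos) auto
qed (simp add: a0)

lemma alt_coeff_summable: "summable a"
proof -
  have "(\<lambda>k. t ^ k / (1 - t ^ Suc k)) \<longlonglongrightarrow> 0 / (1 - 0)"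
    using t by (intro tendsto_intros LIMSEQ_power_zero LIMSEQ_Suc) auto
  then have "eventually (\<lambda>k. t ^ k / (1 - t ^ Suc k) < 1/2) sequentially"
    by (intro order_tendstoD) auto
  then obtain N where N: "\<And>k. k \<ge> N \<Longrightarrow> t ^ k / (1 - t ^ Suc k) < 1/2"
    unfolding eventually_sequentially by blast
  show ?thesis
  proof (rule summable_ratio_test[where c = "1/2" and N = N])
    fix k assume "k \<ge> N"
    have "a (Suc k) \<le> 1/2 * a k"
      unfolding alt_rec using N[OF \<open>k \<ge> N\<close>] alt_coeff_pos[of k] by (intro mult_right_mono) auto
    then show "norm (a (Suc k)) \<le> 1/2 * norm (a k)"
      using alt_coeff_pos[of k] alt_coeff_pos[of "Suc k"] by simp
  qed simp
qed

definition alt_series :: "real \<Rightarrow> real" where "alt_series z = (\<Sum>k. a k * z ^ k)"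

lemma alt_series_summable: "\<bar>z\<bar> \<le> 1 \<Longrightarrow> summable (\<lambda>k. a k * z ^ k)"
  by (rule summable_comparison_test'[OF alt_coeff_summable, of 0])
     (use alt_coeff_pos in \<open>auto simp: abs_mult power_abs less_imp_le intro!: mult_left_le power_le_one\<close>)

lemma alt_series_eq: assumes "\<bar>z\<bar> \<le> 1" shows "alt_series z = (1 + z) * alt_series (t * z)"
proof -
  have tz: "\<bar>t * z\<bar> \<le> 1" using assms t by (simp add: abs_mult mult_le_one)
  have s1: "summable (\<lambda>k. a k * (t * z) ^ k)" by (rule alt_series_summable[OF tz])
  have "alt_series z = a 0 + (\<Sum>k. a (Suc k) * z ^ Suc k)"
    unfolding alt_series_def using suminf_split_head[OF alt_series_summable[OF assms]] by simp
  also have "(\<lambda>k. a (Suc k) * z ^ Suc k)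
      = (\<lambda>k. a (Suc k) * (t * z) ^ Suc k + z * (a k * (t * z) ^ k))"
  proof
    fix k
    have "a (Suc k) * z ^ Suc k - a (Suc k) * (t * z) ^ Suc k
        = (a (Suc k) * (1 - t ^ Suc k)) * z ^ Suc k"
      by (simp only: power_mult_distrib algebra_simps)
    also have "\<dots> = z * (a k * (t * z) ^ k)"
      unfolding aSuc by (simp add: power_mult_distrib)
    finally show "a (Suc k) * z ^ Suc k = a (Suc k) * (t * z) ^ Suc k + z * (a k * (t * z) ^ k)"
      by simp
  qed
  also have "suminf \<dots> = (\<Sum>k. a (Suc k) * (t * z) ^ Suc k) + (\<Sum>k. z * (a k * (t * z) ^ k))"
    by (rule suminf_add[symmetric])
       (use s1 in \<open>auto intro!: summable_mult simp: summable_Suc_iff[of "\<lambda>k. a k * (t * z) ^ k"] simp del: power_Suc\<close>)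
  also have "(\<Sum>k. z * (a k * (t * z) ^ k)) = z * alt_series (t * z)"
    unfolding alt_series_def by (rule suminf_mult[OF s1])
  also have "a 0 + ((\<Sum>k. a (Suc k) * (t * z) ^ Suc k) + z * alt_series (t * z)) = alt_series (t * z) + z * alt_series (t * z)"
    unfolding alt_series_def using suminf_split_head[OF s1] by simp
  finally show ?thesis by (simp add: algebra_simps)
qed

lemma alt_series_iter: "alt_series t = (\<Prod>i=1..n. 1 + t ^ i) * alt_series (t ^ Suc n)"
proof (induction n)
  case (Suc n)
  have "alt_series (t ^ Suc n) = (1 + t ^ Suc n) * alt_series (t ^ Suc (Suc n))"
    using alt_series_eq[of "t ^ Suc n"] t alt_tpow[of n] by (simp del: power_Suc add: power_Suc[of _ "Suc n"])
  then show ?case using Suc by (simp del: power_Suc)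
qed simp

lemma alt_series_lim: "(\<lambda>n. alt_series (t ^ Suc n)) \<longlonglongrightarrow> 1"
proof -
  have "summable (\<lambda>n. a n * 1 ^ n)" using alt_coeff_summable by simp
  then have "isCont alt_series 0" unfolding alt_series_def by (rule isCont_powser) simp
  moreover have "(\<lambda>n. t ^ Suc n) \<longlonglongrightarrow> 0"
    using t by (intro LIMSEQ_power_zero LIMSEQ_Suc) auto
  moreover have "alt_series 0 = 1" by (simp add: alt_series_def a0)
  ultimately show ?thesis using isCont_tendsto_compose by fastforce
qed

lemma alt_summable_odd: "summable (\<lambda>i. t ^ (2 * i + 1))"
proof -
  have "summable (\<lambda>i. t * (t ^ 2) ^ i)"
    using t by (intro summable_mult summable_geometric) (auto simp: power_less_one_iff abs_square_less_1)
  then show ?thesis by (simp add: power_mult)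
qed

lemma alt_prod_lim:
  assumes "summable e" "\<And>i. 0 < e i" "\<And>i. e i < (1::real)"
  shows "(\<lambda>n. \<Prod>i<n. 1 - e i) \<longlonglongrightarrow> (\<Prod>i. 1 - e i)" "(\<Prod>i. 1 - e i) > 0"
proof -
  have c: "convergent_prod (\<lambda>i. 1 - e i)"
  proof -
    have "convergent_prod (\<lambda>i. 1 + - e i)"
    proof (rule summable_imp_convergent_prod_real)
      show "summable (\<lambda>i. \<bar>- e i\<bar>)" using assms(1,2) by (simp add: less_imp_le)
      show "- e i \<noteq> - 1" for i using assms(3)[of i] by simp
    qed
    then show ?thesis by simp
  qed
  show "(\<lambda>n. \<Prod>i<n. 1 - e i) \<longlonglongrightarrow> (\<Prod>i. 1 - e i)"
    using convergent_prod_LIMSEQ[OF c] LIMSEQ_lessThan_iff_atMost by blast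
  then have "(\<Prod>i. 1 - e i) \<ge> 0"
    by (rule LIMSEQ_le_const) (use assms in \<open>auto intro!: prod_nonneg simp: less_imp_le\<close>)
  moreover have "(\<Prod>i. 1 - e i) \<noteq> 0"
    by (rule prodinf_nonzero[OF c]) (use assms(3) in \<open>metis diff_gt_0_iff_gt less_irrefl\<close>)
  ultimately show "(\<Prod>i. 1 - e i) > 0" by simp
qed

lemma alt_prod_identity:
  "(\<Prod>i=1..n. 1 + t ^ i) * (\<Prod>i<n. 1 - t ^ (2 * i + 1)) * (\<Prod>i<n. 1 - t ^ Suc i)
     = (\<Prod>i<2 * n. 1 - t ^ Suc i)"
proof (induction n)
  case (Suc n)
  have "(1 + t ^ Suc n) * (1 - t ^ (2 * n + 1)) * (1 - t ^ Suc n)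
      = (1 - t ^ Suc (2 * n)) * (1 - t ^ Suc (Suc (2 * n)))"
    by (simp only: power_Suc power_add power_one_right mult_2) (simp add: algebra_simps)
  moreover have "(B * b) * (D * d) * (P * p) = Q * (e * e')"
    if "B * D * P = Q" "b * d * p = e * e'" for B b D d P p Q e e' :: real
    using that by (metis mult.assoc mult.left_commute)
  ultimately have "((\<Prod>i=1..n. 1 + t ^ i) * (1 + t ^ Suc n)) *
      ((\<Prod>i<n. 1 - t ^ (2 * i + 1)) * (1 - t ^ (2 * n + 1))) *
      ((\<Prod>i<n. 1 - t ^ Suc i) * (1 - t ^ Suc n))
      = (\<Prod>i<2 * n. 1 - t ^ Suc i) * ((1 - t ^ Suc (2 * n)) * (1 - t ^ Suc (Suc (2 * n))))"
    using Suc by blast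
  moreover have "{..<2 * Suc n} = insert (Suc (2 * n)) (insert (2 * n) {..<2 * n})" by auto
  ultimately show ?case by (simp add: ac_simps del: power_Suc)
qed simp

lemma alt_series_value: "alt_series t * (\<Prod>i. 1 - t ^ (2 * i + 1)) = 1"
proof -
  let ?P = "\<lambda>n. \<Prod>i<n. 1 - t ^ Suc i" and ?D = "\<lambda>n. \<Prod>i<n. 1 - t ^ (2 * i + 1)"
  let ?p = "\<Prod>i. 1 - t ^ Suc i"
  have s: "summable (\<lambda>i. t ^ Suc i)"
    using t summable_Suc_iff[of "\<lambda>i. t ^ i"] by (simp add: summable_geometric del: power_Suc)
  have P: "?P \<longlonglongrightarrow> ?p" "?p > 0"
    using alt_prod_lim[OF s] t alt_tpow by auto
  have D: "?D \<longlonglongrightarrow> (\<Prod>i. 1 - t ^ (2 * i + 1))"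
    using alt_prod_lim(1)[OF alt_summable_odd] t alt_tpow by auto
  have Ppos: "?P n > 0" for n using alt_tpow by (auto intro!: prod_pos simp del: power_Suc)
  have P2: "(\<lambda>n. ?P (2 * n)) \<longlonglongrightarrow> ?p"
    by (rule LIMSEQ_subseq_LIMSEQ[OF P(1), unfolded o_def, of "\<lambda>n. 2 * n"])
       (auto simp: strict_mono_def)
  have "alt_series t * ?D n = ?P (2 * n) / ?P n * alt_series (t ^ Suc n)" for n
  proof -
    have "alt_series t * ?D n * ?P n = ?P (2 * n) * alt_series (t ^ Suc n)"
      unfolding alt_prod_identity[symmetric] alt_series_iter[of n] by (simp only: ac_simps)
    then show ?thesis using Ppos[of n] by (simp only: times_divide_eq_left nonzero_eq_divide_eq[OF less_imp_neq[OF Ppos[of n], symmetric]])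
  qed
  moreover have "(\<lambda>n. ?P (2 * n) / ?P n * alt_series (t ^ Suc n)) \<longlonglongrightarrow> ?p / ?p * 1"
    using P(2) by (intro tendsto_intros P2 P alt_series_lim) auto
  ultimately have "(\<lambda>n. alt_series t * ?D n) \<longlonglongrightarrow> 1" using P(2) by simp
  moreover have "(\<lambda>n. alt_series t * ?D n) \<longlonglongrightarrow> alt_series t * (\<Prod>i. 1 - t ^ (2 * i + 1))"
    by (intro tendsto_intros D)
  ultimately show ?thesis using LIMSEQ_unique by blast
qed

lemma alt_parity_sums:
  "(\<lambda>k. if even k then a k else 0) sums alt_series t" "(\<lambda>k. if odd k then a k else 0) sums alt_series t"
proof -
  have s: "(\<lambda>k. a k * 1 ^ k) sums alt_series 1" "(\<lambda>k. a k * (-1) ^ k) sums alt_series (-1)"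
    unfolding alt_series_def by (intro summable_sums alt_series_summable; simp)+
  have v: "alt_series 1 = 2 * alt_series t" "alt_series (-1) = 0" using alt_series_eq[of 1] alt_series_eq[of "-1"] by auto
  have "(\<lambda>k. (a k * 1 ^ k + a k * (-1) ^ k) / 2) sums ((alt_series 1 + alt_series (-1)) / 2)"
    by (intro sums_divide sums_add s)
  moreover have "(\<lambda>k. (a k * 1 ^ k + a k * (-1) ^ k) / 2) = (\<lambda>k. if even k then a k else 0)"
    by auto
  ultimately show "(\<lambda>k. if even k then a k else 0) sums alt_series t" using v by simp
  have "(\<lambda>k. (a k * 1 ^ k - a k * (-1) ^ k) / 2) sums ((alt_series 1 - alt_series (-1)) / 2)"
    by (intro sums_divide sums_diff s)
  moreover have "(\<lambda>k. (a k * 1 ^ k - a k * (-1) ^ k) / 2) = (\<lambda>k. if odd k then a k else 0)"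
    by auto
  ultimately show "(\<lambda>k. if odd k then a k else 0) sums alt_series t" using v by simp
qed

end

lemma
  assumes q: "2 \<le> q"
  shows Q_alt_mass_pos: "Q_alt_mass q k > 0"
    and Q_alt_mass_even_sums: "(\<lambda>k. if even k then Q_alt_mass q k else 0) sums 1"
    and Q_alt_mass_odd_sums: "(\<lambda>k. if odd k then Q_alt_mass q k else 0) sums 1"
proof -
  define t where "t = 1 / real q"
  define a where "a = (\<lambda>k. real q ^ k / (\<Prod>i=1..k. real q ^ i - 1))"
  have t: "0 < t" "t < 1" using q by (auto simp: t_def)
  have a0: "a 0 = 1" by (simp add: a_def)
  have aSuc: "a (Suc k) * (1 - t ^ Suc k) = t ^ k * a k" for k
  proof -
    have n: "real q ^ Suc k - 1 > 0" using q by (simp del: power_Suc add: one_less_power)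
    have p: "(\<Prod>i=1..k. real q ^ i - 1) > 0" using q by (auto intro!: prod_pos one_less_power)
    have "1 - t ^ Suc k = (real q ^ Suc k - 1) / real q ^ Suc k"
      using q by (simp add: t_def power_one_over field_simps)
    moreover have "a (Suc k) = real q ^ Suc k / ((\<Prod>i=1..k. real q ^ i - 1) * (real q ^ Suc k - 1))"
      by (simp add: a_def)
    moreover have "t ^ k * a k = 1 / (\<Prod>i=1..k. real q ^ i - 1)"
      using q by (simp add: a_def t_def power_one_over)
    moreover have "x / (y * z) * (z / x) = 1 / y" if "x > 0" "z > 0" for x y z :: real
      using that by simp
    ultimately show ?thesis using n q by simp
  qed
  define D where "D = (\<Prod>i. 1 - t ^ (2 * i + 1))"
  have m: "Q_alt_mass q k = D * a k" for k
    by (simp add: Q_alt_mass_def D_def a_def t_def power_one_over)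
  note ctx = t a0 aSuc
  have Dpos: "D > 0"
    unfolding D_def by (rule alt_prod_lim(2)[OF ctx alt_summable_odd[OF ctx]]) (use t alt_tpow[OF ctx] in auto)
  show "Q_alt_mass q k > 0" using Dpos alt_coeff_pos[OF ctx] by (simp add: m)
  have v: "D * alt_series a t = 1" using alt_series_value[OF ctx] by (simp add: D_def mult.commute)
  have *: "(\<lambda>k. if P k then Q_alt_mass q k else 0) = (\<lambda>k. D * (if P k then a k else 0))" for P
    by (auto simp: m)
  show "(\<lambda>k. if even k then Q_alt_mass q k else 0) sums 1"
    unfolding * v[symmetric] by (intro sums_mult alt_parity_sums[OF ctx])
  show "(\<lambda>k. if odd k then Q_alt_mass q k else 0) sums 1"
    unfolding * v[symmetric] by (intro sums_mult alt_parity_sums[OF ctx])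
qed

lemma pmf_embed_nat:
  assumes "\<And>k. 0 \<le> g k" "g sums 1"
  shows "pmf (embed_pmf g) (k :: nat) = g k"
proof (rule pmf_embed_pmf)
  have "(\<integral>\<^sup>+k. ennreal (g k) \<partial>count_space UNIV) = ennreal (\<Sum>k. g k)"
    using assms by (simp add: nn_integral_count_space_nat suminf_ennreal2 sums_summable)
  then show "(\<integral>\<^sup>+k. ennreal (g k) \<partial>count_space UNIV) = 1"
    using sums_unique[OF assms(2)] by simp
qed (use assms in auto)

lemma pmf_Q_alt_e:
  "2 \<le> q \<Longrightarrow> pmf (Q_alt_e q) k = (if even k then Q_alt_mass q k else 0)"
  unfolding Q_alt_e_def
  by (rule pmf_embed_nat) (auto simp: Q_alt_mass_even_sums less_imp_le[OF Q_alt_mass_pos])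

lemma pmf_Q_alt_o:
  "2 \<le> q \<Longrightarrow> pmf (Q_alt_o q) k = (if odd k then Q_alt_mass q k else 0)"
  unfolding Q_alt_o_def
  by (rule pmf_embed_nat) (auto simp: Q_alt_mass_odd_sums less_imp_le[OF Q_alt_mass_pos])

end

theory Submission
  imports Defs
begin

text \<open>
  Let \<open>M\<^sub>k\<close> be the leading \<open>k \<times> k\<close> block of the random matrix. Passing from \<open>M\<^sub>k\<close> to \<open>M\<^sub>k\<^sub>+\<^sub>1\<close> adds a
  column \<open>x\<close> and the row \<open>- x\<close>. The corank goes up by one if \<open>x\<close> is orthogonal to the kernel \<open>W\<close> of
  \<open>M\<^sub>k\<close>, and down by one otherwise (\<open>corank_Suc_cases\<close>). For a uniform column the first case has
  probability \<open>q\<close> to the power \<open>- dim W\<close>, so for uniform matrices the corank is a Markov chain on the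
  natural numbers, which moves from \<open>r\<close> to \<open>r + 1\<close> with probability \<open>1 / q ^ r\<close> and to \<open>r - 1\<close>
  otherwise. This chain exchanges the two limiting laws (\<open>bind_corank_limit_step\<close>), and it forgets
  its start at rate \<open>1 / q\<close> per step: if the increments \<open>g (r + 2) - g r\<close> of a test function are at
  most \<open>L * q ^ r\<close>, then after one step they are at most \<open>(L / q) * q ^ r\<close>
  (\<open>corank_transfer_contraction\<close>). Starting at \<open>k = n div 3\<close>, where the corank is at most \<open>n / 3\<close>,
  the remaining \<open>2 * n / 3\<close> steps of the chain bring it within about \<open>q\<close> to the power \<open>- n / 3\<close>
  of the limit.

  It remains to replace, for \<open>k\<close> from \<open>n div 3\<close> to \<open>n\<close>, the true column by a uniform one, that is,
  to compare the probability of \<open>x \<bottom> W\<close> with \<open>1 / card W\<close>. Let \<open>b v = q * P (x \<bullet> v = 0) - 1\<close>. Counting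
  points of hyperplanes in \<open>W\<close> shows that the difference of the two probabilities is a multiple of the
  sum of \<open>b v\<close> over the nonzero \<open>v\<close> in \<open>W\<close> (\<open>prob_orthogonal_approx\<close>). Two facts make the expectation of
  this sum small.

  \<^item> As functions of \<open>v\<close>, the numbers \<open>q * [x \<bullet> v = 0] - 1\<close> and \<open>q * [y \<bullet> v = 0] - 1\<close> are orthogonal
    unless \<open>x\<close> and \<open>y\<close> are proportional. Hence the sum of \<open>(b v)\<^sup>2\<close> over all \<open>v\<close> is at most \<open>q ^ (k + 2)\<close>
    times the largest point mass of \<open>x\<close>, that is, at most \<open>C ^ k * q\<^sup>2\<close> if the entries of \<open>x\<close> are near
    uniform. By Cauchy-Schwarz the sum of \<open>\<bar>b v\<bar>\<close> is then at most \<open>C\<close> to the power \<open>k / 2\<close> times \<open>q\<close> to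
    the power \<open>k / 2 + 1\<close> (\<open>sum_abs_hyperplane_bias\<close>). This plays the part of Parseval's identity, without characters.

  \<^item> A fixed nonzero \<open>v\<close> lies in the kernel of \<open>M\<^sub>k\<close> with probability at most \<open>(C / q) ^ (k - 1)\<close>: if
    \<open>v s \<noteq> 0\<close> and all entries outside row and column \<open>s\<close> are fixed, then every row \<open>t \<noteq> s\<close> of the equation
    \<open>M\<^sub>k v = 0\<close> determines the entry \<open>(t, s)\<close> (\<open>prob_kernel\<close>).

  Every entry of arbitrary law in that row or column costs a factor \<open>q\<close> in these two bounds on
  probabilities. If each row has at most \<open>f\<close> of them, the
  error of step \<open>k\<close> is at most \<open>C\<close> to the power \<open>3 * k / 2\<close> times \<open>q\<close> to the power \<open>3 * f / 2 - k / 2\<close>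
  (\<open>step_error_le\<close>). With \<open>k \<ge> n / 5\<close> and \<open>f \<le> n / 60\<close> this is exponentially small in \<open>n\<close>, with a power
  of \<open>q\<close> as base.
\<close>

section \<open>Expectations under probability mass functions\<close>

lemma expectation_bind_pmf_bounded:
  fixes f :: "'b \<Rightarrow> real"
  assumes "\<And>x. \<bar>f x\<bar> \<le> B"
  shows "measure_pmf.expectation (bind_pmf p N) f =
    measure_pmf.expectation p (\<lambda>x. measure_pmf.expectation (N x) f)"
  unfolding measure_pmf_bind
  by (rule integral_bind[where K="count_space UNIV" and B=B and B'=1])
    (auto simp: assms measure_pmf_in_subprob_space measure_pmf.emeasure_space_1 intro: measure_pmf.finite_measure_axioms
      measurable_measure_pmf)

lemma integrable_pmf_bounded:
  fixes f :: "'b \<Rightarrow> real"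
  assumes "\<And>x. x \<in> set_pmf p \<Longrightarrow> \<bar>f x\<bar> \<le> B"
  shows "integrable (measure_pmf p) f"
  by (rule measure_pmf.integrable_const_bound[where B=B]) (auto simp: AE_measure_pmf_iff assms)

lemma integrable_indicator_pmf [simp]: "integrable (measure_pmf M) (indicator S :: 'a \<Rightarrow> real)"
  by (rule integrable_pmf_bounded[where B=1]) (auto simp: indicator_def)

lemma expectation_pair_pmf_bounded:
  fixes f :: "'a \<times> 'b \<Rightarrow> real"
  assumes "\<And>x. \<bar>f x\<bar> \<le> B"
  shows "measure_pmf.expectation (pair_pmf M N) f =
    measure_pmf.expectation M (\<lambda>x. measure_pmf.expectation N (\<lambda>y. f (x, y)))"
  unfolding pair_pmf_def by (simp add: expectation_bind_pmf_bounded[OF assms])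

lemma expectation_if_pmf:
  "measure_pmf.expectation D (\<lambda>x. g (if P x then a else b)) =
    measure_pmf.prob D {x. P x} * g a + (1 - measure_pmf.prob D {x. P x}) * (g b :: real)"
proof -
  have "measure_pmf.expectation D (\<lambda>x. g (if P x then a else b))
      = measure_pmf.expectation D (\<lambda>x. g b + (g a - g b) * indicator {x. P x} x)"
    by (intro Bochner_Integration.integral_cong) (auto simp: indicator_def)
  also have "\<dots> = g b + (g a - g b) * measure_pmf.prob D {x. P x}"
    by (subst Bochner_Integration.integral_add) (auto simp: measure_pmf.prob_space)
  finally show ?thesis by (simp add: algebra_simps)
qed

text \<open>
  Inside the support of the product law the event has at most one point, so its probability is at most a
  product of point masses.
\<close>

lemma prob_determined_coordinates:
  assumes J: "finite J" and cap: "\<And>e x. e \<in> J \<Longrightarrow> pmf (p e) x \<le> cap e"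
    and det: "\<And>z z' e. z \<in> S \<Longrightarrow> z' \<in> S \<Longrightarrow> z \<in> set_pmf (Pi_pmf J d p) \<Longrightarrow>
      z' \<in> set_pmf (Pi_pmf J d p) \<Longrightarrow> e \<in> J \<Longrightarrow> z e = z' e"
  shows "measure_pmf.prob (Pi_pmf J d p) S \<le> (\<Prod>e\<in>J. cap e)"
proof (cases "S \<inter> set_pmf (Pi_pmf J d p) = {}")
  case True
  have "0 \<le> cap e" if "e \<in> J" for e using order_trans[OF pmf_nonneg cap[OF that]] .
  then have "0 \<le> (\<Prod>e\<in>J. cap e)" by (rule prod_nonneg)
  moreover have "measure_pmf.prob (Pi_pmf J d p) S = 0"
    using True by (subst measure_pmf_zero_iff) (simp add: Int_commute)
  ultimately show ?thesis by simp
next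
  case False
  then obtain z where z: "z \<in> S" "z \<in> set_pmf (Pi_pmf J d p)" by blast
  have "measure_pmf.prob (Pi_pmf J d p) S = measure_pmf.prob (Pi_pmf J d p) (S \<inter> set_pmf (Pi_pmf J d p))"
    by (simp add: measure_Int_set_pmf)
  also have "\<dots> \<le> measure_pmf.prob (Pi_pmf J d p) (Pi J (\<lambda>e. {z e}))"
    using det[OF _ z(1) _ z(2)] by (intro measure_pmf.finite_measure_mono) auto
  also have "\<dots> = (\<Prod>e\<in>J. pmf (p e) (z e))"
    by (subst measure_Pi_pmf_Pi[OF J]) (simp add: measure_pmf_single)
  also have "\<dots> \<le> (\<Prod>e\<in>J. cap e)" by (intro prod_mono conjI pmf_nonneg cap)
  finally show ?thesis .
qed

text \<open>
  Compared with a near uniform coordinate, an arbitrary one costs at most a factor \<open>q\<close>.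
\<close>

lemma prod_cap_le:
  assumes "finite T" "card (T \<inter> S) \<le> f" "1 \<le> C" "1 \<le> (q::real)"
  shows "(\<Prod>t\<in>T. if t \<in> S then 1 else C / q) \<le> (C / q) ^ card T * q ^ f"
proof -
  have "(\<Prod>t\<in>T. if t \<in> S then 1 else C / q) \<le> (\<Prod>t\<in>T. C / q * (if t \<in> S then q else 1))"
    using assms by (intro prod_mono) auto
  also have "\<dots> = (C / q) ^ card T * q ^ card (T \<inter> S)"
    unfolding prod.distrib using assms(1) by (simp add: prod.If_cases)
  also have "\<dots> \<le> (C / q) ^ card T * q ^ f"
    using assms by (intro mult_left_mono power_increasing) auto
  finally show ?thesis .
qed

lemma tv_dist_le:
  assumes "\<And>g. (\<And>x. g x \<in> {0..1}) \<Longrightarrow>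
    \<bar>measure_pmf.expectation p g - measure_pmf.expectation r g\<bar> \<le> b"
  shows "tv_dist p r \<le> b"
  unfolding tv_dist_def
proof (rule cSUP_least)
  fix X
  show "\<bar>measure_pmf.prob p X - measure_pmf.prob r X\<bar> \<le> b"
  proof -
    have "indicator X x \<in> {0..1 :: real}" for x by (simp add: indicator_def)
    from assms[of "indicator X", OF this] show ?thesis by simp
  qed
qed simp

section \<open>The corank chain of uniform alternating matrices\<close>

text \<open>
  One step of the chain that moves up from \<open>r\<close> with probability \<open>1 / q ^ r\<close>, acting on functions. At
  \<open>r = 0\<close> the move up is certain, so the truncated \<open>r - 1\<close> has weight \<open>0\<close>.
\<close>

definition corank_transfer :: "nat \<Rightarrow> (nat \<Rightarrow> real) \<Rightarrow> nat \<Rightarrow> real" where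
  "corank_transfer q g r = g (Suc r) / real q ^ r + (1 - 1 / real q ^ r) * g (r - 1)"

definition corank_step :: "nat \<Rightarrow> nat \<Rightarrow> nat pmf" where
  "corank_step q r = map_pmf (\<lambda>up. if up then Suc r else r - 1) (bernoulli_pmf (1 / real q ^ r))"

text \<open>
  Every step of the chain changes the parity of the corank, so its equilibrium alternates between two laws.
\<close>

definition corank_limit :: "nat \<Rightarrow> nat \<Rightarrow> nat pmf" where
  "corank_limit q j = (if even j then Q_alt_e q else Q_alt_o q)"

lemma expectation_corank_step:
  assumes "2 \<le> q"
  shows "measure_pmf.expectation (corank_step q r) g = corank_transfer q g r"
  using assms by (simp add: corank_step_def corank_transfer_def algebra_simps)

lemma corank_transfer_unit:
  assumes "2 \<le> q" "\<And>r. g r \<in> {0..1}"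
  shows "corank_transfer q g r \<in> {0..1}"
proof -
  have p: "0 \<le> 1 / real q ^ r" "1 / real q ^ r \<le> 1" using assms(1) by auto
  have "(1 / real q ^ r) * g (Suc r) + (1 - 1 / real q ^ r) * g (r - 1) \<in> {0..1}"
    using convexD[OF convex_real_interval(5)[of 0 "1::real"], of "g (Suc r)" "g (r - 1)" "1 / real q ^ r" "1 - 1 / real q ^ r"]
      assms(2) p by auto
  then show ?thesis by (simp add: corank_transfer_def)
qed

text \<open>
  Couple the chains started at \<open>r\<close> and at \<open>r + 2\<close> monotonically: the pair moves up with probability
  \<open>1 / q ^ (r + 2)\<close>, down with probability \<open>1 - 1 / q ^ r\<close>, and otherwise meets at \<open>r + 1\<close>. The weight \<open>q ^ r\<close> is
  an eigenvector of this motion: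
  \<open>q ^ (r + 1) / q ^ (r + 2) + (1 - 1 / q ^ r) * q ^ (r - 1) = q ^ (r - 1)\<close>.
\<close>

lemma corank_transfer_contraction:
  assumes q: "2 \<le> q" and g: "\<And>r. \<bar>g (r + 2) - g r\<bar> \<le> L * real q ^ r"
  shows "\<bar>corank_transfer q g (r + 2) - corank_transfer q g r\<bar> \<le> L / real q * real q ^ r"
proof (cases r)
  case 0
  have "corank_transfer q g 2 - corank_transfer q g 0 = (g (1 + 2) - g 1) / real q ^ 2"
    by (simp add: corank_transfer_def algebra_simps diff_divide_distrib eval_nat_numeral)
  moreover have "\<bar>(g (1 + 2) - g 1) / real q ^ 2\<bar> \<le> L * real q ^ 1 / real q ^ 2"
    unfolding abs_divide using q g[of 1] by (intro divide_mono) auto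
  moreover have "L * real q ^ 1 / real q ^ 2 = L / real q * real q ^ r"
    using 0 q by (simp add: power2_eq_square)
  ultimately show ?thesis using 0 by (simp add: numeral_2_eq_2)
next
  case (Suc s)
  define u where "u = 1 / real q ^ r"
  have u: "0 \<le> u" "u \<le> 1" using q by (auto simp: u_def)
  have *: "1 / real q ^ (r + 2) = u / real q ^ 2"
    unfolding u_def power_add by (simp del: power_Suc)
  have "corank_transfer q g (r + 2) = g (Suc r + 2) * (1 / real q ^ (r + 2)) + (1 - 1 / real q ^ (r + 2)) * g (Suc r)"
    by (simp add: corank_transfer_def)
  moreover have "corank_transfer q g r = g (Suc r) * u + (1 - u) * g s"
    using Suc by (simp add: corank_transfer_def u_def)
  moreover have "Suc r = s + 2" using Suc by simp
  ultimately have "corank_transfer q g (r + 2) - corank_transfer q g r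
      = u / real q ^ 2 * (g (Suc r + 2) - g (Suc r)) + (1 - u) * (g (s + 2) - g s)"
    unfolding * by (simp add: algebra_simps)
  also have "\<bar>\<dots>\<bar> \<le> u / real q ^ 2 * (L * real q ^ Suc r) + (1 - u) * (L * real q ^ s)"
    using u g[of "Suc r"] unfolding abs_mult
    by (intro abs_triangle_ineq[THEN order_trans] add_mono)
      (auto simp: abs_mult simp del: power_Suc add_2_eq_Suc' times_divide_eq_left intro!: mult_left_mono g)
  also have "\<dots> = L / real q * real q ^ r"
    using q Suc by (simp add: power2_eq_square field_simps)
  finally show ?thesis .
qed

lemma corank_transfer_funpow_unit:
  assumes "2 \<le> q" "\<And>r. g r \<in> {0..1}"
  shows "(corank_transfer q ^^ T) g r \<in> {0..1}"
  using assms by (induction T arbitrary: r) (auto simp del: atLeastAtMost_iff intro!: corank_transfer_unit)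

lemma corank_transfer_funpow_contraction:
  assumes q: "2 \<le> q" and g: "\<And>r. g r \<in> {0..1}"
  shows "\<bar>(corank_transfer q ^^ T) g (r + 2) - (corank_transfer q ^^ T) g r\<bar> \<le> 1 / real q ^ T * real q ^ r"
proof (induction T arbitrary: r)
  case 0
  have "\<bar>g (r + 2) - g r\<bar> \<le> 1" using g[of r] g[of "r + 2"] by auto
  also have "1 \<le> real q ^ r" using q by auto
  finally show ?case by simp
next
  case (Suc T)
  show ?case using corank_transfer_contraction[OF q Suc, of r] by (simp add: mult.commute)
qed

text \<open>
  The increments along \<open>r, r + 2, \<dots>\<close> form a geometric series dominated by its last term.
\<close>

lemma corank_transfer_funpow_mixing:
  assumes q: "2 \<le> q" and g: "\<And>r. g r \<in> {0..1}"
  shows "\<bar>(corank_transfer q ^^ T) g (r + 2 * j) - (corank_transfer q ^^ T) g r\<bar>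
    \<le> real q ^ (r + 2 * j) / (real q * real q ^ T)"
proof (induction j)
  case (Suc j)
  let ?h = "(corank_transfer q ^^ T) g" and ?s = "r + 2 * j"
  have "\<bar>?h (?s + 2) - ?h r\<bar> \<le> 1 / real q ^ T * real q ^ ?s + real q ^ ?s / (real q * real q ^ T)"
    using corank_transfer_funpow_contraction[where g=g, OF assms, of T ?s] Suc by linarith
  also have "\<dots> = (real q + 1) * (real q ^ ?s / (real q * real q ^ T))"
    using q by (simp add: field_simps)
  also have "\<dots> \<le> real q ^ 2 * (real q ^ ?s / (real q * real q ^ T))"
  proof (intro mult_right_mono)
    have "real q + 1 \<le> 2 * real q" using q by simp
    also have "\<dots> \<le> real q ^ 2" using q by (auto simp: power2_eq_square)
    finally show "real q + 1 \<le> real q ^ 2" .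
  qed auto
  also have "\<dots> = real q ^ (r + 2 * Suc j) / (real q * real q ^ T)"
    by (simp add: power_add power2_eq_square)
  finally show ?case by simp
qed auto

text \<open>
  Detailed balance: the chain carries as much mass from \<open>k + 1\<close> down to \<open>k\<close> as from \<open>k\<close> up to \<open>k + 1\<close>.
\<close>

lemma Q_alt_mass_Suc:
  assumes "2 \<le> q"
  shows "Q_alt_mass q (Suc k) * (1 - 1 / real q ^ Suc k) = Q_alt_mass q k / real q ^ k"
proof -
  have n: "real q ^ Suc k - 1 > 0" using assms by (simp del: power_Suc add: one_less_power)
  have p: "(\<Prod>i=1..k. real q ^ i - 1) > 0" using assms by (auto intro!: prod_pos one_less_power)
  have "x / (y * z) * (1 - 1 / x) = 1 / y" if "x > 0" "z > 0" "z = x - 1" for x y z :: real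
    using that by (cases "y = 0") (auto simp: field_simps)
  from this[of "real q ^ Suc k" "real q ^ Suc k - 1" "\<Prod>i=1..k. real q ^ i - 1"] n assms
  have "real q ^ Suc k / (\<Prod>i=1..Suc k. real q ^ i - 1) * (1 - 1 / real q ^ Suc k)
      = 1 / (\<Prod>i=1..k. real q ^ i - 1)"
    by (simp del: power_Suc)
  moreover have "1 / (\<Prod>i=1..k. real q ^ i - 1) = real q ^ k / (\<Prod>i=1..k. real q ^ i - 1) / real q ^ k"
    using assms by simp
  ultimately show ?thesis by (simp only: Q_alt_mass_def mult.assoc times_divide_eq_right[symmetric])
qed

lemma pmf_corank_limit:
  "2 \<le> q \<Longrightarrow> pmf (corank_limit q j) k = (if even (j + k) then Q_alt_mass q k else 0)"
  by (auto simp: corank_limit_def pmf_Q_alt_e pmf_Q_alt_o)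

text \<open>
  By detailed balance the mass that arrives at \<open>k\<close> is the mass that leaves \<open>k\<close>.
\<close>

lemma bind_corank_limit_step:
  assumes q: "2 \<le> q"
  shows "bind_pmf (corank_limit q j) (corank_step q) = corank_limit q (Suc j)"
proof (rule pmf_eqI)
  fix k
  have st: "pmf (corank_step q r) k = corank_transfer q (indicator {k}) r" for r
    using expectation_corank_step[OF q, of r "indicator {k}"] by (simp add: pmf.rep_eq)
  have "pmf (bind_pmf (corank_limit q j) (corank_step q)) k
      = (\<Sum>r\<in>{k - 1, Suc k}. corank_transfer q (indicator {k}) r * pmf (corank_limit q j) r)"
    unfolding pmf_bind st
  proof (rule integral_measure_pmf_real)
    fix r assume "corank_transfer q (indicator {k}) r \<noteq> 0"
    then show "r \<in> {k - 1, Suc k}"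
      by (cases r) (auto simp: corank_transfer_def indicator_def split: if_splits)
  qed simp
  also have "\<dots> = pmf (corank_limit q (Suc j)) k"
  proof (cases k)
    case 0
    then show ?thesis using q Q_alt_mass_Suc[OF q, of 0]
      by (simp add: pmf_corank_limit corank_transfer_def mult.commute)
  next
    case (Suc m)
    define x where "x = 1 / real q ^ k"
    have "Q_alt_mass q m / real q ^ m = Q_alt_mass q k * (1 - x)" "Q_alt_mass q (Suc k) * (1 - 1 / real q ^ Suc k) = Q_alt_mass q k * x"
      using Q_alt_mass_Suc[OF q, of m] Q_alt_mass_Suc[OF q, of k] Suc by (auto simp: x_def)
    moreover have "x + (1 - x) = 1" by simp
    ultimately show ?thesis using q Suc
      by (simp add: pmf_corank_limit corank_transfer_def algebra_simps)
  qed
  finally show "pmf (bind_pmf (corank_limit q j) (corank_step q)) k = pmf (corank_limit q (Suc j)) k" .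
qed

lemma expectation_corank_limit_transfer:
  assumes q: "2 \<le> q" and g: "\<And>r. g r \<in> {0..1}"
  shows "measure_pmf.expectation (corank_limit q j) ((corank_transfer q ^^ T) g)
    = measure_pmf.expectation (corank_limit q (j + T)) g"
proof (induction T arbitrary: j)
  case (Suc T)
  let ?h = "(corank_transfer q ^^ T) g"
  have b: "\<bar>?h r\<bar> \<le> 1" for r using corank_transfer_funpow_unit[where g=g, OF assms, of T r] by auto
  have "(corank_transfer q ^^ Suc T) g = (\<lambda>r. measure_pmf.expectation (corank_step q r) ?h)"
    by (auto simp: expectation_corank_step[OF q])
  then show ?case
    using Suc[of "Suc j"] by (simp add: expectation_bind_pmf_bounded[OF b, symmetric] bind_corank_limit_step[OF q])
qed auto

text \<open>
  The denominator of \<open>Q_alt_mass q k\<close> grows like \<open>q\<close> to the power \<open>k * (k + 1) / 2\<close>. The factor \<open>q\<close> on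
  the right is the true order, attained at \<open>k = 1\<close> and \<open>k = 2\<close>; a higher power of \<open>q\<close> would make the mixing
  estimate worthless for small \<open>n\<close>.
\<close>

lemma Q_alt_mass_decay:
  assumes q: "3 \<le> q"
  shows "Q_alt_mass q k * real q ^ k \<le> 9 * (1/2) ^ k * real q"
proof -
  let ?q = "real q"
  have prods: "(2/3) ^ k * ?q ^ (\<Sum>i=1..k. i) \<le> (\<Prod>i=1..k. ?q ^ i - 1)"
  proof -
    have "2/3 * ?q ^ i \<le> ?q ^ i - 1" if "i \<in> {1..k}" for i
    proof -
      have "?q ^ 1 \<le> ?q ^ i" using that q by (intro power_increasing) auto
      moreover have "3 \<le> ?q ^ 1" using q by simp
      ultimately have "3 \<le> ?q ^ i" by (rule order_trans[rotated])
      then show ?thesis by simp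
    qed
    then have "(\<Prod>i=1..k. 2/3 * ?q ^ i) \<le> (\<Prod>i=1..k. ?q ^ i - 1)"
      using q by (intro prod_mono) auto
    moreover have "(\<Prod>i=1..k. 2/3 * ?q ^ i) = (2/3) ^ k * ?q ^ (\<Sum>i=1..k. i)"
      unfolding prod.distrib power_sum by simp
    ultimately show ?thesis by simp
  qed
  have D: "(\<Prod>i. 1 - 1 / ?q ^ (2 * i + 1)) \<le> 1"
  proof -
    have "Q_alt_mass q 0 = pmf (Q_alt_e q) 0" using q by (simp add: pmf_Q_alt_e)
    then show ?thesis using pmf_le_1[of "Q_alt_e q" 0] by (simp add: Q_alt_mass_def)
  qed
  have pos: "0 < (2/3) ^ k * ?q ^ (\<Sum>i=1..k. i)" using q by simp
  have "Q_alt_mass q k * ?q ^ k \<le> 1 * (?q ^ k / (\<Prod>i=1..k. ?q ^ i - 1)) * ?q ^ k"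
    unfolding Q_alt_mass_def using order_less_le_trans[OF pos prods] q
    by (intro mult_right_mono D divide_nonneg_nonneg) auto
  also have "\<dots> = ?q ^ (2 * k) / (\<Prod>i=1..k. ?q ^ i - 1)"
    by (simp add: power_add[symmetric] mult_2)
  also have "\<dots> \<le> ?q ^ (2 * k) / ((2/3) ^ k * ?q ^ (\<Sum>i=1..k. i))"
    using order_less_le_trans[OF pos prods] pos q by (intro divide_left_mono prods mult_pos_pos) auto
  also have "\<dots> \<le> 9 * (1/2) ^ k * ?q"
  proof -
    (* Equivalent to (k - 2) * (k - 3) >= 0. *)
    have nat_ineq: "3 * k \<le> (\<Sum>i=1..k. i) + 3" for k :: nat
    proof (induction k)
      case (Suc k)
      show ?case
      proof (cases "k \<le> 2")
        case True
        then consider "k = 0" | "k = 1" | "k = 2" by linarith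
        then show ?thesis by cases (auto simp: eval_nat_numeral)
      qed (use Suc in simp)
    qed simp
    have "3 ^ k * ?q ^ (2 * k) \<le> 9 * ?q * ?q ^ (\<Sum>i=1..k. i)"
    proof (cases "k \<ge> 2")
      case True
      then obtain m where m: "k = m + 2" using le_Suc_ex add.commute by metis
      have "3 ^ m * ?q ^ (2 * k) \<le> ?q ^ m * ?q ^ (2 * k)"
        using q by (intro mult_right_mono power_mono) auto
      also have "\<dots> = ?q ^ (m + 2 * k)" by (simp add: power_add)
      also have "\<dots> \<le> ?q ^ Suc (\<Sum>i=1..k. i)"
        using q nat_ineq[of k] m by (intro power_increasing) auto
      finally show ?thesis using m by (simp add: power_add)
    next
      case False
      then consider "k = 0" | "k = 1" by linarith
      then show ?thesis using q by cases (auto simp: power2_eq_square)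
    qed
    moreover have "9 * (1/2) ^ k * ?q * ((2/3) ^ k * ?q ^ (\<Sum>i=1..k. i))
        = 9 * ?q * ?q ^ (\<Sum>i=1..k. i) / 3 ^ k"
    proof -
      have "(1/2) ^ k * (2/3) ^ k = (1/3 :: real) ^ k" by (simp flip: power_mult_distrib)
      then show ?thesis by (simp add: power_one_over field_simps)
    qed
    ultimately show ?thesis using pos
      by (subst pos_divide_le_eq[OF pos]) (simp add: pos_le_divide_eq mult.commute)
  qed
  finally show ?thesis .
qed

text \<open>
  The bound \<open>18\<close> is the sum of \<open>9 * (1/2) ^ k\<close> from the decay of the masses.
\<close>

lemma corank_limit_near_parity:
  assumes q: "3 \<le> q" and g: "\<And>r. \<bar>g r\<bar> \<le> 1" and "0 \<le> L"
    and b: "\<And>r. even (j + r) \<Longrightarrow> \<bar>g r - a\<bar> \<le> L * real q ^ r"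
  shows "\<bar>measure_pmf.expectation (corank_limit q j) g - a\<bar> \<le> 18 * L * real q"
proof -
  let ?M = "measure_pmf (corank_limit q j)"
  have int: "integrable ?M g" by (rule integrable_pmf_bounded[of _ _ 1]) (use g in auto)
  have "ennreal \<bar>measure_pmf.expectation (corank_limit q j) g - a\<bar> = ennreal \<bar>\<integral>r. g r - a \<partial>?M\<bar>"
    using int by (simp add: measure_pmf.prob_space)
  also have "\<dots> \<le> (\<integral>\<^sup>+r. ennreal \<bar>g r - a\<bar> \<partial>?M)"
    using integral_norm_bound_ennreal[of ?M "\<lambda>r. g r - a"] int by simp
  also have "\<dots> = (\<integral>\<^sup>+r. ennreal (pmf (corank_limit q j) r) * ennreal \<bar>g r - a\<bar> \<partial>count_space UNIV)"
    by (rule nn_integral_measure_pmf)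
  also have "\<dots> \<le> (\<integral>\<^sup>+r. ennreal (9 * L * real q * (1/2) ^ r) \<partial>count_space UNIV)"
  proof (intro nn_integral_mono)
    fix r
    have "pmf (corank_limit q j) r * \<bar>g r - a\<bar> \<le> 9 * L * real q * (1/2) ^ r"
    proof (cases "even (j + r)")
      case True
      have "Q_alt_mass q r * \<bar>g r - a\<bar> \<le> Q_alt_mass q r * (L * real q ^ r)"
        using q b[OF True] by (intro mult_left_mono) (auto simp: Q_alt_mass_pos less_imp_le)
      also have "\<dots> = L * (Q_alt_mass q r * real q ^ r)" by simp
      also have "\<dots> \<le> L * (9 * (1/2) ^ r * real q)"
        using \<open>0 \<le> L\<close> by (intro mult_left_mono Q_alt_mass_decay q)
      finally show ?thesis using q True by (simp add: pmf_corank_limit ac_simps)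
    qed (use q \<open>0 \<le> L\<close> in \<open>simp add: pmf_corank_limit\<close>)
    then show "ennreal (pmf (corank_limit q j) r) * ennreal \<bar>g r - a\<bar> \<le> ennreal (9 * L * real q * (1/2) ^ r)"
      by (simp add: ennreal_mult''[symmetric] ennreal_leI)
  qed
  also have "\<dots> = ennreal (\<Sum>r. 9 * L * real q * (1/2) ^ r)"
    using \<open>0 \<le> L\<close> by (subst nn_integral_count_space_nat) (auto intro!: suminf_ennreal2 summable_mult summable_geometric)
  also have "(\<Sum>r. 9 * L * real q * (1/2::real) ^ r) = 18 * L * real q"
    by (subst suminf_mult) (auto simp: suminf_geometric summable_geometric)
  finally show ?thesis using \<open>0 \<le> L\<close> by (subst (asm) ennreal_le_iff) auto
qed

section \<open>Vectors over a finite field\<close>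

(* Index sets keep the form {1..k} under simplification. *)
declare One_nat_def [simp del]

locale finite_field = field R for R (structure) +
  assumes finite_carrier [simp]: "finite (carrier R)"
begin

abbreviation q :: nat where "q \<equiv> card (carrier R)"

text \<open>
  Extensional functions: they form the carrier of \<open>func_space\<close>, in which the rank is defined, and there are
  only finitely many of them.
\<close>

definition vecs :: "nat \<Rightarrow> (nat \<Rightarrow> 'a) set" where
  "vecs k = {1..k} \<rightarrow>\<^sub>E carrier R"

definition dot :: "nat \<Rightarrow> (nat \<Rightarrow> 'a) \<Rightarrow> (nat \<Rightarrow> 'a) \<Rightarrow> 'a" where
  "dot k x y = (\<Oplus>i\<in>{1..k}. x i \<otimes> y i)"

definition comb :: "nat \<Rightarrow> (nat \<Rightarrow> 'a) \<Rightarrow> 'a \<Rightarrow> (nat \<Rightarrow> 'a) \<Rightarrow> nat \<Rightarrow> 'a" where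
  "comb k v c w = (\<lambda>i\<in>{1..k}. v i \<oplus> c \<otimes> w i)"

definition vec_subspace :: "nat \<Rightarrow> (nat \<Rightarrow> 'a) set \<Rightarrow> bool" where
  "vec_subspace k W \<longleftrightarrow> W \<subseteq> vecs k \<and> (\<lambda>i\<in>{1..k}. \<zero>) \<in> W \<and>
    (\<forall>v\<in>W. \<forall>w\<in>W. \<forall>c\<in>carrier R. comb k v c w \<in> W)"

definition kernel_vecs :: "nat \<Rightarrow> (nat \<Rightarrow> nat \<Rightarrow> 'a) \<Rightarrow> (nat \<Rightarrow> 'a) set" where
  "kernel_vecs k A = {v \<in> vecs k. \<forall>i\<in>{1..k}. dot k (A i) v = \<zero>}"

definition orthogonal :: "nat \<Rightarrow> (nat \<Rightarrow> 'a) \<Rightarrow> (nat \<Rightarrow> 'a) set \<Rightarrow> bool" where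
  "orthogonal k x W \<longleftrightarrow> (\<forall>v\<in>W. dot k x v = \<zero>)"

lemma q_ge_2: "2 \<le> q"
proof -
  have "card {\<zero>, \<one>} \<le> q" by (intro card_mono) auto
  then show ?thesis by simp
qed

lemma vecs_carrier: "v \<in> vecs k \<Longrightarrow> v \<in> {1..k} \<rightarrow> carrier R"
  by (auto simp: vecs_def PiE_def)

lemma finite_vecs [simp]: "finite (vecs k)"
  by (auto simp: vecs_def intro!: finite_PiE)

lemma card_vecs: "card (vecs k) = q ^ k"
  by (simp add: vecs_def card_PiE)

lemma dot_closed: "x \<in> {1..k} \<rightarrow> carrier R \<Longrightarrow> y \<in> {1..k} \<rightarrow> carrier R \<Longrightarrow> dot k x y \<in> carrier R"
  unfolding dot_def by (intro finsum_closed) auto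

lemma dot_cong: "(\<And>i. i \<in> {1..k} \<Longrightarrow> x i = x' i) \<Longrightarrow> (\<And>i. i \<in> {1..k} \<Longrightarrow> y i = y' i) \<Longrightarrow>
    x' \<in> {1..k} \<rightarrow> carrier R \<Longrightarrow> y' \<in> {1..k} \<rightarrow> carrier R \<Longrightarrow> dot k x y = dot k x' y'"
  unfolding dot_def by (intro finsum_cong') auto

lemma dot_commute: "x \<in> {1..k} \<rightarrow> carrier R \<Longrightarrow> y \<in> {1..k} \<rightarrow> carrier R \<Longrightarrow> dot k x y = dot k y x"
  unfolding dot_def by (intro finsum_cong') (auto simp: m_comm Pi_iff)

lemma dot_Suc:
  assumes "x \<in> {1..Suc k} \<rightarrow> carrier R" "y \<in> {1..Suc k} \<rightarrow> carrier R"
  shows "dot (Suc k) x y = dot k x y \<oplus> x (Suc k) \<otimes> y (Suc k)"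
proof -
  have "{1..Suc k} = insert (Suc k) {1..k}" by auto
  then show ?thesis using assms unfolding dot_def
    by (simp, subst finsum_insert) (auto simp: Pi_iff intro!: a_comm)
qed

lemma comb_vecs: "v \<in> vecs k \<Longrightarrow> w \<in> vecs k \<Longrightarrow> c \<in> carrier R \<Longrightarrow> comb k v c w \<in> vecs k"
  by (auto simp: comb_def vecs_def PiE_def Pi_iff)

lemma zero_vecs: "(\<lambda>i\<in>{1..k}. \<zero>) \<in> vecs k"
  by (auto simp: vecs_def)

lemma dot_comb:
  assumes "x \<in> {1..k} \<rightarrow> carrier R" "v \<in> vecs k" "w \<in> vecs k" "c \<in> carrier R"
  shows "dot k x (comb k v c w) = dot k x v \<oplus> c \<otimes> dot k x w"
proof -
  have v: "v \<in> {1..k} \<rightarrow> carrier R" "w \<in> {1..k} \<rightarrow> carrier R" using assms vecs_carrier by auto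
  have "dot k x (comb k v c w) = (\<Oplus>i\<in>{1..k}. x i \<otimes> v i \<oplus> c \<otimes> (x i \<otimes> w i))"
    unfolding dot_def comb_def using assms v
    by (intro finsum_cong') (auto simp: Pi_iff r_distr m_lcomm)
  also have "\<dots> = (\<Oplus>i\<in>{1..k}. x i \<otimes> v i) \<oplus> (\<Oplus>i\<in>{1..k}. c \<otimes> (x i \<otimes> w i))"
    using assms v by (intro finsum_addf) (auto simp: Pi_iff)
  also have "(\<Oplus>i\<in>{1..k}. c \<otimes> (x i \<otimes> w i)) = c \<otimes> dot k x w"
    unfolding dot_def using assms v by (intro finsum_rdistr[symmetric]) (auto simp: Pi_iff)
  finally show ?thesis by (simp add: dot_def)
qed

lemma dot_zero: "x \<in> {1..k} \<rightarrow> carrier R \<Longrightarrow> dot k x (\<lambda>i\<in>{1..k}. \<zero>) = \<zero>"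
  unfolding dot_def by (intro add.finprod_one_eqI) (auto simp: Pi_iff)

lemma comb_cancel:
  assumes "v \<in> vecs k" "w \<in> vecs k" "c \<in> carrier R" "d \<in> carrier R" "c \<oplus> d = \<zero>"
  shows "comb k (comb k v c w) d w = v"
proof
  fix i
  show "comb k (comb k v c w) d w i = v i"
  proof (cases "i \<in> {1..k}")
    case True
    have m: "v i \<in> carrier R" "w i \<in> carrier R" using assms True by (auto simp: vecs_def PiE_def Pi_iff)
    then have "comb k (comb k v c w) d w i = v i \<oplus> (c \<oplus> d) \<otimes> w i"
      using assms(3,4) True by (simp add: comb_def l_distr a_assoc)
    then show ?thesis using m assms(5) by simp
  qed (use assms in \<open>auto simp: comb_def vecs_def PiE_def extensional_def\<close>)
qed

lemma vec_subspace_vecs: "vec_subspace k (vecs k)"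
  by (simp add: vec_subspace_def zero_vecs comb_vecs)

lemma vec_subspace_kernel:
  assumes "vec_subspace k W" "\<And>i. i \<in> I \<Longrightarrow> x i \<in> {1..k} \<rightarrow> carrier R"
  shows "vec_subspace k {v \<in> W. \<forall>i\<in>I. dot k (x i) v = \<zero>}"
  unfolding vec_subspace_def
proof (intro conjI ballI)
  fix v w c assume vw: "v \<in> {v \<in> W. \<forall>i\<in>I. dot k (x i) v = \<zero>}" "w \<in> {v \<in> W. \<forall>i\<in>I. dot k (x i) v = \<zero>}" "c \<in> carrier R"
  then have "v \<in> vecs k" "w \<in> vecs k" using assms(1) by (auto simp: vec_subspace_def)
  then show "comb k v c w \<in> {v \<in> W. \<forall>i\<in>I. dot k (x i) v = \<zero>}"
    using vw assms by (auto simp: vec_subspace_def dot_comb)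
qed (use assms in \<open>auto simp: vec_subspace_def dot_zero\<close>)

text \<open>
  A linear functional with a nonzero value at \<open>w\<close> splits \<open>W\<close> into its kernel and the multiples of \<open>w\<close>.
\<close>

lemma card_subspace_functional:
  assumes W: "vec_subspace k W" and f: "\<And>v. v \<in> W \<Longrightarrow> f v \<in> carrier R"
    and lin: "\<And>v w c. v \<in> W \<Longrightarrow> w \<in> W \<Longrightarrow> c \<in> carrier R \<Longrightarrow> f (comb k v c w) = f v \<oplus> c \<otimes> f w"
    and w: "w \<in> W" "f w \<noteq> \<zero>"
  shows "card W = q * card {v \<in> W. f v = \<zero>}"
proof -
  (* The isomorphism from the product of the field with the kernel of f, and its inverse. *)
  let ?g = "\<lambda>(c, v). comb k v c w"
  let ?h = "\<lambda>v. (f v \<otimes> inv (f w), comb k v (\<ominus> (f v \<otimes> inv (f w))) w)"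
  have inv: "inv (f w) \<in> carrier R" "inv (f w) \<otimes> f w = \<one>" "f w \<otimes> inv (f w) = \<one>"
    using w f field_Units by auto
  have sub: "v \<in> W \<Longrightarrow> v \<in> vecs k" for v using W by (auto simp: vec_subspace_def)
  have cl: "v \<in> W \<Longrightarrow> c \<in> carrier R \<Longrightarrow> comb k v c w \<in> W" for v c
    using W w by (auto simp: vec_subspace_def)
  have coef: "f v \<otimes> inv (f w) \<in> carrier R" if "v \<in> W" for v using that f inv by auto
  have "bij_betw ?g (carrier R \<times> {v \<in> W. f v = \<zero>}) W"
  proof (rule bij_betw_byWitness[where f' = ?h])
    show "\<forall>a\<in>carrier R \<times> {v \<in> W. f v = \<zero>}. ?h (?g a) = a"
    proof
      fix a assume "a \<in> carrier R \<times> {v \<in> W. f v = \<zero>}"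
      then obtain c v where a: "a = (c, v)" and v: "c \<in> carrier R" "v \<in> W" "f v = \<zero>"
        by auto
      have "f (comb k v c w) \<otimes> inv (f w) = c"
      proof -
        have "f (comb k v c w) = c \<otimes> f w" using v(1,3) f[OF w(1)] by (simp add: lin[OF v(2) w(1) v(1)])
        then show ?thesis using v(1) f[OF w(1)] inv(1,3) by (simp add: m_assoc)
      qed
      moreover have "comb k (comb k v c w) (\<ominus> c) w = v"
        using v(1) by (intro comb_cancel sub v w a_inv_closed r_neg)
      ultimately show "?h (?g a) = a" using a by simp
    qed
    show "\<forall>v\<in>W. ?g (?h v) = v"
    proof
      fix v assume v: "v \<in> W"
      have "comb k (comb k v (\<ominus> (f v \<otimes> inv (f w))) w) (f v \<otimes> inv (f w)) w = v"
        using coef[OF v] by (intro comb_cancel sub v w a_inv_closed l_neg)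
      then show "?g (?h v) = v" by simp
    qed
    show "?g ` (carrier R \<times> {v \<in> W. f v = \<zero>}) \<subseteq> W"
      by (auto intro: cl)
    show "?h ` W \<subseteq> carrier R \<times> {v \<in> W. f v = \<zero>}"
    proof safe
      fix v assume v: "v \<in> W"
      have "f v \<otimes> inv (f w) \<otimes> f w = f v" using f[OF v] f[OF w(1)] inv(1,2) by (simp add: m_assoc)
      then show "f (comb k v (\<ominus> (f v \<otimes> inv (f w))) w) = \<zero>"
        using f[OF v] f[OF w(1)] coef[OF v] by (simp add: lin[OF v w(1)] l_minus r_neg)
    qed (auto intro!: cl coef a_inv_closed)
  qed
  from bij_betw_same_card[OF this] show ?thesis by (simp add: card_cartesian_product)
qed

lemma card_perp:
  assumes W: "vec_subspace k W" and x: "x \<in> {1..k} \<rightarrow> carrier R" and no: "\<not> orthogonal k x W"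
  shows "card W = q * card {v \<in> W. dot k x v = \<zero>}"
proof -
  obtain w where w: "w \<in> W" "dot k x w \<noteq> \<zero>" using no by (auto simp: orthogonal_def)
  have "v \<in> W \<Longrightarrow> v \<in> vecs k" for v using W by (auto simp: vec_subspace_def)
  note sub = this
  have "card W = q * card {v \<in> W. dot k x v = \<zero>}"
  proof (rule card_subspace_functional[OF W])
    show "dot k x v \<in> carrier R" if "v \<in> W" for v
      using x vecs_carrier[OF sub[OF that]] by (rule dot_closed)
    show "dot k x (comb k v c w) = dot k x v \<oplus> c \<otimes> dot k x w"
      if "v \<in> W" "w \<in> W" "c \<in> carrier R" for v w c
      using x sub[OF that(1)] sub[OF that(2)] that(3) by (rule dot_comb)
  qed fact+
  then show ?thesis .
qed

lemma finite_subspace: "vec_subspace k W \<Longrightarrow> finite W"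
  unfolding vec_subspace_def using finite_subset finite_vecs by blast

text \<open>
  This is the sum of all nontrivial additive characters of the field at \<open>dot k x v\<close>.
\<close>

definition hyperplane_weight :: "nat \<Rightarrow> (nat \<Rightarrow> 'a) \<Rightarrow> (nat \<Rightarrow> 'a) \<Rightarrow> real" where
  "hyperplane_weight k x v = real q * of_bool (dot k x v = \<zero>) - 1"

text \<open>
  Either every weight is \<open>q - 1\<close>, or exactly one vector of \<open>W\<close> in \<open>q\<close> is orthogonal to \<open>x\<close> and the weights
  cancel.
\<close>

lemma sum_hyperplane_weight:
  assumes W: "vec_subspace k W" and x: "x \<in> {1..k} \<rightarrow> carrier R"
  shows "(\<Sum>v\<in>W. hyperplane_weight k x v) = of_bool (orthogonal k x W) * (real q - 1) * card W"
proof -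
  have fin: "finite W" by (rule finite_subspace[OF W])
  have "(\<Sum>v\<in>W. hyperplane_weight k x v) = real q * card {v \<in> W. dot k x v = \<zero>} - card W"
    using fin by (simp add: hyperplane_weight_def sum_subtractf sum_distrib_left[symmetric] of_bool_def
        sum.If_cases Int_def)
  also have "\<dots> = of_bool (orthogonal k x W) * (real q - 1) * card W"
  proof (cases "orthogonal k x W")
    case True
    then have "{v \<in> W. dot k x v = \<zero>} = W" by (auto simp: orthogonal_def)
    then show ?thesis using True by (simp add: algebra_simps)
  next
    case False
    then show ?thesis using card_perp[OF W x False] by simp
  qed
  finally show ?thesis .
qed

lemma orthogonal_vecs:
  assumes x: "x \<in> {1..k} \<rightarrow> carrier R"
  shows "orthogonal k x (vecs k) \<longleftrightarrow> (\<forall>i\<in>{1..k}. x i = \<zero>)"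
proof
  assume o: "orthogonal k x (vecs k)"
  show "\<forall>i\<in>{1..k}. x i = \<zero>"
  proof
    fix i assume i: "i \<in> {1..k}"
    let ?e = "\<lambda>j\<in>{1..k}. if i = j then \<one> else \<zero>"
    have "?e \<in> vecs k" by (auto simp: vecs_def)
    then have "\<zero> = dot k x ?e" using o by (auto simp: orthogonal_def)
    also have "\<dots> = (\<Oplus>j\<in>{1..k}. if i = j then x j else \<zero>)"
      unfolding dot_def using x by (intro finsum_cong') (auto simp: Pi_iff)
    also have "\<dots> = x i" using x i by (intro add.finprod_singleton) auto
    finally show "x i = \<zero>" by simp
  qed
next
  assume z: "\<forall>i\<in>{1..k}. x i = \<zero>"
  show "orthogonal k x (vecs k)" unfolding orthogonal_def dot_def
    using z by (auto intro!: add.finprod_one_eqI simp: vecs_def PiE_def Pi_iff)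
qed

text \<open>
  Sum the weights over all pairs of a vector \<open>x\<close> and an element \<open>v\<close> of \<open>W\<close>, in both orders. For fixed \<open>x\<close>
  only the elements of the complement contribute, for fixed \<open>v\<close> only \<open>v = 0\<close>.
\<close>

lemma card_orthogonal_complement:
  assumes W: "vec_subspace k W"
  shows "card {x \<in> vecs k. orthogonal k x W} * card W = q ^ k"
proof -
  have sub: "v \<in> W \<Longrightarrow> v \<in> vecs k" for v using W by (auto simp: vec_subspace_def)
  have fin: "finite W" by (rule finite_subspace[OF W])
  have z: "(\<lambda>i\<in>{1..k}. \<zero>) \<in> W" using W by (auto simp: vec_subspace_def)
  have "(real q - 1) * (card {x \<in> vecs k. orthogonal k x W} * card W)
     = (\<Sum>x\<in>vecs k. of_bool (orthogonal k x W) * (real q - 1) * card W)"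
    by (simp add: sum_distrib_right[symmetric] of_bool_def sum.If_cases Int_def)
  also have "\<dots> = (\<Sum>x\<in>vecs k. \<Sum>v\<in>W. hyperplane_weight k x v)"
    by (intro sum.cong refl sum_hyperplane_weight[OF W, symmetric] vecs_carrier)
  also have "\<dots> = (\<Sum>v\<in>W. \<Sum>x\<in>vecs k. hyperplane_weight k v x)"
    by (subst sum.swap) (auto simp: hyperplane_weight_def sub dot_commute vecs_carrier intro!: sum.cong)
  also have "\<dots> = (\<Sum>v\<in>W. of_bool (v = (\<lambda>i\<in>{1..k}. \<zero>)) * (real q - 1) * q ^ k)"
  proof (intro sum.cong refl)
    fix v assume v: "v \<in> W"
    have "(\<forall>i\<in>{1..k}. v i = \<zero>) \<longleftrightarrow> v = (\<lambda>i\<in>{1..k}. \<zero>)"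
      using sub[OF v] by (auto simp: vecs_def PiE_def extensional_def restrict_def fun_eq_iff)
    then show "(\<Sum>x\<in>vecs k. hyperplane_weight k v x) = of_bool (v = (\<lambda>i\<in>{1..k}. \<zero>)) * (real q - 1) * q ^ k"
      using sum_hyperplane_weight[OF vec_subspace_vecs vecs_carrier[OF sub[OF v]]]
        orthogonal_vecs[OF vecs_carrier[OF sub[OF v]]] by (simp add: card_vecs)
  qed
  also have "\<dots> = (real q - 1) * real (q ^ k)"
    using fin z by (simp add: sum_distrib_right[symmetric] of_bool_def)
  finally have "real (card {x \<in> vecs k. orthogonal k x W} * card W) = real (q ^ k)"
    using q_ge_2 by simp
  then show ?thesis by (simp only: of_nat_eq_iff)
qed

section \<open>Alternating matrices and their leading blocks\<close>

definition square_matrix :: "nat \<Rightarrow> (nat \<Rightarrow> nat \<Rightarrow> 'a) \<Rightarrow> bool" where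
  "square_matrix k A \<longleftrightarrow> (\<forall>i\<in>{1..k}. \<forall>j\<in>{1..k}. A i j \<in> carrier R)"

definition mat_vec :: "nat \<Rightarrow> (nat \<Rightarrow> nat \<Rightarrow> 'a) \<Rightarrow> (nat \<Rightarrow> 'a) \<Rightarrow> nat \<Rightarrow> 'a" where
  "mat_vec k A v = (\<lambda>i\<in>{1..k}. dot k (A i) v)"

lemma square_matrix_row: "square_matrix k A \<Longrightarrow> i \<in> {1..k} \<Longrightarrow> A i \<in> {1..k} \<rightarrow> carrier R"
  by (auto simp: square_matrix_def)

lemma alternating_square: "alternating_matrix R k A \<Longrightarrow> square_matrix k A"
  unfolding square_matrix_def alternating_matrix_def by blast

lemma mat_vec_vecs:
  assumes "square_matrix k A" "v \<in> vecs k"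
  shows "mat_vec k A v \<in> vecs k"
proof -
  have "dot k (A i) v \<in> carrier R" if "i \<in> {1..k}" for i
    by (rule dot_closed[OF square_matrix_row[OF assms(1) that] vecs_carrier[OF assms(2)]])
  then show ?thesis by (simp add: mat_vec_def vecs_def del: atLeastAtMost_iff)
qed

lemma vec_subspace_kernel_vecs:
  assumes "square_matrix k A"
  shows "vec_subspace k (kernel_vecs k A)"
  unfolding kernel_vecs_def
  by (rule vec_subspace_kernel[OF vec_subspace_vecs]) (rule square_matrix_row[OF assms])

lemma mat_vec_comb:
  assumes "square_matrix k A" "v \<in> vecs k" "w \<in> vecs k" "c \<in> carrier R"
  shows "mat_vec k A (comb k v c w) = comb k (mat_vec k A v) c (mat_vec k A w)"
proof
  fix i
  have "dot k (A i) (comb k v c w) = dot k (A i) v \<oplus> c \<otimes> dot k (A i) w" if "i \<in> {1..k}"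
    by (rule dot_comb[OF square_matrix_row[OF assms(1) that] assms(2-4)])
  then show "mat_vec k A (comb k v c w) i = comb k (mat_vec k A v) c (mat_vec k A w) i"
    by (cases "i \<in> {1..k}") (simp_all add: mat_vec_def comb_def del: atLeastAtMost_iff)
qed

lemma kernel_vecs_mat_vec: "kernel_vecs k A = {v \<in> vecs k. mat_vec k A v = (\<lambda>i\<in>{1..k}. \<zero>)}"
proof -
  have "(\<forall>i\<in>{1..k}. dot k (A i) v = \<zero>) \<longleftrightarrow> mat_vec k A v = (\<lambda>i\<in>{1..k}. \<zero>)" for v
    unfolding mat_vec_def restrict_def fun_eq_iff by auto
  then show ?thesis by (simp add: kernel_vecs_def)
qed

text \<open>
  The fibres of a linear map over its image are translates of the kernel.
\<close>

lemma card_image_kernel: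
  assumes A: "square_matrix k A"
  shows "card (mat_vec k A ` vecs k) * card (kernel_vecs k A) = q ^ k"
proof -
  have "card {v \<in> vecs k. mat_vec k A v = mat_vec k A w} = card (kernel_vecs k A)" if w: "w \<in> vecs k" for w
  proof (rule bij_betw_same_card[OF bij_betw_byWitness[where f' = "\<lambda>v. comb k v \<one> w"]])
    let ?f = "\<lambda>v. comb k v (\<ominus> \<one>) w"
    have y: "mat_vec k A w \<in> vecs k" by (rule mat_vec_vecs[OF A w])
    have zero_comb: "comb k (\<lambda>i\<in>{1..k}. \<zero>) \<one> (mat_vec k A w) = mat_vec k A w"
    proof
      fix i show "comb k (\<lambda>i\<in>{1..k}. \<zero>) \<one> (mat_vec k A w) i = mat_vec k A w i"
        using y[unfolded vecs_def, THEN PiE_mem, of i]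
        by (cases "i \<in> {1..k}") (simp_all add: comb_def mat_vec_def del: atLeastAtMost_iff)
    qed
    have cancel: "comb k (comb k v c w) (\<ominus> c) w = v" "comb k (comb k v (\<ominus> c) w) c w = v"
      if "v \<in> vecs k" "c \<in> carrier R" for v c
      using that by (auto intro!: comb_cancel w simp: l_neg r_neg)
    show "\<forall>a\<in>{v \<in> vecs k. mat_vec k A v = mat_vec k A w}. comb k (?f a) \<one> w = a"
      using cancel(2) by blast
    show "\<forall>a\<in>kernel_vecs k A. ?f (comb k a \<one> w) = a"
      using cancel(1) unfolding kernel_vecs_def by blast
    show "?f ` {v \<in> vecs k. mat_vec k A v = mat_vec k A w} \<subseteq> kernel_vecs k A"
    proof safe
      fix v assume v: "v \<in> vecs k" "mat_vec k A v = mat_vec k A w"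
      have "mat_vec k A (?f v) = comb k (comb k (\<lambda>i\<in>{1..k}. \<zero>) \<one> (mat_vec k A w)) (\<ominus> \<one>) (mat_vec k A w)"
        unfolding zero_comb using mat_vec_comb[OF A v(1) w, of "\<ominus> \<one>"] v(2) by simp
      also have "\<dots> = (\<lambda>i\<in>{1..k}. \<zero>)"
        by (rule comb_cancel[OF zero_vecs y]) (simp_all add: r_neg)
      finally show "?f v \<in> kernel_vecs k A"
        using v(1) w by (simp add: kernel_vecs_mat_vec comb_vecs)
    qed
    show "(\<lambda>v. comb k v \<one> w) ` kernel_vecs k A \<subseteq> {v \<in> vecs k. mat_vec k A v = mat_vec k A w}"
    proof safe
      fix v assume "v \<in> kernel_vecs k A"
      then have v: "v \<in> vecs k" "mat_vec k A v = (\<lambda>i\<in>{1..k}. \<zero>)" by (simp_all add: kernel_vecs_mat_vec)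
      show "comb k v \<one> w \<in> vecs k" using v(1) w by (simp add: comb_vecs)
      show "mat_vec k A (comb k v \<one> w) = mat_vec k A w"
        using mat_vec_comb[OF A v(1) w, of \<one>] v(2) zero_comb by simp
    qed
  qed
  then have "(\<Sum>y\<in>mat_vec k A ` vecs k. card {v \<in> vecs k. mat_vec k A v = y})
      = (\<Sum>y\<in>mat_vec k A ` vecs k. card (kernel_vecs k A))"
    by (intro sum.cong) auto
  moreover have "(\<Sum>y\<in>mat_vec k A ` vecs k. card {v \<in> vecs k. mat_vec k A v = y}) = card (vecs k)"
    using sum.image_gen[of "vecs k" "\<lambda>_. 1::nat" "mat_vec k A"] by simp
  ultimately show ?thesis by (simp add: card_vecs)
qed

lemma dot_mat_vec_alternating:
  assumes A: "alternating_matrix R k A" and u: "u \<in> vecs k" and v: "v \<in> vecs k"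
  shows "dot k (mat_vec k A u) v = \<ominus> dot k (mat_vec k A v) u"
proof -
  have cu: "u i \<in> carrier R" "v i \<in> carrier R" if "i \<in> {1..k}" for i using u v that by (auto simp: vecs_def)
  have cA: "A i j \<in> carrier R" "A j i = \<ominus> A i j" if "i \<in> {1..k}" "j \<in> {1..k}" for i j
    using A that unfolding alternating_matrix_def by blast+
  have expand: "dot k (mat_vec k A x) y = (\<Oplus>i\<in>{1..k}. \<Oplus>j\<in>{1..k}. A i j \<otimes> x j \<otimes> y i)"
    if "\<And>i. i \<in> {1..k} \<Longrightarrow> x i \<in> carrier R" "\<And>i. i \<in> {1..k} \<Longrightarrow> y i \<in> carrier R" for x y
  proof -
    have "dot k (mat_vec k A x) y = (\<Oplus>i\<in>{1..k}. (\<Oplus>j\<in>{1..k}. A i j \<otimes> x j) \<otimes> y i)"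
      unfolding dot_def mat_vec_def using that cA(1)
      by (intro finsum_cong') (auto intro!: finsum_closed)
    also have "\<dots> = (\<Oplus>i\<in>{1..k}. \<Oplus>j\<in>{1..k}. A i j \<otimes> x j \<otimes> y i)"
      using that cA(1) by (intro finsum_cong' finsum_ldistr) (auto intro!: finsum_closed)
    finally show ?thesis .
  qed
  have "dot k (mat_vec k A u) v = (\<Oplus>i\<in>{1..k}. \<Oplus>j\<in>{1..k}. A i j \<otimes> u j \<otimes> v i)"
    by (intro expand cu)
  also have "\<dots> = (\<Oplus>j\<in>{1..k}. \<Oplus>i\<in>{1..k}. A i j \<otimes> u j \<otimes> v i)"
    using cu cA(1) by (intro finsum_finsum_swap) auto
  also have "\<dots> = (\<Oplus>j\<in>{1..k}. \<Oplus>i\<in>{1..k}. (\<ominus> \<one>) \<otimes> (A j i \<otimes> v i \<otimes> u j))"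
  proof (intro finsum_cong' refl)
    fix i j assume "j \<in> {1..k}" "i \<in> {1..k}"
    then have c: "u j \<in> carrier R" "v i \<in> carrier R" "A j i \<in> carrier R" and a: "A i j = \<ominus> A j i"
      using cu cA by blast+
    have "A i j \<otimes> u j \<otimes> v i = \<ominus> (A j i \<otimes> (u j \<otimes> v i))"
      unfolding a using c by (simp add: l_minus m_assoc)
    also have "u j \<otimes> v i = v i \<otimes> u j" using c by (simp add: m_comm)
    also have "\<ominus> (A j i \<otimes> (v i \<otimes> u j)) = (\<ominus> \<one>) \<otimes> (A j i \<otimes> v i \<otimes> u j)"
      using c by (simp add: l_minus m_assoc)
    finally show "A i j \<otimes> u j \<otimes> v i = (\<ominus> \<one>) \<otimes> (A j i \<otimes> v i \<otimes> u j)" .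
  qed (simp_all add: Pi_iff cu cA(1) finsum_closed del: atLeastAtMost_iff)
  also have "\<dots> = (\<ominus> \<one>) \<otimes> (\<Oplus>j\<in>{1..k}. \<Oplus>i\<in>{1..k}. A j i \<otimes> v i \<otimes> u j)"
  proof -
    have "(\<Oplus>j\<in>{1..k}. \<Oplus>i\<in>{1..k}. (\<ominus> \<one>) \<otimes> (A j i \<otimes> v i \<otimes> u j))
        = (\<Oplus>j\<in>{1..k}. (\<ominus> \<one>) \<otimes> (\<Oplus>i\<in>{1..k}. (A j i \<otimes> v i \<otimes> u j)))"
      using cu cA(1) by (intro finsum_cong' finsum_rdistr[symmetric]) (auto intro!: finsum_closed)
    also have "\<dots> = (\<ominus> \<one>) \<otimes> (\<Oplus>j\<in>{1..k}. \<Oplus>i\<in>{1..k}. A j i \<otimes> v i \<otimes> u j)"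
      using cu cA(1) by (intro finsum_rdistr[symmetric]) (auto intro!: finsum_closed)
    finally show ?thesis .
  qed
  also have "(\<Oplus>j\<in>{1..k}. \<Oplus>i\<in>{1..k}. A j i \<otimes> v i \<otimes> u j) = dot k (mat_vec k A v) u"
    by (intro expand[symmetric] cu)
  also have "\<ominus> \<one> \<otimes> dot k (mat_vec k A v) u = \<ominus> dot k (mat_vec k A v) u"
  proof -
    have "dot k (mat_vec k A v) u \<in> carrier R"
      by (intro dot_closed vecs_carrier[OF mat_vec_vecs[OF alternating_square[OF A] v]] vecs_carrier[OF u])
    then show ?thesis by (simp add: l_minus)
  qed
  finally show ?thesis .
qed

lemma alternating_Suc: "alternating_matrix R (Suc k) A \<Longrightarrow> alternating_matrix R k A"
  unfolding alternating_matrix_def by (meson atLeastAtMost_iff le_SucI)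

lemma restrict_vecs: "v \<in> vecs (Suc k) \<Longrightarrow> restrict v {1..k} \<in> vecs k"
  by (auto simp: vecs_def)

lemma upd_vecs: "v \<in> vecs k \<Longrightarrow> c \<in> carrier R \<Longrightarrow> v(Suc k := c) \<in> vecs (Suc k)"
  by (auto simp: vecs_def PiE_def extensional_def Pi_iff le_Suc_eq)

text \<open>
  In block form \<open>A\<close> has the rows \<open>(A', x)\<close> and \<open>(- x, 0)\<close>, where \<open>A'\<close> is its leading block.
\<close>

lemma mat_vec_Suc:
  assumes A: "alternating_matrix R (Suc k) A" and v: "v \<in> vecs (Suc k)"
  defines "x \<equiv> \<lambda>i\<in>{1..k}. A i (Suc k)"
  shows "restrict (mat_vec (Suc k) A v) {1..k} = comb k (mat_vec k A (restrict v {1..k})) (v (Suc k)) x"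
    and "mat_vec (Suc k) A v (Suc k) = \<ominus> dot k x (restrict v {1..k})"
proof -
  let ?w = "restrict v {1..k}"
  have w: "?w \<in> vecs k" by (rule restrict_vecs[OF v])
  have cA: "A i j \<in> carrier R" "A j i = \<ominus> A i j" "A i i = \<zero>" if "i \<in> {1..Suc k}" "j \<in> {1..Suc k}" for i j
    using A that unfolding alternating_matrix_def by blast+
  have cv: "v i \<in> carrier R" if "i \<in> {1..Suc k}" for i
    using v that by (auto simp: vecs_def)
  have x: "x \<in> vecs k" using cA(1) by (auto simp: x_def vecs_def)
  have xc: "x i \<in> carrier R" and wc: "v i \<in> carrier R" if "i \<in> {1..k}" for i
    using x cv that unfolding vecs_def by auto
  have expand: "dot (Suc k) (A i) v = dot k (A i) ?w \<oplus> A i (Suc k) \<otimes> v (Suc k)" if "i \<in> {1..Suc k}" for i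
  proof -
    have "dot k (A i) v = dot k (A i) ?w"
      using that cA(1) cv by (intro dot_cong) auto
    then show ?thesis
      using that cA(1) cv by (subst dot_Suc) auto
  qed
  show "restrict (mat_vec (Suc k) A v) {1..k} = comb k (mat_vec k A ?w) (v (Suc k)) x"
    unfolding comb_def
  proof (rule restrict_ext)
    fix i assume i: "i \<in> {1..k}"
    then have "mat_vec (Suc k) A v i = dot k (A i) ?w \<oplus> A i (Suc k) \<otimes> v (Suc k)"
      using expand[of i] by (simp add: mat_vec_def)
    moreover have "A i (Suc k) \<otimes> v (Suc k) = v (Suc k) \<otimes> A i (Suc k)"
      using i cv by (intro m_comm cA(1)) auto
    ultimately show "mat_vec (Suc k) A v i = mat_vec k A ?w i \<oplus> v (Suc k) \<otimes> x i"
      using i by (simp add: mat_vec_def x_def)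
  qed
  have r: "A (Suc k) \<in> {1..k} \<rightarrow> carrier R" using cA(1) by auto
  have "mat_vec (Suc k) A v (Suc k) = dot (Suc k) (A (Suc k)) v" by (simp add: mat_vec_def)
  also have "\<dots> = dot k (A (Suc k)) ?w"
    using expand[of "Suc k"] cA(3)[of "Suc k" "Suc k"] cv[of "Suc k"]
    by (simp add: dot_closed[OF r vecs_carrier[OF w], simplified])
  also have "\<dots> = (\<Oplus>i\<in>{1..k}. (\<ominus> \<one>) \<otimes> (x i \<otimes> ?w i))"
    unfolding dot_def
  proof (intro finsum_cong' refl)
    fix i assume i: "i \<in> {1..k}"
    have "A (Suc k) i = \<ominus> x i" using i by (simp add: x_def cA(2)[of i "Suc k"])
    then show "A (Suc k) i \<otimes> ?w i = (\<ominus> \<one>) \<otimes> (x i \<otimes> ?w i)"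
      using i xc wc by (simp add: l_minus)
  qed (simp add: Pi_iff xc wc del: atLeastAtMost_iff)
  also have "\<dots> = (\<ominus> \<one>) \<otimes> dot k x ?w"
    unfolding dot_def by (intro finsum_rdistr[symmetric]) (simp_all add: Pi_iff xc wc del: atLeastAtMost_iff)
  also have "\<dots> = \<ominus> dot k x ?w" using dot_closed[OF vecs_carrier[OF x] vecs_carrier[OF w]] by (simp add: l_minus)
  finally show "mat_vec (Suc k) A v (Suc k) = \<ominus> dot k x ?w" .
qed

text \<open>
  By the block form and the zero on the diagonal, a new row and column add two terms to the quadratic form,
  which cancel.
\<close>

lemma dot_mat_vec_self:
  assumes "alternating_matrix R k A" "u \<in> vecs k"
  shows "dot k (mat_vec k A u) u = \<zero>"
  using assms
proof (induction k arbitrary: u)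
  case (Suc k)
  let ?w = "restrict u {1..k}" and ?x = "\<lambda>i\<in>{1..k}. A i (Suc k)" and ?y = "mat_vec (Suc k) A u"
  have A: "alternating_matrix R k A" by (rule alternating_Suc[OF Suc.prems(1)])
  have w: "?w \<in> vecs k" by (rule restrict_vecs[OF Suc.prems(2)])
  have x: "?x \<in> vecs k" using alternating_square[OF Suc.prems(1)] by (auto simp: square_matrix_def vecs_def)
  have y: "?y \<in> vecs (Suc k)" by (rule mat_vec_vecs[OF alternating_square[OF Suc.prems(1)] Suc.prems(2)])
  have m: "mat_vec k A ?w \<in> vecs k" by (rule mat_vec_vecs[OF alternating_square[OF A] w])
  have c: "u (Suc k) \<in> carrier R" using Suc.prems(2) by (auto simp: vecs_def)
  have d: "dot k ?x ?w \<in> carrier R" by (intro dot_closed vecs_carrier x w)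
  have "dot k ?y u = dot k (restrict ?y {1..k}) ?w"
    using vecs_carrier[OF restrict_vecs[OF y]] vecs_carrier[OF w] by (intro dot_cong) auto
  also have "\<dots> = dot k ?w (comb k (mat_vec k A ?w) (u (Suc k)) ?x)"
    unfolding mat_vec_Suc(1)[OF Suc.prems] by (intro dot_commute vecs_carrier w comb_vecs m c x)
  also have "\<dots> = dot k ?w (mat_vec k A ?w) \<oplus> u (Suc k) \<otimes> dot k ?w ?x"
    by (intro dot_comb vecs_carrier w m c x)
  also have "dot k ?w (mat_vec k A ?w) = \<zero>"
    by (rule trans[OF dot_commute[OF vecs_carrier[OF w] vecs_carrier[OF m]] Suc.IH[OF A w]])
  also have "dot k ?w ?x = dot k ?x ?w" by (intro dot_commute vecs_carrier w x)
  finally have "dot k ?y u = u (Suc k) \<otimes> dot k ?x ?w" using c d by simp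
  moreover have "?y (Suc k) \<otimes> u (Suc k) = \<ominus> (u (Suc k) \<otimes> dot k ?x ?w)"
    unfolding mat_vec_Suc(2)[OF Suc.prems] using c d by (simp add: l_minus m_comm[of "u (Suc k)"])
  ultimately show ?case
    using dot_Suc[OF vecs_carrier[OF y] vecs_carrier[OF Suc.prems(2)]] c d by (simp add: r_neg)
qed (simp add: dot_def)

text \<open>
  The image is orthogonal to the kernel by antisymmetry, and both sides have \<open>q ^ k / card (kernel_vecs k A)\<close>
  elements.
\<close>

lemma mat_vec_image:
  assumes A: "alternating_matrix R k A"
  shows "mat_vec k A ` vecs k = {x \<in> vecs k. orthogonal k x (kernel_vecs k A)}"
proof (rule card_subset_eq)
  have sq: "square_matrix k A" by (rule alternating_square[OF A])
  show "mat_vec k A ` vecs k \<subseteq> {x \<in> vecs k. orthogonal k x (kernel_vecs k A)}"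
  proof (safe, rule mat_vec_vecs[OF sq])
    fix u assume u: "u \<in> vecs k"
    have "dot k (mat_vec k A u) v = \<zero>" if v: "v \<in> kernel_vecs k A" for v
    proof -
      have "dot k (mat_vec k A u) v = \<ominus> dot k (mat_vec k A v) u"
        using v by (intro dot_mat_vec_alternating A u) (simp add: kernel_vecs_def)
      also have "mat_vec k A v = (\<lambda>i\<in>{1..k}. \<zero>)" using v by (simp add: kernel_vecs_mat_vec)
      also have "dot k (\<lambda>i\<in>{1..k}. \<zero>) u = dot k u (\<lambda>i\<in>{1..k}. \<zero>)"
        by (intro dot_commute vecs_carrier u zero_vecs)
      also have "\<dots> = \<zero>" by (intro dot_zero vecs_carrier u)
      finally show ?thesis by simp
    qed
    then show "orthogonal k (mat_vec k A u) (kernel_vecs k A)" by (simp add: orthogonal_def)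
  qed
  have "(\<lambda>i\<in>{1..k}. \<zero>) \<in> kernel_vecs k A" "finite (kernel_vecs k A)"
    using vec_subspace_kernel_vecs[OF sq] finite_subspace by (auto simp: vec_subspace_def)
  then have "0 < card (kernel_vecs k A)" by (auto simp: card_gt_0_iff)
  then show "card (mat_vec k A ` vecs k) = card {x \<in> vecs k. orthogonal k x (kernel_vecs k A)}"
    using card_image_kernel[OF sq] card_orthogonal_complement[OF vec_subspace_kernel_vecs[OF sq]]
    by (metis mult_right_cancel not_gr_zero)
qed simp

lemma kernel_vecs_Suc_iff:
  assumes A: "alternating_matrix R (Suc k) A" and v: "v \<in> vecs (Suc k)"
  defines "x \<equiv> \<lambda>i\<in>{1..k}. A i (Suc k)"
  shows "v \<in> kernel_vecs (Suc k) A \<longleftrightarrow>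
    mat_vec k A (restrict v {1..k}) = comb k (\<lambda>i\<in>{1..k}. \<zero>) (\<ominus> v (Suc k)) x \<and> dot k x (restrict v {1..k}) = \<zero>"
proof -
  let ?w = "restrict v {1..k}"
  have w: "?w \<in> vecs k" by (rule restrict_vecs[OF v])
  have x: "x \<in> vecs k" using alternating_square[OF A] by (auto simp: x_def square_matrix_def vecs_def)
  have y: "mat_vec k A ?w \<in> vecs k" by (rule mat_vec_vecs[OF alternating_square[OF alternating_Suc[OF A]] w])
  have c: "v (Suc k) \<in> carrier R" using v by (auto simp: vecs_def)
  have "mat_vec (Suc k) A v i = \<zero> \<longleftrightarrow> mat_vec k A ?w i = comb k (\<lambda>i\<in>{1..k}. \<zero>) (\<ominus> v (Suc k)) x i"
    if i: "i \<in> {1..k}" for i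
  proof -
    have m: "x i \<in> carrier R" "mat_vec k A ?w i \<in> carrier R" using x y i unfolding vecs_def by blast+
    have "mat_vec (Suc k) A v i = mat_vec k A ?w i \<oplus> v (Suc k) \<otimes> x i"
      using fun_cong[OF mat_vec_Suc(1)[OF A v], of i] i by (simp add: comb_def x_def)
    moreover have "comb k (\<lambda>i\<in>{1..k}. \<zero>) (\<ominus> v (Suc k)) x i = \<ominus> (v (Suc k) \<otimes> x i)"
      using i c m by (simp add: comb_def l_minus)
    moreover have "a \<oplus> b = \<zero> \<longleftrightarrow> a = \<ominus> b" if "a \<in> carrier R" "b \<in> carrier R" for a b
      using that sum_zero_eq_neg l_neg by blast
    ultimately show ?thesis using m c by simp
  qed
  moreover have "mat_vec (Suc k) A v (Suc k) = \<zero> \<longleftrightarrow> dot k x ?w = \<zero>"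
    using mat_vec_Suc(2)[OF A v] dot_closed[OF vecs_carrier[OF x] vecs_carrier[OF w]] by (simp add: x_def)
  moreover have "v \<in> kernel_vecs (Suc k) A \<longleftrightarrow>
      (\<forall>i\<in>{1..k}. mat_vec (Suc k) A v i = \<zero>) \<and> mat_vec (Suc k) A v (Suc k) = \<zero>"
    using v by (auto simp: kernel_vecs_def mat_vec_def le_Suc_eq)
  moreover have "mat_vec k A ?w = comb k (\<lambda>i\<in>{1..k}. \<zero>) (\<ominus> v (Suc k)) x \<longleftrightarrow>
      (\<forall>i\<in>{1..k}. mat_vec k A ?w i = comb k (\<lambda>i\<in>{1..k}. \<zero>) (\<ominus> v (Suc k)) x i)"
  proof
    assume *: "\<forall>i\<in>{1..k}. mat_vec k A ?w i = comb k (\<lambda>i\<in>{1..k}. \<zero>) (\<ominus> v (Suc k)) x i"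
    show "mat_vec k A ?w = comb k (\<lambda>i\<in>{1..k}. \<zero>) (\<ominus> v (Suc k)) x"
    proof
      fix i show "mat_vec k A ?w i = comb k (\<lambda>i\<in>{1..k}. \<zero>) (\<ominus> v (Suc k)) x i"
        using * by (cases "i \<in> {1..k}") (auto simp: mat_vec_def comb_def)
    qed
  qed simp
  ultimately show ?thesis by blast
qed

lemma kernel_vecs_Suc_no_last:
  assumes A: "alternating_matrix R (Suc k) A"
  defines "x \<equiv> \<lambda>i\<in>{1..k}. A i (Suc k)"
  shows "card {v \<in> kernel_vecs (Suc k) A. v (Suc k) = \<zero>} = card {v \<in> kernel_vecs k A. dot k x v = \<zero>}"
proof (rule bij_betw_same_card[OF bij_betw_byWitness[where f = "\<lambda>v. restrict v {1..k}" and f' = "\<lambda>v. v(Suc k := \<zero>)"]])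
  have xc: "x i \<in> carrier R" if "i \<in> {1..k}" for i
    using alternating_square[OF A] that by (auto simp: x_def square_matrix_def)
  have zero: "comb k (\<lambda>i\<in>{1..k}. \<zero>) (\<ominus> \<zero>) x = (\<lambda>i\<in>{1..k}. \<zero>)"
    using xc by (auto simp: comb_def intro!: restrict_ext)
  have iff: "v \<in> kernel_vecs (Suc k) A \<longleftrightarrow> restrict v {1..k} \<in> kernel_vecs k A \<and> dot k x (restrict v {1..k}) = \<zero>"
    if "v \<in> vecs (Suc k)" "v (Suc k) = \<zero>" for v
    using kernel_vecs_Suc_iff[OF A that(1)] restrict_vecs[OF that(1)] that(2) zero
    by (simp add: kernel_vecs_mat_vec x_def)
  have upd: "restrict (v(Suc k := \<zero>)) {1..k} = v" if "v \<in> vecs k" for v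
    using that by (auto simp: vecs_def PiE_def extensional_def fun_eq_iff)
  have sub: "kernel_vecs m A \<subseteq> vecs m" for m by (auto simp: kernel_vecs_def)
  show "\<forall>v\<in>{v \<in> kernel_vecs (Suc k) A. v (Suc k) = \<zero>}. (restrict v {1..k})(Suc k := \<zero>) = v"
    using sub[of "Suc k"] by (auto simp: vecs_def PiE_def extensional_def fun_eq_iff le_Suc_eq subset_iff)
  show "\<forall>v\<in>{v \<in> kernel_vecs k A. dot k x v = \<zero>}. restrict (v(Suc k := \<zero>)) {1..k} = v"
    using sub[of k] upd by blast
  show "(\<lambda>v. restrict v {1..k}) ` {v \<in> kernel_vecs (Suc k) A. v (Suc k) = \<zero>} \<subseteq> {v \<in> kernel_vecs k A. dot k x v = \<zero>}"
    using iff sub[of "Suc k"] by blast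
  show "(\<lambda>v. v(Suc k := \<zero>)) ` {v \<in> kernel_vecs k A. dot k x v = \<zero>} \<subseteq> {v \<in> kernel_vecs (Suc k) A. v (Suc k) = \<zero>}"
  proof safe
    fix v assume v: "v \<in> kernel_vecs k A" "dot k x v = \<zero>"
    then have w: "v \<in> vecs k" using sub by blast
    show "v(Suc k := \<zero>) \<in> kernel_vecs (Suc k) A"
      using v upd[OF w] iff[OF upd_vecs[OF w zero_closed]] by simp
  qed simp
qed

text \<open>
  If \<open>x\<close> is orthogonal to the kernel, then \<open>- x = A' u\<close> for some \<open>u\<close>, where \<open>A'\<close> is the leading block. As
  \<open>x \<bullet> u = - (A' u) \<bullet> u = 0\<close>, the vector \<open>(u, 1)\<close> lies in the new kernel, which it generates together with
  the old one. If \<open>x\<close> is not orthogonal to the kernel, then neither is any nonzero multiple of it, so no such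
  multiple lies in the image of \<open>A'\<close>; hence the last coordinate of a kernel vector is \<open>0\<close>, and the condition
  \<open>x \<bullet> v = 0\<close> cuts the old kernel down by a factor \<open>q\<close>.
\<close>

lemma card_kernel_vecs_Suc:
  assumes A: "alternating_matrix R (Suc k) A"
  defines "x \<equiv> \<lambda>i\<in>{1..k}. A i (Suc k)"
  shows "orthogonal k x (kernel_vecs k A) \<Longrightarrow> card (kernel_vecs (Suc k) A) = q * card (kernel_vecs k A)"
    and "\<not> orthogonal k x (kernel_vecs k A) \<Longrightarrow> q * card (kernel_vecs (Suc k) A) = card (kernel_vecs k A)"
proof -
  let ?W = "kernel_vecs k A" and ?W' = "kernel_vecs (Suc k) A"
  have A': "alternating_matrix R k A" by (rule alternating_Suc[OF A])
  have W: "vec_subspace k ?W" by (intro vec_subspace_kernel_vecs alternating_square A')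
  have W': "vec_subspace (Suc k) ?W'" by (intro vec_subspace_kernel_vecs alternating_square A)
  have x: "x \<in> vecs k" using alternating_square[OF A] by (auto simp: x_def square_matrix_def vecs_def)
  have last: "v (Suc k) \<in> carrier R" if "v \<in> ?W'" for v
    using that by (auto simp: kernel_vecs_def vecs_def)
  {
    assume o: "orthogonal k x ?W"
    let ?y = "comb k (\<lambda>i\<in>{1..k}. \<zero>) (\<ominus> \<one>) x"
    have y: "?y \<in> vecs k" by (intro comb_vecs zero_vecs x a_inv_closed one_closed)
    have "dot k ?y v = \<zero>" if v: "v \<in> ?W" for v
    proof -
      have vv: "v \<in> vecs k" using v by (simp add: kernel_vecs_def)
      have "dot k ?y v = dot k v ?y" by (intro dot_commute vecs_carrier y vv)
      also have "\<dots> = dot k v (\<lambda>i\<in>{1..k}. \<zero>) \<oplus> \<ominus> \<one> \<otimes> dot k v x"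
        by (intro dot_comb vecs_carrier[OF vv] zero_vecs x a_inv_closed one_closed)
      also have "dot k v x = dot k x v" by (intro dot_commute vecs_carrier x vv)
      also have "dot k x v = \<zero>" using o v by (simp add: orthogonal_def)
      also have "dot k v (\<lambda>i\<in>{1..k}. \<zero>) = \<zero>" by (rule dot_zero[OF vecs_carrier[OF vv]])
      also have "\<zero> \<oplus> \<ominus> \<one> \<otimes> \<zero> = \<zero>" by simp
      finally show ?thesis .
    qed
    then have "?y \<in> {x \<in> vecs k. orthogonal k x ?W}" using y by (simp add: orthogonal_def)
    then have "?y \<in> mat_vec k A ` vecs k" unfolding mat_vec_image[OF A'] .
    then obtain u where u: "u \<in> vecs k" "mat_vec k A u = ?y" by (rule imageE) (rule that, assumption, rule sym)
    have xu: "dot k x u = \<zero>"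
    proof -
      have c: "dot k u x \<in> carrier R" by (intro dot_closed vecs_carrier u x)
      have "\<zero> = dot k (mat_vec k A u) u" by (rule dot_mat_vec_self[OF A' u(1), symmetric])
      also have "\<dots> = dot k u ?y"
        unfolding u(2) by (intro dot_commute vecs_carrier y u)
      also have "\<dots> = dot k u (\<lambda>i\<in>{1..k}. \<zero>) \<oplus> \<ominus> \<one> \<otimes> dot k u x"
        by (intro dot_comb vecs_carrier[OF u(1)] zero_vecs x a_inv_closed one_closed)
      also have "\<dots> = \<ominus> dot k u x"
        unfolding dot_zero[OF vecs_carrier[OF u(1)]] using c by (simp add: l_minus)
      finally have "dot k u x = \<zero>" using c by (metis add.inv_eq_1_iff)
      then show ?thesis using dot_commute[OF vecs_carrier[OF u(1)] vecs_carrier[OF x]] by metis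
    qed
    have r: "restrict (u(Suc k := \<one>)) {1..k} = u"
      using u(1) by (auto simp: vecs_def PiE_def extensional_def fun_eq_iff)
    have in_ker: "u(Suc k := \<one>) \<in> ?W'"
      using kernel_vecs_Suc_iff[OF A upd_vecs[OF u(1) one_closed], folded x_def, unfolded r] u(2) xu
      by (simp del: restrict_apply)
    have "card ?W' = q * card {v \<in> ?W'. v (Suc k) = \<zero>}"
    proof (rule card_subspace_functional[OF W' _ _ in_ker])
      show "v (Suc k) \<in> carrier R" if "v \<in> ?W'" for v by (rule last[OF that])
    qed (simp_all add: comb_def)
    also have "{v \<in> ?W. dot k x v = \<zero>} = ?W" using o by (auto simp: orthogonal_def)
    then have "card {v \<in> ?W'. v (Suc k) = \<zero>} = card ?W"
      using kernel_vecs_Suc_no_last[OF A, folded x_def] by simp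
    finally show "card ?W' = q * card ?W" .
  next
    assume no: "\<not> orthogonal k x ?W"
    have "v (Suc k) = \<zero>" if v: "v \<in> ?W'" for v
    proof (rule ccontr)
      assume nz: "v (Suc k) \<noteq> \<zero>"
      let ?v = "restrict v {1..k}"
      have vv: "v \<in> vecs (Suc k)" using v by (simp add: kernel_vecs_def)
      have rv: "?v \<in> vecs k" by (rule restrict_vecs[OF vv])
      have m: "mat_vec k A ?v = comb k (\<lambda>i\<in>{1..k}. \<zero>) (\<ominus> v (Suc k)) x"
        using v kernel_vecs_Suc_iff[OF A vv, folded x_def] by blast
      have "dot k x w = \<zero>" if w: "w \<in> ?W" for w
      proof -
        have ww: "w \<in> vecs k" using w by (simp add: kernel_vecs_def)
        have c: "dot k w x \<in> carrier R" "dot k w x = dot k x w"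
          by (intro dot_closed dot_commute vecs_carrier ww x)+
        have "mat_vec k A ?v \<in> mat_vec k A ` vecs k" using rv by blast
        then have "\<zero> = dot k (mat_vec k A ?v) w"
          using w unfolding mat_vec_image[OF A'] orthogonal_def by simp
        also have "\<dots> = dot k w (mat_vec k A ?v)"
          by (intro dot_commute vecs_carrier ww mat_vec_vecs[OF alternating_square[OF A']] rv)
        also have "\<dots> = dot k w (\<lambda>i\<in>{1..k}. \<zero>) \<oplus> \<ominus> v (Suc k) \<otimes> dot k w x"
          unfolding m by (intro dot_comb vecs_carrier[OF ww] zero_vecs x a_inv_closed last v)
        also have "\<dots> = \<ominus> (v (Suc k) \<otimes> dot k x w)"
          using c last[OF v] by (simp add: dot_zero vecs_carrier[OF ww] l_minus)
        finally have "v (Suc k) \<otimes> dot k x w = \<zero>"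
          using c last[OF v] add.inv_eq_1_iff[of "v (Suc k) \<otimes> dot k x w"] by simp
        moreover have "dot k x w \<in> carrier R" using c by simp
        ultimately show ?thesis using nz last[OF v] integral[of "v (Suc k)" "dot k x w"] by blast
      qed
      then show False using no by (simp add: orthogonal_def)
    qed
    then have "{v \<in> ?W'. v (Suc k) = \<zero>} = ?W'" by blast
    then have "card ?W' = card {v \<in> ?W. dot k x v = \<zero>}"
      using kernel_vecs_Suc_no_last[OF A, folded x_def] by simp
    then show "q * card ?W' = card ?W"
      using card_perp[OF W vecs_carrier[OF x] no] by simp
  }
qed

section \<open>Corank and the size of the kernel\<close>

text \<open>
  Vectors correspond to their coefficient functions on a basis.
\<close>

lemma card_vectorspace:
  assumes "vectorspace R V" "vectorspace.fin_dim R V"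
  shows "card (carrier V) = q ^ vectorspace.dim R V"
proof -
  interpret V: vectorspace R V by fact
  obtain \<beta> where b: "finite \<beta>" "V.basis \<beta>" using V.finite_basis_exists[OF assms(2)] by blast
  then have sub: "\<beta> \<subseteq> carrier V" by (simp add: V.basis_def)
  have ex1: "\<exists>!a. a \<in> \<beta> \<rightarrow>\<^sub>E carrier R \<and> V.lincomb a \<beta> = v" if "v \<in> carrier V" for v
    using V.basis_criterion[OF b(1) sub] b(2) that by blast
  have cl: "V.lincomb a \<beta> \<in> carrier V" if "a \<in> \<beta> \<rightarrow>\<^sub>E carrier R" for a
    using that sub by (intro V.lincomb_closed) (auto simp: PiE_def)
  have "bij_betw (\<lambda>a. V.lincomb a \<beta>) (\<beta> \<rightarrow>\<^sub>E carrier R) (carrier V)"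
    unfolding bij_betw_def
  proof
    show "inj_on (\<lambda>a. V.lincomb a \<beta>) (\<beta> \<rightarrow>\<^sub>E carrier R)"
    proof (rule inj_onI)
      fix a b assume ab: "a \<in> \<beta> \<rightarrow>\<^sub>E carrier R" "b \<in> \<beta> \<rightarrow>\<^sub>E carrier R" "V.lincomb a \<beta> = V.lincomb b \<beta>"
      show "a = b" using ex1[OF cl[OF ab(2)]] ab by blast
    qed
    show "(\<lambda>a. V.lincomb a \<beta>) ` (\<beta> \<rightarrow>\<^sub>E carrier R) = carrier V"
    proof
      show "(\<lambda>a. V.lincomb a \<beta>) ` (\<beta> \<rightarrow>\<^sub>E carrier R) \<subseteq> carrier V" using cl by (rule image_subsetI)
      show "carrier V \<subseteq> (\<lambda>a. V.lincomb a \<beta>) ` (\<beta> \<rightarrow>\<^sub>E carrier R)"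
      proof
        fix v assume "v \<in> carrier V"
        from ex1[OF this] show "v \<in> (\<lambda>a. V.lincomb a \<beta>) ` (\<beta> \<rightarrow>\<^sub>E carrier R)" by blast
      qed
    qed
  qed
  from bij_betw_same_card[OF this] show ?thesis
    using b(1) V.dim_basis[OF b] by (simp add: card_PiE)
qed

text \<open>
  The image contains the columns because \<open>A\<close> maps unit vectors to them. Conversely, the partial sums of
  \<open>A v\<close> stay in the span.
\<close>

lemma span_columns:
  assumes A: "square_matrix k A"
  shows "LinearCombinations.module.span R (func_space {1..k}) ((\<lambda>j. \<lambda>i\<in>{1..k}. A i j) ` {1..k})
    = mat_vec k A ` vecs k"
proof -
  define V where "V = func_space {1..k}"
  define col where "col = (\<lambda>j. \<lambda>i\<in>{1..k}. A i j)"
  interpret V: module R V unfolding V_def by (rule func_space_is_module)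
  have cV: "carrier V = vecs k" by (simp add: V_def func_space_def vecs_def)
  have zV: "\<zero>\<^bsub>V\<^esub> = (\<lambda>i\<in>{1..k}. \<zero>)" by (simp add: V_def func_space_def)
  have aV: "v \<oplus>\<^bsub>V\<^esub> c \<odot>\<^bsub>V\<^esub> w = comb k v c w" for v c w
    by (auto simp: V_def func_space_def comb_def)
  have Ac: "A i j \<in> carrier R" if "i \<in> {1..k}" "j \<in> {1..k}" for i j
    using A that by (simp add: square_matrix_def)
  have colV: "col ` {1..k} \<subseteq> carrier V" using Ac by (auto simp: col_def cV vecs_def)
  have zero: "mat_vec k A (\<lambda>i\<in>{1..k}. \<zero>) = (\<lambda>i\<in>{1..k}. \<zero>)"
    unfolding mat_vec_def using dot_zero[OF square_matrix_row[OF A]] by (intro restrict_ext) simp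
  have im: "comb k v c w \<in> mat_vec k A ` vecs k"
    if vw: "v \<in> mat_vec k A ` vecs k" "w \<in> mat_vec k A ` vecs k" and c: "c \<in> carrier R" for v c w
  proof -
    obtain v' w' where "v = mat_vec k A v'" "w = mat_vec k A w'" "v' \<in> vecs k" "w' \<in> vecs k"
      using vw by blast
    then show ?thesis
      using mat_vec_comb[OF A, of v' w' c] comb_vecs[of v' k w' c] c by (metis imageI)
  qed
  have z_im: "(\<lambda>i\<in>{1..k}. \<zero>) \<in> mat_vec k A ` vecs k" using zero zero_vecs by (metis imageI)
  have "V.span (col ` {1..k}) \<subseteq> mat_vec k A ` vecs k"
  proof (rule V.span_is_subset)
    show "col ` {1..k} \<subseteq> mat_vec k A ` vecs k"
    proof safe
      fix j assume j: "j \<in> {1..k}"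
      (* The j-th unit vector. *)
      let ?e = "\<lambda>i\<in>{1..k}. if j = i then \<one> else \<zero>"
      have e: "?e \<in> vecs k" by (auto simp: vecs_def)
      have "dot k (A i) ?e = A i j" if i: "i \<in> {1..k}" for i
      proof -
        have "dot k (A i) ?e = (\<Oplus>l\<in>{1..k}. if j = l then A i l else \<zero>)"
          unfolding dot_def using Ac i by (intro finsum_cong') auto
        also have "\<dots> = A i j" using Ac i j by (intro add.finprod_singleton) auto
        finally show ?thesis .
      qed
      then have "col j = mat_vec k A ?e" unfolding col_def mat_vec_def by (intro restrict_ext) metis
      then show "col j \<in> mat_vec k A ` vecs k" using e by blast
    qed
    show "LinearCombinations.submodule R (mat_vec k A ` vecs k) V"
    proof (unfold_locales)
      show "mat_vec k A ` vecs k \<subseteq> carrier V" using mat_vec_vecs[OF A] by (auto simp: cV)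
      show "\<zero>\<^bsub>V\<^esub> \<in> mat_vec k A ` vecs k" unfolding zV by (rule z_im)
      fix v w assume v: "v \<in> mat_vec k A ` vecs k" "w \<in> mat_vec k A ` vecs k"
      have vw: "v \<in> carrier V" "w \<in> carrier V" using v mat_vec_vecs[OF A] by (auto simp: cV)
      show "v \<oplus>\<^bsub>V\<^esub> w \<in> mat_vec k A ` vecs k"
        using aV[of v \<one> w] im[OF v one_closed] vw by simp
    next
      fix c v assume c: "c \<in> carrier R" and v: "v \<in> mat_vec k A ` vecs k"
      have "v \<in> carrier V" using v mat_vec_vecs[OF A] by (auto simp: cV)
      then have "c \<odot>\<^bsub>V\<^esub> v = \<zero>\<^bsub>V\<^esub> \<oplus>\<^bsub>V\<^esub> c \<odot>\<^bsub>V\<^esub> v" using c by simp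
      also have "\<dots> = comb k (\<lambda>i\<in>{1..k}. \<zero>) c v" unfolding aV zV ..
      finally show "c \<odot>\<^bsub>V\<^esub> v \<in> mat_vec k A ` vecs k" using im[OF z_im v c] by metis
    qed
  qed
  moreover have "mat_vec k A v \<in> V.span (col ` {1..k})" if v: "v \<in> vecs k" for v
  proof -
    have vc: "v i \<in> carrier R" if "i \<in> {1..k}" for i using v that by (auto simp: vecs_def)
    have sub: "LinearCombinations.submodule R (V.span (col ` {1..k})) V"
      by (rule V.span_is_submodule[OF colV])
    have "(\<lambda>i\<in>{1..k}. \<Oplus>j\<in>{1..m}. A i j \<otimes> v j) \<in> V.span (col ` {1..k})" if "m \<le> k" for m
      using that
    proof (induction m)
      case 0
      have "(\<lambda>i\<in>{1..k}. \<Oplus>j\<in>{1..0}. A i j \<otimes> v j) = \<zero>\<^bsub>V\<^esub>" unfolding zV by (intro restrict_ext) simp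
      then show ?case using LinearCombinations.submodule.zero_closed[OF sub] by metis
    next
      case (Suc m)
      let ?p = "\<lambda>i\<in>{1..k}. \<Oplus>j\<in>{1..m}. A i j \<otimes> v j"
      have S: "{1..Suc m} = insert (Suc m) {1..m}" by auto
      have "(\<lambda>i\<in>{1..k}. \<Oplus>j\<in>{1..Suc m}. A i j \<otimes> v j) = ?p \<oplus>\<^bsub>V\<^esub> v (Suc m) \<odot>\<^bsub>V\<^esub> col (Suc m)"
        unfolding aV comb_def
      proof (rule restrict_ext)
        fix i assume i: "i \<in> {1..k}"
        have t: "A i j \<otimes> v j \<in> carrier R" if "j \<in> {1..Suc m}" for j
          using that Suc.prems i by (intro m_closed Ac vc) auto
        have "(\<Oplus>j\<in>{1..Suc m}. A i j \<otimes> v j) = A i (Suc m) \<otimes> v (Suc m) \<oplus> (\<Oplus>j\<in>{1..m}. A i j \<otimes> v j)"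
          unfolding S using t by (intro finsum_insert) auto
        also have "\<dots> = (\<Oplus>j\<in>{1..m}. A i j \<otimes> v j) \<oplus> A i (Suc m) \<otimes> v (Suc m)"
          using t by (intro a_comm finsum_closed) auto
        also have "A i (Suc m) \<otimes> v (Suc m) = v (Suc m) \<otimes> A i (Suc m)"
          using Suc.prems i by (intro m_comm Ac vc) auto
        finally show "(\<Oplus>j\<in>{1..Suc m}. A i j \<otimes> v j) = ?p i \<oplus> v (Suc m) \<otimes> col (Suc m) i"
          using i by (simp add: col_def)
      qed
      moreover have colm: "col (Suc m) \<in> V.span (col ` {1..k})"
        using V.in_own_span[OF colV] Suc.prems by auto
      moreover have vm: "v (Suc m) \<in> carrier R" using Suc.prems by (intro vc) auto
      moreover have p: "?p \<in> V.span (col ` {1..k})" using Suc.IH Suc.prems by (meson Suc_leD)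
      ultimately show ?case
        using LinearCombinations.submodule.m_closed[OF sub p LinearCombinations.submodule.smult_closed[OF sub vm colm]]
        by (simp only:)
    qed
    from this[of k] show ?thesis by (simp add: mat_vec_def dot_def)
  qed
  ultimately have "V.span (col ` {1..k}) = mat_vec k A ` vecs k" by (intro equalityI image_subsetI)
  then show ?thesis unfolding V_def col_def .
qed

text \<open>
  Counting the points of kernel and image turns the dimension in the definition of the corank into a
  cardinality.
\<close>

lemma card_kernel_vecs:
  assumes A: "square_matrix k A"
  shows "card (kernel_vecs k A) = q ^ corank R k A"
proof -
  define V where "V = func_space {1..k}"
  define S where "S = (\<lambda>j. \<lambda>i\<in>{1..k}. A i j) ` {1..k}"
  interpret V: vectorspace R V
    unfolding V_def vectorspace_def using func_space_is_module field_axioms by blast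
  have S: "S \<subseteq> carrier V" using A by (auto simp: S_def V_def func_space_def square_matrix_def)
  have sub: "subspace R (V.span S) V" by (rule V.span_is_subspace[OF S])
  interpret W: vectorspace R "V.vs (V.span S)" by (rule V.subspace_is_vs[OF sub])
  have "W.gen_set S"
    using V.span_li_not_depend(1)[OF V.in_own_span[OF S] V.span_is_submodule[OF S]] by simp
  moreover have finS: "finite S" by (simp add: S_def)
  ultimately have "W.fin_dim"
    unfolding W.fin_dim_def using V.in_own_span[OF S] finS by (metis V.carrier_vs_is_self)
  then have "card (V.span S) = q ^ W.dim"
    using card_vectorspace[OF W.vectorspace_axioms] by (metis V.carrier_vs_is_self)
  moreover have "W.dim = matrix_rank R k A" by (simp add: matrix_rank_def Let_def V_def S_def)
  moreover have "V.span S = mat_vec k A ` vecs k"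
    unfolding V_def S_def by (rule span_columns[OF A])
  ultimately have "q ^ matrix_rank R k A * card (kernel_vecs k A) = q ^ k"
    using card_image_kernel[OF A] by simp
  also have "q ^ k = q ^ matrix_rank R k A * q ^ corank R k A"
  proof -
    have "matrix_rank R k A \<le> k"
      using A unfolding square_matrix_def by (intro matrix_rank_le[OF field_axioms]) blast
    then show ?thesis unfolding corank_def power_add[symmetric] by simp
  qed
  finally have "q ^ matrix_rank R k A * card (kernel_vecs k A) = q ^ matrix_rank R k A * q ^ corank R k A" .
  then show ?thesis using carrier_not_empty by simp
qed

lemma corank_Suc_cases:
  assumes A: "alternating_matrix R (Suc k) A"
  defines "x \<equiv> \<lambda>i\<in>{1..k}. A i (Suc k)"
  shows "orthogonal k x (kernel_vecs k A) \<Longrightarrow> corank R (Suc k) A = Suc (corank R k A)"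
    and "\<not> orthogonal k x (kernel_vecs k A) \<Longrightarrow> Suc (corank R (Suc k) A) = corank R k A"
proof -
  have c: "card (kernel_vecs k A) = q ^ corank R k A" "card (kernel_vecs (Suc k) A) = q ^ corank R (Suc k) A"
    by (rule card_kernel_vecs[OF alternating_square[OF alternating_Suc[OF A]]],
        rule card_kernel_vecs[OF alternating_square[OF A]])
  have inj: "a = b" if "q ^ a = q ^ b" for a b
  proof -
    have "1 < q" using q_ge_2 by linarith
    then show ?thesis using that power_inject_exp by blast
  qed
  show "corank R (Suc k) A = Suc (corank R k A)" if "orthogonal k x (kernel_vecs k A)"
    using card_kernel_vecs_Suc(1)[OF A that[unfolded x_def]] unfolding c power_Suc[symmetric] by (rule inj)
  show "Suc (corank R (Suc k) A) = corank R k A" if "\<not> orthogonal k x (kernel_vecs k A)"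
    using card_kernel_vecs_Suc(2)[OF A that[unfolded x_def]] unfolding c power_Suc[symmetric] by (rule inj)
qed

lemma corank_parity:
  assumes "alternating_matrix R k A"
  shows "even (k + corank R k A)"
  using assms
proof (induction k)
  case (Suc k)
  have IH: "even (k + corank R k A)" by (rule Suc.IH[OF alternating_Suc[OF Suc.prems]])
  show ?case
  proof (cases "orthogonal k (\<lambda>i\<in>{1..k}. A i (Suc k)) (kernel_vecs k A)")
    case True
    then have "corank R (Suc k) A = Suc (corank R k A)" by (rule corank_Suc_cases(1)[OF Suc.prems])
    then show ?thesis using IH by simp
  next
    case False
    then have "Suc (corank R (Suc k) A) = corank R k A" by (rule corank_Suc_cases(2)[OF Suc.prems])
    then show ?thesis using IH by (metis add_Suc add_Suc_right)
  qed
qed (simp add: corank_def)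

section \<open>Bias of a random vector on hyperplanes\<close>

definition smul :: "nat \<Rightarrow> 'a \<Rightarrow> (nat \<Rightarrow> 'a) \<Rightarrow> nat \<Rightarrow> 'a" where
  "smul k c x = (\<lambda>i\<in>{1..k}. c \<otimes> x i)"

definition zero_vec :: "nat \<Rightarrow> nat \<Rightarrow> 'a" where
  "zero_vec k = (\<lambda>i\<in>{1..k}. \<zero>)"

lemma zero_vec_vecs: "zero_vec k \<in> vecs k"
  unfolding zero_vec_def by (rule zero_vecs)

lemma eq_zero_vec_iff:
  assumes "v \<in> vecs k"
  shows "v = zero_vec k \<longleftrightarrow> (\<forall>i\<in>{1..k}. v i = \<zero>)"
proof
  assume "\<forall>i\<in>{1..k}. v i = \<zero>"
  then show "v = zero_vec k"
    using assms unfolding vecs_def zero_vec_def by (intro PiE_ext[of _ "{1..k}" "\<lambda>_. carrier R"]) auto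
qed (simp add: zero_vec_def)

lemma smul_vecs: "c \<in> carrier R \<Longrightarrow> x \<in> vecs k \<Longrightarrow> smul k c x \<in> vecs k"
  by (auto simp: smul_def vecs_def)

lemma dot_smul:
  assumes "x \<in> vecs k" "v \<in> vecs k" "c \<in> carrier R"
  shows "dot k (smul k c x) v = c \<otimes> dot k x v"
proof -
  have m: "x i \<in> carrier R" "v i \<in> carrier R" if "i \<in> {1..k}" for i using assms that unfolding vecs_def by auto
  have "dot k (smul k c x) v = (\<Oplus>i\<in>{1..k}. c \<otimes> (x i \<otimes> v i))"
    unfolding dot_def smul_def using m assms(3) by (intro finsum_cong') (auto simp: m_assoc)
  also have "\<dots> = c \<otimes> dot k x v"
    unfolding dot_def using m assms(3) by (intro finsum_rdistr[symmetric]) auto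
  finally show ?thesis .
qed

lemma card_hyperplane:
  assumes x: "x \<in> vecs k" "x \<noteq> zero_vec k"
  shows "q * card {v \<in> vecs k. dot k x v = \<zero>} = q ^ k"
proof -
  have "\<not> orthogonal k x (vecs k)"
    using x eq_zero_vec_iff[OF x(1)] orthogonal_vecs[OF vecs_carrier[OF x(1)]] by blast
  then show ?thesis using card_perp[OF vec_subspace_vecs vecs_carrier[OF x(1)]] by (simp add: card_vecs)
qed

lemma hyperplane_subspace:
  assumes "x \<in> vecs k" shows "vec_subspace k {v \<in> vecs k. dot k x v = \<zero>}"
  using vec_subspace_kernel[OF vec_subspace_vecs, of "{()}" "\<lambda>_. x" k] vecs_carrier[OF assms] by simp

text \<open>
  The multiples of \<open>x\<close> are orthogonal to the hyperplane, and both sides have \<open>q\<close> elements.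
\<close>

lemma orthogonal_hyperplane:
  assumes x: "x \<in> vecs k" "x \<noteq> zero_vec k"
  shows "{y \<in> vecs k. orthogonal k y {v \<in> vecs k. dot k x v = \<zero>}} = (\<lambda>c. smul k c x) ` carrier R"
proof (rule card_subset_eq[symmetric])
  let ?H = "{v \<in> vecs k. dot k x v = \<zero>}"
  show "(\<lambda>c. smul k c x) ` carrier R \<subseteq> {y \<in> vecs k. orthogonal k y ?H}"
    using x(1) by (auto simp: smul_vecs orthogonal_def dot_smul)
  obtain i where i: "i \<in> {1..k}" "x i \<noteq> \<zero>" using x eq_zero_vec_iff by blast
  have xi: "x i \<in> carrier R" using x(1) i unfolding vecs_def by auto
  have "inj_on (\<lambda>c. smul k c x) (carrier R)"
  proof (rule inj_onI)
    fix c d assume cd: "c \<in> carrier R" "d \<in> carrier R" "smul k c x = smul k d x"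
    have "c \<otimes> x i = d \<otimes> x i" using fun_cong[OF cd(3), of i] i by (simp add: smul_def)
    then show "c = d" using cd(1,2) xi i(2) by (simp add: m_rcancel)
  qed
  then have "card ((\<lambda>c. smul k c x) ` carrier R) = q" by (rule card_image)
  moreover have "card {y \<in> vecs k. orthogonal k y ?H} = q"
  proof -
    have "card {y \<in> vecs k. orthogonal k y ?H} * card ?H = q * card ?H"
      using card_orthogonal_complement[OF hyperplane_subspace[OF x(1)]] card_hyperplane[OF x] by (simp only:)
    moreover have "zero_vec k \<in> ?H"
      unfolding zero_vec_def using dot_zero[OF vecs_carrier[OF x(1)]] zero_vecs by simp
    then have "card ?H \<noteq> 0" using finite_subset[OF _ finite_vecs, of ?H k] by (auto simp only: card_eq_0_iff)
    ultimately show ?thesis by (simp only: mult_cancel2) simp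
  qed
  ultimately show "card ((\<lambda>c. smul k c x) ` carrier R) = card {y \<in> vecs k. orthogonal k y ?H}" by simp
qed simp

text \<open>
  The first factor combines the indicator of the hyperplane of \<open>x\<close> with a constant. Over the hyperplane the
  second factor sums to \<open>0\<close> unless \<open>y\<close> is a multiple of \<open>x\<close>, over the whole space unless \<open>y = 0\<close>. Counting
  the scalars \<open>c\<close> gives one bound that also covers \<open>x = y = 0\<close>, where all \<open>q - 1\<close> of them count.
\<close>

lemma sum_hyperplane_weight_product:
  assumes x: "x \<in> vecs k" and y: "y \<in> vecs k"
  shows "(\<Sum>v\<in>vecs k. hyperplane_weight k x v * hyperplane_weight k y v)
    \<le> real q ^ k * (real q - 1) * (\<Sum>c\<in>carrier R - {\<zero>}. of_bool (y = smul k c x))"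
proof -
  let ?H = "{v \<in> vecs k. dot k x v = \<zero>}"
  have q1: "1 \<le> real q" using q_ge_2 by linarith
  have o: "orthogonal k z (vecs k) \<longleftrightarrow> z = zero_vec k" if "z \<in> vecs k" for z
    using orthogonal_vecs[OF vecs_carrier[OF that]] eq_zero_vec_iff[OF that] by simp
  have "(\<Sum>v\<in>vecs k. hyperplane_weight k x v * hyperplane_weight k y v)
      = (\<Sum>v\<in>vecs k. real q * (if dot k x v = \<zero> then hyperplane_weight k y v else 0) - hyperplane_weight k y v)"
    by (intro sum.cong refl) (simp add: hyperplane_weight_def[of k x] algebra_simps)
  also have "\<dots> = real q * (\<Sum>v\<in>?H. hyperplane_weight k y v) - (\<Sum>v\<in>vecs k. hyperplane_weight k y v)"
    by (simp add: sum_subtractf sum_distrib_left[symmetric] sum.If_cases Int_def)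
  also have "\<dots> = of_bool (orthogonal k y ?H) * (real q - 1) * (real q * card ?H)
      - of_bool (y = zero_vec k) * (real q - 1) * real q ^ k"
    using sum_hyperplane_weight[OF hyperplane_subspace[OF x] vecs_carrier[OF y]]
      sum_hyperplane_weight[OF vec_subspace_vecs vecs_carrier[OF y]] o[OF y] by (simp add: card_vecs)
  also have "\<dots> \<le> real q ^ k * (real q - 1) * (\<Sum>c\<in>carrier R - {\<zero>}. of_bool (y = smul k c x))"
  proof (cases "x = zero_vec k")
    case True
    have sm: "smul k c x = zero_vec k" if "c \<in> carrier R" for c
      using that unfolding True smul_def zero_vec_def by (intro restrict_ext) simp
    have Hv: "?H = vecs k"
      using o[OF zero_vec_vecs] unfolding True orthogonal_def by blast
    have sm2: "(\<Sum>c\<in>carrier R - {\<zero>}. of_bool (y = smul k c x)) = (real q - 1) * of_bool (y = zero_vec k)"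
    proof -
      have "(\<Sum>c\<in>carrier R - {\<zero>}. of_bool (y = smul k c x)) = (\<Sum>c\<in>carrier R - {\<zero>}. of_bool (y = zero_vec k) :: real)"
        by (intro sum.cong refl) (simp add: sm)
      also have "\<dots> = real (card (carrier R - {\<zero>})) * of_bool (y = zero_vec k)" by simp
      also have "real (card (carrier R - {\<zero>})) = real q - 1"
        using q1 by (simp add: card_Diff_singleton of_nat_diff)
      finally show ?thesis .
    qed
    show ?thesis unfolding Hv sm2 by (simp add: o[OF y] card_vecs algebra_simps)
  next
    case False
    have H: "real q * card ?H = real q ^ k" using arg_cong[OF card_hyperplane[OF x False], of real] unfolding of_nat_mult of_nat_power .
    have "of_bool (orthogonal k y ?H) - of_bool (y = zero_vec k) \<le> (\<Sum>c\<in>carrier R - {\<zero>}. of_bool (y = smul k c x) :: real)"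
    proof (cases "orthogonal k y ?H \<and> y \<noteq> zero_vec k")
      case True
      then have "y \<in> (\<lambda>c. smul k c x) ` carrier R"
        unfolding orthogonal_hyperplane[OF x False, symmetric] using y by simp
      then obtain c where c: "c \<in> carrier R" "y = smul k c x" by blast
      have "smul k \<zero> x = zero_vec k"
        unfolding smul_def zero_vec_def
      proof (rule restrict_ext)
        fix i assume "i \<in> {1..k}"
        then have "x i \<in> carrier R" using x unfolding vecs_def by blast
        then show "\<zero> \<otimes> x i = \<zero>" by simp
      qed
      then have "c \<noteq> \<zero>" using c(2) True by metis
      then have "c \<in> carrier R - {\<zero>}" using c(1) by blast
      then have "of_bool (y = smul k c x) \<le> (\<Sum>c\<in>carrier R - {\<zero>}. of_bool (y = smul k c x) :: real)"
        by (intro member_le_sum) auto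
      moreover have "of_bool (y = smul k c x) = (1 :: real)" using c(2) by (simp only: of_bool_eq_1_iff)
      moreover have "of_bool (orthogonal k y ?H) = (1 :: real)" "of_bool (y = zero_vec k) = (0 :: real)"
        using True by (simp_all only: of_bool_eq_1_iff of_bool_eq_0_iff not_False_eq_True)
      ultimately show ?thesis by linarith
    next
      case False
      have "0 \<le> (\<Sum>c\<in>carrier R - {\<zero>}. of_bool (y = smul k c x) :: real)" by (intro sum_nonneg) simp
      moreover have "of_bool (orthogonal k y ?H) - of_bool (y = zero_vec k) \<le> (0 :: real)"
        using False unfolding of_bool_def by (simp only: split: if_split) linarith
      ultimately show ?thesis by (rule order_trans[rotated])
    qed
    then have "real q ^ k * (real q - 1) * (of_bool (orthogonal k y ?H) - of_bool (y = zero_vec k))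
        \<le> real q ^ k * (real q - 1) * (\<Sum>c\<in>carrier R - {\<zero>}. of_bool (y = smul k c x))"
      using q1 by (intro mult_left_mono) auto
    then show ?thesis unfolding H by (simp add: algebra_simps)
  qed
  finally show ?thesis .
qed

text \<open>
  This is \<open>q * P (x \<bullet> v = 0) - 1\<close>, which vanishes if \<open>x\<close> is uniform and \<open>v \<noteq> 0\<close>.
\<close>

definition hyperplane_bias :: "nat \<Rightarrow> (nat \<Rightarrow> 'a) pmf \<Rightarrow> (nat \<Rightarrow> 'a) \<Rightarrow> real" where
  "hyperplane_bias k D v = measure_pmf.expectation D (\<lambda>x. hyperplane_weight k x v)"

lemma expectation_vecs:
  fixes f :: "(nat \<Rightarrow> 'a) \<Rightarrow> real"
  assumes "set_pmf D \<subseteq> vecs k"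
  shows "measure_pmf.expectation D f = (\<Sum>x\<in>vecs k. pmf D x * f x)"
  using assms by (subst integral_measure_pmf_real[of "vecs k"]) (auto simp: mult.commute)

lemma sum_pmf_vecs: "set_pmf D \<subseteq> vecs k \<Longrightarrow> (\<Sum>x\<in>vecs k. pmf D x) = 1"
  by (rule sum_pmf_eq_1) simp_all

text \<open>
  Write the square as an expectation over two independent copies of the random vector. Only proportional
  copies contribute, and given the first copy they have probability at most \<open>(q - 1) * B\<close>.
\<close>

lemma sum_squared_hyperplane_bias:
  assumes D: "set_pmf D \<subseteq> vecs k" and B: "\<And>x. pmf D x \<le> B"
  shows "(\<Sum>v\<in>vecs k. (hyperplane_bias k D v)\<^sup>2) \<le> real q ^ k * (real q - 1)\<^sup>2 * B"
proof -
  have q1: "1 \<le> real q" using q_ge_2 by linarith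
  have cardq: "real (card (carrier R - {\<zero>})) = real q - 1"
    using q1 by (simp add: card_Diff_singleton of_nat_diff)
  let ?w = "hyperplane_weight k"
  have "(\<Sum>v\<in>vecs k. (hyperplane_bias k D v)\<^sup>2)
      = (\<Sum>v\<in>vecs k. \<Sum>x\<in>vecs k. \<Sum>y\<in>vecs k. pmf D x * pmf D y * (?w x v * ?w y v))"
    unfolding hyperplane_bias_def expectation_vecs[OF D] power2_eq_square sum_product
    by (intro sum.cong refl) (simp add: ac_simps)
  also have "\<dots> = (\<Sum>x\<in>vecs k. \<Sum>y\<in>vecs k. \<Sum>v\<in>vecs k. pmf D x * pmf D y * (?w x v * ?w y v))"
    by (subst sum.swap, rule sum.cong[OF refl], rule sum.swap)
  also have "\<dots> = (\<Sum>x\<in>vecs k. \<Sum>y\<in>vecs k. pmf D x * pmf D y * (\<Sum>v\<in>vecs k. ?w x v * ?w y v))"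
    by (simp add: sum_distrib_left)
  also have "\<dots> \<le> (\<Sum>x\<in>vecs k. \<Sum>y\<in>vecs k. pmf D x * pmf D y *
      (real q ^ k * (real q - 1) * (\<Sum>c\<in>carrier R - {\<zero>}. of_bool (y = smul k c x))))"
    by (intro sum_mono mult_left_mono sum_hyperplane_weight_product) auto
  also have "\<dots> = (\<Sum>x\<in>vecs k. pmf D x * (real q ^ k * (real q - 1)) *
      (\<Sum>c\<in>carrier R - {\<zero>}. \<Sum>y\<in>vecs k. pmf D y * of_bool (y = smul k c x)))"
  proof (rule sum.cong[OF refl])
    fix x
    have "(\<Sum>c\<in>carrier R - {\<zero>}. \<Sum>y\<in>vecs k. pmf D y * of_bool (y = smul k c x))
        = (\<Sum>y\<in>vecs k. pmf D y * (\<Sum>c\<in>carrier R - {\<zero>}. of_bool (y = smul k c x)))"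
      unfolding sum_distrib_left by (rule sum.swap)
    then show "(\<Sum>y\<in>vecs k. pmf D x * pmf D y *
        (real q ^ k * (real q - 1) * (\<Sum>c\<in>carrier R - {\<zero>}. of_bool (y = smul k c x))))
      = pmf D x * (real q ^ k * (real q - 1)) *
        (\<Sum>c\<in>carrier R - {\<zero>}. \<Sum>y\<in>vecs k. pmf D y * of_bool (y = smul k c x))"
      unfolding sum_distrib_left[of _ _ "vecs k"] by (simp only: sum_distrib_left[of _ _ "vecs k"] ac_simps)
  qed
  also have "\<dots> \<le> (\<Sum>x\<in>vecs k. pmf D x * (real q ^ k * (real q - 1)) * ((real q - 1) * B))"
  proof (intro sum_mono mult_left_mono)
    fix x assume x: "x \<in> vecs k"
    have "(\<Sum>c\<in>carrier R - {\<zero>}. \<Sum>y\<in>vecs k. pmf D y * of_bool (y = smul k c x)) \<le> (\<Sum>c\<in>carrier R - {\<zero>}. B)"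
    proof (intro sum_mono)
      fix c assume "c \<in> carrier R - {\<zero>}"
      then have s: "smul k c x \<in> vecs k" using x by (intro smul_vecs) auto
      have "(\<Sum>y\<in>vecs k. pmf D y * of_bool (y = smul k c x)) = (\<Sum>y\<in>vecs k. if y = smul k c x then pmf D y else 0)"
        by (intro sum.cong) auto
      also have "\<dots> = pmf D (smul k c x)" using s by (simp add: sum.delta)
      finally show "(\<Sum>y\<in>vecs k. pmf D y * of_bool (y = smul k c x)) \<le> B" using B by simp
    qed
    then show "(\<Sum>c\<in>carrier R - {\<zero>}. \<Sum>y\<in>vecs k. pmf D y * of_bool (y = smul k c x)) \<le> (real q - 1) * B"
      using cardq by simp
  qed (use q1 in auto)
  also have "\<dots> = real q ^ k * (real q - 1)\<^sup>2 * B"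
    using sum_pmf_vecs[OF D] by (simp add: sum_distrib_right[symmetric] power2_eq_square)
  finally show ?thesis .
qed

lemma sum_abs_hyperplane_bias:
  assumes D: "set_pmf D \<subseteq> vecs k" and B: "\<And>x. pmf D x \<le> B"
  shows "(\<Sum>v\<in>vecs k. \<bar>hyperplane_bias k D v\<bar>) \<le> (real q - 1) * real q ^ k * sqrt B"
proof -
  have q1: "1 \<le> real q" using q_ge_2 by linarith
  have B0: "0 \<le> B" by (rule order_trans[OF pmf_nonneg B])
  have "(\<Sum>v\<in>vecs k. 1 * \<bar>hyperplane_bias k D v\<bar>)\<^sup>2
      \<le> (\<Sum>v\<in>vecs k. 1\<^sup>2) * (\<Sum>v\<in>vecs k. \<bar>hyperplane_bias k D v\<bar>\<^sup>2)"
    by (rule Cauchy_Schwarz_ineq_sum)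
  also have "\<dots> = real q ^ k * (\<Sum>v\<in>vecs k. (hyperplane_bias k D v)\<^sup>2)" by (simp add: card_vecs)
  also have "\<dots> \<le> real q ^ k * (real q ^ k * (real q - 1)\<^sup>2 * B)"
    by (intro mult_left_mono sum_squared_hyperplane_bias D B) simp
  also have "\<dots> = ((real q - 1) * real q ^ k * sqrt B)\<^sup>2"
    using B0 by (simp add: power_mult_distrib) (simp add: power2_eq_square)
  finally have "(\<Sum>v\<in>vecs k. \<bar>hyperplane_bias k D v\<bar>)\<^sup>2 \<le> ((real q - 1) * real q ^ k * sqrt B)\<^sup>2" by simp
  then show ?thesis by (rule power2_le_imp_le) (use q1 B0 in auto)
qed

text \<open>
  Averaging \<open>sum_hyperplane_weight\<close> over \<open>D\<close> expresses the probability by the biases of all elements of \<open>W\<close>.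
  The zero vector, with bias \<open>q - 1\<close>, accounts for the term \<open>1 / q ^ r\<close>. Keeping one factor \<open>1 / q\<close> of
  \<open>1 / q ^ r\<close> in the bound is what makes the step from the \<open>1 \<times> 1\<close> block cheap enough.
\<close>

lemma prob_orthogonal_approx:
  assumes D: "set_pmf D \<subseteq> vecs k" and W: "vec_subspace k W" and r: "card W = q ^ r"
  shows "\<bar>measure_pmf.prob D {x. orthogonal k x W} - 1 / real q ^ r\<bar>
    \<le> (\<Sum>v\<in>W - {zero_vec k}. \<bar>hyperplane_bias k D v\<bar>) / (real q * (real q - 1))"
proof -
  have q1: "1 < real q" using q_ge_2 by linarith
  let ?p = "measure_pmf.prob D {x. orthogonal k x W}" and ?b = "hyperplane_bias k D"
  have fin: "finite W" by (rule finite_subspace[OF W])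
  have z: "zero_vec k \<in> W" using W unfolding vec_subspace_def zero_vec_def by blast
  have p: "?p = (\<Sum>x\<in>vecs k. pmf D x * of_bool (orthogonal k x W))"
    using expectation_vecs[OF D, of "indicator {x. orthogonal k x W}"] by (simp add: indicator_def of_bool_def)
  have "(\<Sum>v\<in>W. ?b v) = (\<Sum>x\<in>vecs k. pmf D x * (\<Sum>v\<in>W. hyperplane_weight k x v))"
    unfolding hyperplane_bias_def expectation_vecs[OF D] by (subst sum.swap) (simp add: sum_distrib_left)
  also have "\<dots> = (\<Sum>x\<in>vecs k. pmf D x * (of_bool (orthogonal k x W) * (real q - 1) * real q ^ r))"
    using sum_hyperplane_weight[OF W vecs_carrier] r by (intro sum.cong refl) simp
  also have "\<dots> = (real q - 1) * real q ^ r * ?p"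
    unfolding p sum_distrib_left by (intro sum.cong refl) (simp only: ac_simps)
  finally have total: "(\<Sum>v\<in>W. ?b v) = (real q - 1) * real q ^ r * ?p" .
  have "hyperplane_weight k x (zero_vec k) = real q - 1" if "x \<in> vecs k" for x
    unfolding hyperplane_weight_def zero_vec_def dot_zero[OF vecs_carrier[OF that]] by simp
  then have "?b (zero_vec k) = (\<Sum>x\<in>vecs k. pmf D x * (real q - 1))"
    unfolding hyperplane_bias_def expectation_vecs[OF D] by (intro sum.cong) auto
  then have b0: "?b (zero_vec k) = real q - 1"
    using sum_pmf_vecs[OF D] by (simp add: sum_distrib_right[symmetric])
  have "(\<Sum>v\<in>W - {zero_vec k}. ?b v) = (\<Sum>v\<in>W. ?b v) - ?b (zero_vec k)"
    using fin z by (simp add: sum_diff1)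
  then have S: "(\<Sum>v\<in>W - {zero_vec k}. ?b v) = (real q - 1) * real q ^ r * ?p - (real q - 1)"
    unfolding total b0 .
  have "p - 1 / Q = s / (Q * a)" if "s = a * Q * p - a" "0 < a" "0 < Q" for p s a Q :: real
  proof -
    have "(p - 1 / Q) * (Q * a) = s" using that by (simp add: left_diff_distrib)
    then show ?thesis using that by (simp add: eq_divide_eq)
  qed
  from this[OF S] have eq: "?p - 1 / real q ^ r = (\<Sum>v\<in>W - {zero_vec k}. ?b v) / (real q ^ r * (real q - 1))"
    using q1 by simp
  show ?thesis
  proof (cases r)
    case 0
    then have "card W = 1" using r by simp
    then have "W - {zero_vec k} = {}" using z by (auto elim!: card_1_singletonE)
    then show ?thesis unfolding eq by (simp only: sum.empty abs_zero div_0 order_refl)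
  next
    case (Suc s)
    have le: "real q * (real q - 1) \<le> real q ^ r * (real q - 1)"
      using q1 Suc by (intro mult_right_mono) auto
    have "\<bar>?p - 1 / real q ^ r\<bar> = \<bar>\<Sum>v\<in>W - {zero_vec k}. ?b v\<bar> / (real q ^ r * (real q - 1))"
      unfolding eq abs_divide using q1 by (simp add: abs_mult)
    also have "\<dots> \<le> (\<Sum>v\<in>W - {zero_vec k}. \<bar>?b v\<bar>) / (real q * (real q - 1))"
      using q1 le by (intro frac_le sum_abs sum_nonneg) (auto simp del: sum_abs_ge_zero)
    finally show ?thesis .
  qed
qed

section \<open>One step with a random last column\<close>

text \<open>
  Both expectations mix \<open>g (r + 1)\<close> and \<open>g (r - 1)\<close>, with weights that differ by the error in
  \<open>prob_orthogonal_approx\<close>. That error is a sum over the random kernel; exchanging the sum with the expectation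
  over the matrix leaves a sum over all nonzero \<open>v\<close> of the bias of \<open>v\<close> times the probability that \<open>v\<close> lies
  in the kernel.
\<close>

lemma corank_step_error:
  assumes alt: "\<And>u. u \<in> set_pmf M \<Longrightarrow> alternating_matrix R k (A u)"
    and D: "set_pmf D \<subseteq> vecs k" and B: "\<And>x. pmf D x \<le> B"
    and ker: "\<And>v. v \<in> vecs k \<Longrightarrow> v \<noteq> zero_vec k \<Longrightarrow>
      measure_pmf.prob M {u. v \<in> kernel_vecs k (A u)} \<le> B'"
    and B': "0 \<le> B'" and g: "\<And>r. g r \<in> {0..1}"
  shows "\<bar>measure_pmf.expectation M (\<lambda>u. measure_pmf.expectation D (\<lambda>x.
        g (if orthogonal k x (kernel_vecs k (A u)) then Suc (corank R k (A u)) else corank R k (A u) - 1)))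
      - measure_pmf.expectation M (\<lambda>u. corank_transfer q g (corank R k (A u)))\<bar>
    \<le> B' * real q ^ k * sqrt B / real q"
proof -
  have q1: "1 < real q" using q_ge_2 by linarith
  let ?W = "\<lambda>u. kernel_vecs k (A u)" and ?r = "\<lambda>u. corank R k (A u)"
  let ?p = "\<lambda>u. measure_pmf.prob D {x. orthogonal k x (?W u)}"
  let ?b = "\<lambda>v. \<bar>hyperplane_bias k D v\<bar> / (real q * (real q - 1))"
  let ?L = "\<lambda>u. ?p u * g (Suc (?r u)) + (1 - ?p u) * g (?r u - 1)"
  let ?T = "\<lambda>u. corank_transfer q g (?r u)"
  let ?E = "\<lambda>u. \<Sum>v\<in>vecs k - {zero_vec k}. ?b v * indicator {u. v \<in> ?W u} u"
  have gb: "0 \<le> g r" "g r \<le> 1" for r using g[of r] by auto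
  have Lb: "\<bar>?L u\<bar> \<le> 2" for u
  proof -
    have "?p u * g (Suc (?r u)) \<le> 1" "(1 - ?p u) * g (?r u - 1) \<le> 1"
      using gb by (auto intro!: mult_le_one)
    moreover have "0 \<le> ?p u * g (Suc (?r u))" "0 \<le> (1 - ?p u) * g (?r u - 1)"
      using gb by auto
    ultimately show ?thesis by linarith
  qed
  have Tb: "\<bar>?T u\<bar> \<le> 1" for u
    using corank_transfer_unit[where g=g, OF q_ge_2 g, of "?r u"] by auto
  have int: "integrable M ?L" "integrable M ?T" "integrable M (\<lambda>u. \<bar>?L u - ?T u\<bar>)"
    by (intro integrable_pmf_bounded[where B=2] Lb integrable_pmf_bounded[where B=1] Tb
          integrable_pmf_bounded[where B=3]; use Lb Tb in \<open>smt (verit)\<close>)+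
  have ib: "integrable M (\<lambda>u. ?b v * indicator {u. v \<in> ?W u} u)" for v
    by (rule integrable_mult_right) simp
  then have intE: "integrable M ?E" by (intro Bochner_Integration.integrable_sum)
  have pt: "\<bar>?L u - ?T u\<bar> \<le> ?E u" if u: "u \<in> set_pmf M" for u
  proof -
    have sq: "square_matrix k (A u)" by (rule alternating_square[OF alt[OF u]])
    have W: "vec_subspace k (?W u)" by (rule vec_subspace_kernel_vecs[OF sq])
    have "?L u - ?T u = (?p u - 1 / real q ^ ?r u) * (g (Suc (?r u)) - g (?r u - 1))"
      by (simp add: corank_transfer_def algebra_simps)
    then have "\<bar>?L u - ?T u\<bar> = \<bar>?p u - 1 / real q ^ ?r u\<bar> * \<bar>g (Suc (?r u)) - g (?r u - 1)\<bar>"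
      by (simp only: abs_mult)
    also have "\<dots> \<le> \<bar>?p u - 1 / real q ^ ?r u\<bar> * 1"
      using gb[of "Suc (?r u)"] gb[of "?r u - 1"] by (intro mult_left_mono) auto
    also have "\<dots> \<le> (\<Sum>v\<in>?W u - {zero_vec k}. \<bar>hyperplane_bias k D v\<bar>) / (real q * (real q - 1))"
      using prob_orthogonal_approx[OF D W card_kernel_vecs[OF sq]] by simp
    also have "\<dots> = (\<Sum>v\<in>?W u - {zero_vec k}. ?b v)" by (rule sum_divide_distrib)
    also have "\<dots> = (\<Sum>v\<in>?W u - {zero_vec k}. ?b v * indicator {u. v \<in> ?W u} u)"
      by (intro sum.cong) auto
    also have "\<dots> = ?E u"
    proof (rule sum.mono_neutral_left)
      show "?W u - {zero_vec k} \<subseteq> vecs k - {zero_vec k}" by (auto simp: kernel_vecs_def)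
    qed auto
    finally show ?thesis .
  qed
  have "\<bar>measure_pmf.expectation M ?L - measure_pmf.expectation M ?T\<bar>
      = \<bar>measure_pmf.expectation M (\<lambda>u. ?L u - ?T u)\<bar>"
    using int by simp
  also have "\<dots> \<le> measure_pmf.expectation M (\<lambda>u. \<bar>?L u - ?T u\<bar>)" by (rule integral_abs_bound)
  also have "\<dots> \<le> measure_pmf.expectation M ?E"
    using int(3) intE pt by (intro integral_mono_AE) (auto simp: AE_measure_pmf_iff)
  also have "\<dots> = (\<Sum>v\<in>vecs k - {zero_vec k}. ?b v * measure_pmf.prob M {u. v \<in> ?W u})"
    by (subst Bochner_Integration.integral_sum[OF ib]) simp
  also have "\<dots> \<le> (\<Sum>v\<in>vecs k - {zero_vec k}. ?b v * B')"
    using q1 ker by (intro sum_mono mult_left_mono) auto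
  also have "\<dots> \<le> (\<Sum>v\<in>vecs k. ?b v * B')"
    using q1 B' by (intro sum_mono2) auto
  also have "\<dots> = (\<Sum>v\<in>vecs k. \<bar>hyperplane_bias k D v\<bar>) / (real q * (real q - 1)) * B'"
    by (simp add: sum_distrib_right[symmetric] sum_divide_distrib[symmetric])
  also have "\<dots> \<le> ((real q - 1) * real q ^ k * sqrt B) / (real q * (real q - 1)) * B'"
    using q1 B' by (intro mult_right_mono divide_right_mono sum_abs_hyperplane_bias D B) auto
  also have "\<dots> = B' * real q ^ k * sqrt B / real q" using q1 by simp
  finally show ?thesis unfolding expectation_if_pmf[of D g] .
qed

definition upper_pairs :: "nat \<Rightarrow> (nat \<times> nat) set" where
  "upper_pairs k = {(i, j). 1 \<le> i \<and> i < j \<and> j \<le> k}"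

definition alt_matrix :: "(nat \<times> nat \<Rightarrow> 'a) \<Rightarrow> nat \<Rightarrow> nat \<Rightarrow> 'a" where
  "alt_matrix U i j = (if i < j then U (i, j) else if j < i then \<ominus> U (j, i) else \<zero>)"

lemma finite_upper_pairs [simp]: "finite (upper_pairs k)"
  by (rule finite_subset[of _ "{1..k} \<times> {1..k}"]) (auto simp: upper_pairs_def)

lemma alternating_alt_matrix:
  assumes "\<And>e. e \<in> upper_pairs k \<Longrightarrow> U e \<in> carrier R"
  shows "alternating_matrix R k (alt_matrix U)"
proof -
  have c: "U (i, j) \<in> carrier R" if "i \<in> {1..k}" "j \<in> {1..k}" "i < j" for i j
    using that by (intro assms) (auto simp: upper_pairs_def)
  show ?thesis unfolding alternating_matrix_def
  proof (intro conjI ballI)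
    fix i j assume ij: "i \<in> {1..k}" "j \<in> {1..k}"
    consider "i < j" | "j < i" | "i = j" by linarith
    then show "alt_matrix U i j \<in> carrier R"
      using c[of i j] c[of j i] ij by cases (auto simp: alt_matrix_def)
    consider "i < j" | "j < i" | "i = j" by linarith
    then show "alt_matrix U j i = \<ominus> alt_matrix U i j"
      using c[of i j] c[of j i] ij by cases (auto simp: alt_matrix_def)
  qed (simp add: alt_matrix_def)
qed

lemma corank_cong:
  assumes "\<And>i j. i \<in> {1..k} \<Longrightarrow> j \<in> {1..k} \<Longrightarrow> A i j = A' i j"
  shows "corank R k A = corank R k A'"
proof -
  have "(\<lambda>j. \<lambda>i\<in>{1..k}. A i j) ` {1..k} = (\<lambda>j. \<lambda>i\<in>{1..k}. A' i j) ` {1..k}"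
    using assms by (intro image_cong refl restrict_ext)
  then show ?thesis by (simp only: corank_def matrix_rank_def)
qed

lemma kernel_vecs_cong:
  assumes "\<And>i j. i \<in> {1..k} \<Longrightarrow> j \<in> {1..k} \<Longrightarrow> A i j = A' i j" "square_matrix k A'"
  shows "kernel_vecs k A = kernel_vecs k A'"
proof -
  have "dot k (A i) v = dot k (A' i) v" if "i \<in> {1..k}" "v \<in> vecs k" for i v
    using that assms(1) square_matrix_row[OF assms(2) that(1)] vecs_carrier[OF that(2)]
    by (intro dot_cong) auto
  then show ?thesis by (auto simp: kernel_vecs_def)
qed

lemma row_entry_determined:
  assumes r: "r \<in> {1..k} \<rightarrow> carrier R" "r' \<in> {1..k} \<rightarrow> carrier R" and v: "v \<in> vecs k"
    and s: "s \<in> {1..k}" "v s \<noteq> \<zero>" and eq: "\<And>j. j \<in> {1..k} \<Longrightarrow> j \<noteq> s \<Longrightarrow> r j = r' j"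
    and d: "dot k r v = dot k r' v"
  shows "r s = r' s"
proof -
  have c: "r j \<in> carrier R" "r' j \<in> carrier R" "v j \<in> carrier R" if "j \<in> {1..k}" for j
    using r v that unfolding vecs_def by blast+
  have ins: "{1..k} = insert s ({1..k} - {s})" using s(1) by blast
  have split: "dot k x v = x s \<otimes> v s \<oplus> (\<Oplus>j\<in>{1..k} - {s}. x j \<otimes> v j)"
    if "\<And>j. j \<in> {1..k} \<Longrightarrow> x j \<in> carrier R" for x
    unfolding dot_def by (subst ins, rule finsum_insert) (use that c s in auto)
  have same: "(\<Oplus>j\<in>{1..k} - {s}. r j \<otimes> v j) = (\<Oplus>j\<in>{1..k} - {s}. r' j \<otimes> v j)"
    using c eq by (intro finsum_cong') auto
  have cl: "(\<Oplus>j\<in>{1..k} - {s}. r' j \<otimes> v j) \<in> carrier R" using c by (intro finsum_closed) auto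
  have "r s \<otimes> v s \<oplus> (\<Oplus>j\<in>{1..k} - {s}. r' j \<otimes> v j) = dot k r v"
    unfolding same[symmetric] by (rule split[symmetric]) (rule c(1))
  also have "\<dots> = r' s \<otimes> v s \<oplus> (\<Oplus>j\<in>{1..k} - {s}. r' j \<otimes> v j)"
    unfolding d by (rule split) (rule c(2))
  finally have "r s \<otimes> v s = r' s \<otimes> v s"
    using cl c[OF s(1)] by (simp add: add.right_cancel)
  then show ?thesis using c[OF s(1)] s(2) by (simp add: m_rcancel)
qed

end

locale random_upper_entries = finite_field R for R (structure) +
  fixes law :: "nat \<times> nat \<Rightarrow> 'a pmf" and cap :: "nat \<times> nat \<Rightarrow> real"
  assumes law_carrier: "set_pmf (law e) \<subseteq> carrier R"
    and law_cap: "pmf (law e) x \<le> cap e"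
begin

text \<open>
  The default value \<open>undefined\<close> makes the families extensional, like the vectors.
\<close>

definition entries :: "(nat \<times> nat) set \<Rightarrow> (nat \<times> nat \<Rightarrow> 'a) pmf" where
  "entries J = Pi_pmf J undefined law"

definition random_column :: "nat \<Rightarrow> (nat \<Rightarrow> 'a) pmf" where
  "random_column k = map_pmf (\<lambda>Z. \<lambda>i\<in>{1..k}. Z (i, Suc k)) (entries ((\<lambda>i. (i, Suc k)) ` {1..k}))"

definition expected_corank :: "nat \<Rightarrow> (nat \<Rightarrow> real) \<Rightarrow> real" where
  "expected_corank k g = measure_pmf.expectation (entries (upper_pairs k)) (\<lambda>U. g (corank R k (alt_matrix U)))"

lemma entries_carrier:
  assumes "finite J" "U \<in> set_pmf (entries J)" "e \<in> J"
  shows "U e \<in> carrier R"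
proof -
  have "U \<in> PiE_dflt J undefined (set_pmf \<circ> law)"
    using assms(2) set_Pi_pmf_subset'[OF assms(1), of undefined law] unfolding entries_def by blast
  then have "U e \<in> set_pmf (law e)" using assms(3) by (cases e) (simp add: PiE_dflt_def)
  then show ?thesis using law_carrier by blast
qed

lemma entries_union:
  assumes "finite J" "finite J'" "J \<inter> J' = {}" and f: "\<And>U. \<bar>f U\<bar> \<le> B"
  shows "measure_pmf.expectation (entries (J \<union> J')) f =
    measure_pmf.expectation (entries J) (\<lambda>U. measure_pmf.expectation (entries J')
      (\<lambda>Z. f (\<lambda>e. if e \<in> J then U e else Z e) :: real))"
proof -
  let ?h = "\<lambda>(U, Z) e. if e \<in> J then U e else Z e"
  have "measure_pmf.expectation (entries (J \<union> J')) f
      = measure_pmf.expectation (pair_pmf (entries J) (entries J')) (\<lambda>x. f (?h x))"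
    unfolding entries_def Pi_pmf_union[OF assms(1-3)] by simp
  also have "\<dots> = measure_pmf.expectation (entries J) (\<lambda>U. measure_pmf.expectation (entries J')
      (\<lambda>Z. f (?h (U, Z))))"
    by (rule expectation_pair_pmf_bounded) (rule f)
  finally show ?thesis by simp
qed

text \<open>
  Fix all entries outside row and column \<open>s\<close>. For \<open>t \<noteq> s\<close>, row \<open>t\<close> of the equation \<open>A v = 0\<close> then has the single
  unknown \<open>A t s\<close>, with nonzero coefficient \<open>v s\<close>. So each of the \<open>k - 1\<close> remaining independent entries is forced
  to a single value.
\<close>

lemma prob_kernel:
  assumes v: "v \<in> vecs k" and s: "s \<in> {1..k}" "v s \<noteq> \<zero>"
  shows "measure_pmf.prob (entries (upper_pairs k)) {U. v \<in> kernel_vecs k (alt_matrix U)}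
    \<le> (\<Prod>t\<in>{1..k} - {s}. cap (min t s, max t s))"
proof -
  let ?e = "\<lambda>t. (min t s, max t s)"
  (* J holds the entries in row or column s, I the other entries. *)
  define J where "J = ?e ` ({1..k} - {s})"
  define I where "I = upper_pairs k - J"
  have inj: "inj_on ?e ({1..k} - {s})"
    by (auto simp: inj_on_def min_def max_def split: if_splits)
  have J: "J \<subseteq> upper_pairs k" "finite J"
    using s(1) by (auto simp: J_def upper_pairs_def min_def max_def)
  have IJ: "upper_pairs k = I \<union> J" "I \<inter> J = {}" "finite I" using J by (auto simp: I_def)
  have notJ: "(i, j) \<in> I" if "i \<noteq> s" "j \<noteq> s" "(i, j) \<in> upper_pairs k" for i j
    using that by (auto simp: I_def J_def min_def max_def split: if_splits)
  let ?m = "\<lambda>U Z e. if e \<in> I then U e else Z e"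
  let ?S = "{U. v \<in> kernel_vecs k (alt_matrix U)}"
  have inner: "measure_pmf.prob (entries J) {Z. ?m U Z \<in> ?S} \<le> (\<Prod>e\<in>J. cap e)"
    if U: "U \<in> set_pmf (entries I)" for U
    unfolding entries_def
  proof (rule prob_determined_coordinates[OF J(2)])
    fix Z Z' e
    assume Z: "Z \<in> {Z. ?m U Z \<in> ?S}" "Z' \<in> {Z. ?m U Z \<in> ?S}"
      and supp: "Z \<in> set_pmf (Pi_pmf J undefined law)" "Z' \<in> set_pmf (Pi_pmf J undefined law)" and e: "e \<in> J"
    have alt: "alternating_matrix R k (alt_matrix (?m U Y))" if "Y \<in> set_pmf (Pi_pmf J undefined law)" for Y
    proof (rule alternating_alt_matrix)
      fix e assume "e \<in> upper_pairs k"
      then show "?m U Y e \<in> carrier R"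
        using entries_carrier[OF IJ(3) U, of e] entries_carrier[OF J(2), of Y e] that IJ(1)
        by (auto simp: entries_def)
    qed
    obtain t where t: "t \<in> {1..k}" "t \<noteq> s" "e = ?e t" using e unfolding J_def by blast
    let ?A = "alt_matrix (?m U Z)" and ?A' = "alt_matrix (?m U Z')"
    have "?A t s = ?A' t s"
    proof (rule row_entry_determined[OF _ _ v s])
      show "?A t \<in> {1..k} \<rightarrow> carrier R" "?A' t \<in> {1..k} \<rightarrow> carrier R"
        by (intro square_matrix_row[OF alternating_square] alt supp t(1))+
      show "dot k (?A t) v = dot k (?A' t) v" using Z t(1) by (simp add: kernel_vecs_def)
      fix j assume j: "j \<in> {1..k}" "j \<noteq> s"
      have "(t, j) \<in> I" if "t < j" using that t j by (intro notJ) (auto simp: upper_pairs_def)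
      moreover have "(j, t) \<in> I" if "j < t" using that t j by (intro notJ) (auto simp: upper_pairs_def)
      ultimately show "?A t j = ?A' t j" by (auto simp: alt_matrix_def)
    qed
    moreover have "e \<notin> I" using e IJ(2) by blast
    moreover have "Z e \<in> carrier R" "Z' e \<in> carrier R"
      using entries_carrier[OF J(2), of _ e] supp e by (auto simp: entries_def)
    ultimately show "Z e = Z' e"
    proof (cases "t < s")
      case True
      then have "e = (t, s)" using t by (simp add: min_def max_def)
      then show ?thesis using \<open>?A t s = ?A' t s\<close> \<open>e \<notin> I\<close> True by (simp add: alt_matrix_def)
    next
      case False
      then have "e = (s, t)" "s < t" using t by (auto simp: min_def max_def)
      then have "\<ominus> Z e = \<ominus> Z' e" using \<open>?A t s = ?A' t s\<close> \<open>e \<notin> I\<close> by (simp add: alt_matrix_def)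
      then show ?thesis using \<open>Z e \<in> carrier R\<close> \<open>Z' e \<in> carrier R\<close> by (metis minus_minus)
    qed
  qed (rule law_cap)
  have "measure_pmf.prob (entries (upper_pairs k)) ?S = measure_pmf.expectation (entries (I \<union> J)) (indicator ?S)"
    by (simp add: IJ(1))
  also have "\<dots> = measure_pmf.expectation (entries I) (\<lambda>U. measure_pmf.expectation (entries J) (\<lambda>Z. indicator ?S (?m U Z)))"
    by (rule entries_union[OF IJ(3) J(2) IJ(2), of _ 1]) (auto simp: indicator_def)
  also have "\<dots> = measure_pmf.expectation (entries I) (\<lambda>U. measure_pmf.prob (entries J) {Z. ?m U Z \<in> ?S})"
  proof (intro Bochner_Integration.integral_cong refl)
    fix U
    have "(\<lambda>Z. indicator ?S (?m U Z) :: real) = indicator {Z. ?m U Z \<in> ?S}" by (auto simp: indicator_def)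
    then show "measure_pmf.expectation (entries J) (\<lambda>Z. indicator ?S (?m U Z)) = measure_pmf.prob (entries J) {Z. ?m U Z \<in> ?S}"
      by simp
  qed
  also have "\<dots> \<le> measure_pmf.expectation (entries I) (\<lambda>U. \<Prod>e\<in>J. cap e)"
  proof (rule integral_mono_AE)
    show "integrable (entries I) (\<lambda>U. measure_pmf.prob (entries J) {Z. ?m U Z \<in> ?S})"
      by (rule integrable_pmf_bounded[where B=1]) simp
    show "AE U in entries I. measure_pmf.prob (entries J) {Z. ?m U Z \<in> ?S} \<le> (\<Prod>e\<in>J. cap e)"
      using inner by (simp only: AE_measure_pmf_iff) blast
  qed simp
  also have "\<dots> = (\<Prod>e\<in>J. cap e)" by (simp add: measure_pmf.prob_space)
  also have "\<dots> = (\<Prod>t\<in>{1..k} - {s}. cap (?e t))"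
    unfolding J_def by (rule prod.reindex_cong[OF inj refl]) simp
  finally show ?thesis .
qed

lemma random_column_vecs: "set_pmf (random_column k) \<subseteq> vecs k"
proof
  fix x assume "x \<in> set_pmf (random_column k)"
  then obtain Z where Z: "Z \<in> set_pmf (entries ((\<lambda>i. (i, Suc k)) ` {1..k}))" "x = (\<lambda>i\<in>{1..k}. Z (i, Suc k))"
    by (auto simp: random_column_def)
  then have "Z (i, Suc k) \<in> carrier R" if "i \<in> {1..k}" for i
    using that by (intro entries_carrier[OF _ Z(1)]) auto
  then show "x \<in> vecs k" unfolding Z(2) vecs_def by auto
qed

lemma pmf_random_column: "pmf (random_column k) x \<le> (\<Prod>i\<in>{1..k}. cap (i, Suc k))"
proof -
  let ?J = "(\<lambda>i. (i, Suc k)) ` {1..k}"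
  have "pmf (random_column k) x = measure_pmf.prob (entries ?J) {Z. (\<lambda>i\<in>{1..k}. Z (i, Suc k)) = x}"
    unfolding random_column_def pmf_map by (simp add: vimage_def)
  also have "\<dots> \<le> (\<Prod>e\<in>?J. cap e)"
    unfolding entries_def
  proof (rule prob_determined_coordinates)
    fix Z Z' e
    assume Z: "Z \<in> {Z. (\<lambda>i\<in>{1..k}. Z (i, Suc k)) = x}" "Z' \<in> {Z. (\<lambda>i\<in>{1..k}. Z (i, Suc k)) = x}" and "e \<in> ?J"
    then obtain i where i: "i \<in> {1..k}" "e = (i, Suc k)" by blast
    have "(\<lambda>i\<in>{1..k}. Z (i, Suc k)) i = (\<lambda>i\<in>{1..k}. Z' (i, Suc k)) i" using Z by simp
    then show "Z e = Z' e" using i by simp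
  qed (simp_all add: law_cap)
  also have "\<dots> = (\<Prod>i\<in>{1..k}. cap (i, Suc k))"
    by (rule prod.reindex_cong[of "\<lambda>i. (i, Suc k)"]) (auto simp: inj_on_def)
  finally show ?thesis .
qed

text \<open>
  The entries of the last column are independent of the leading block, and the corank of the larger matrix
  depends only on the kernel and corank of the block and on whether the column is orthogonal to that kernel.
\<close>

lemma expected_corank_Suc:
  assumes g: "\<And>r. g r \<in> {0..1}"
  shows "expected_corank (Suc k) g = measure_pmf.expectation (entries (upper_pairs k)) (\<lambda>U.
    measure_pmf.expectation (random_column k) (\<lambda>x.
      g (if orthogonal k x (kernel_vecs k (alt_matrix U)) then Suc (corank R k (alt_matrix U))
         else corank R k (alt_matrix U) - 1)))"
proof -
  let ?J = "(\<lambda>i. (i, Suc k)) ` {1..k}" and ?I = "upper_pairs k"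
  let ?m = "\<lambda>U Z e. if e \<in> ?I then U e else Z e"
  have un: "upper_pairs (Suc k) = ?I \<union> ?J" "?I \<inter> ?J = {}" "finite ?J"
    by (auto simp: upper_pairs_def le_Suc_eq image_iff)
  have g1: "\<bar>g r\<bar> \<le> 1" for r using g[of r] by auto
  have "expected_corank (Suc k) g = measure_pmf.expectation (entries ?I) (\<lambda>U.
      measure_pmf.expectation (entries ?J) (\<lambda>Z. g (corank R (Suc k) (alt_matrix (?m U Z)))))"
    unfolding expected_corank_def un(1) by (rule entries_union[OF _ un(3,2) g1]) simp
  also have "\<dots> = measure_pmf.expectation (entries ?I) (\<lambda>U. measure_pmf.expectation (entries ?J) (\<lambda>Z.
      g (if orthogonal k (\<lambda>i\<in>{1..k}. Z (i, Suc k)) (kernel_vecs k (alt_matrix U))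
         then Suc (corank R k (alt_matrix U)) else corank R k (alt_matrix U) - 1)))"
  proof (intro integral_cong_AE; (simp add: AE_measure_pmf_iff)?)
    show "\<forall>U\<in>set_pmf (entries ?I). measure_pmf.expectation (entries ?J) (\<lambda>Z. g (corank R (Suc k) (alt_matrix (?m U Z))))
      = measure_pmf.expectation (entries ?J) (\<lambda>Z. g (if orthogonal k (\<lambda>i\<in>{1..k}. Z (i, Suc k)) (kernel_vecs k (alt_matrix U))
         then Suc (corank R k (alt_matrix U)) else corank R k (alt_matrix U) - 1))"
    proof
      fix U assume U: "U \<in> set_pmf (entries ?I)"
      have "corank R (Suc k) (alt_matrix (?m U Z)) =
          (if orthogonal k (\<lambda>i\<in>{1..k}. Z (i, Suc k)) (kernel_vecs k (alt_matrix U))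
           then Suc (corank R k (alt_matrix U)) else corank R k (alt_matrix U) - 1)"
        if Z: "Z \<in> set_pmf (entries ?J)" for Z
      proof -
        have alt: "alternating_matrix R (Suc k) (alt_matrix (?m U Z))"
        proof (rule alternating_alt_matrix)
          fix e assume "e \<in> upper_pairs (Suc k)"
          then show "?m U Z e \<in> carrier R"
            using entries_carrier[OF finite_upper_pairs U, of e] entries_carrier[OF un(3) Z, of e]
            unfolding un(1) by auto
        qed
        have sq: "square_matrix k (alt_matrix U)"
          by (intro alternating_square alternating_alt_matrix entries_carrier[OF finite_upper_pairs U])
        have corner: "alt_matrix (?m U Z) i j = alt_matrix U i j" if "i \<in> {1..k}" "j \<in> {1..k}" for i j
          using that by (auto simp: alt_matrix_def upper_pairs_def)
        have col: "(\<lambda>i\<in>{1..k}. alt_matrix (?m U Z) i (Suc k)) = (\<lambda>i\<in>{1..k}. Z (i, Suc k))"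
          by (intro restrict_ext) (auto simp: alt_matrix_def upper_pairs_def)
        have cor: "corank R k (alt_matrix (?m U Z)) = corank R k (alt_matrix U)"
          by (rule corank_cong[OF corner])
        have ker: "kernel_vecs k (alt_matrix (?m U Z)) = kernel_vecs k (alt_matrix U)"
          by (rule kernel_vecs_cong[OF corner sq])
        show ?thesis
        proof (cases "orthogonal k (\<lambda>i\<in>{1..k}. Z (i, Suc k)) (kernel_vecs k (alt_matrix U))")
          case True
          from corank_Suc_cases(1)[OF alt, unfolded col cor ker, OF this] show ?thesis
            unfolding if_P[OF True] .
        next
          case False
          from corank_Suc_cases(2)[OF alt, unfolded col cor ker, OF this] show ?thesis
            unfolding if_not_P[OF False] by linarith
        qed
      qed
      then show "measure_pmf.expectation (entries ?J) (\<lambda>Z. g (corank R (Suc k) (alt_matrix (?m U Z))))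
        = measure_pmf.expectation (entries ?J) (\<lambda>Z. g (if orthogonal k (\<lambda>i\<in>{1..k}. Z (i, Suc k)) (kernel_vecs k (alt_matrix U))
         then Suc (corank R k (alt_matrix U)) else corank R k (alt_matrix U) - 1))"
        by (intro integral_cong_AE) (auto simp: AE_measure_pmf_iff)
    qed
  qed
  finally show ?thesis by (simp add: random_column_def)
qed

end

section \<open>Accumulated error\<close>

context random_upper_entries begin

lemma expected_corank_step:
  assumes B: "\<And>x. pmf (random_column k) x \<le> B" and B': "0 \<le> B'"
    and ker: "\<And>v. v \<in> vecs k \<Longrightarrow> v \<noteq> zero_vec k \<Longrightarrow>
      measure_pmf.prob (entries (upper_pairs k)) {U. v \<in> kernel_vecs k (alt_matrix U)} \<le> B'"
    and g: "\<And>r. g r \<in> {0..1}"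
  shows "\<bar>expected_corank (Suc k) g - expected_corank k (corank_transfer q g)\<bar>
    \<le> B' * real q ^ k * sqrt B / real q"
  unfolding expected_corank_Suc[where g = g, OF g]
  unfolding expected_corank_def
proof (rule corank_step_error[OF _ random_column_vecs B ker B' g])
  fix U assume "U \<in> set_pmf (entries (upper_pairs k))"
  then show "alternating_matrix R k (alt_matrix U)"
    by (intro alternating_alt_matrix entries_carrier[OF finite_upper_pairs])
qed

text \<open>
  Replace the true columns by uniform ones, one at a time from the last. A test function for \<open>n\<close> columns
  becomes one for \<open>n - 1\<close> columns with values in the same interval, so the errors add up.
\<close>

lemma expected_corank_telescope:
  assumes step: "\<And>k g. m \<le> k \<Longrightarrow> k < n \<Longrightarrow> (\<And>r. g r \<in> {0..1}) \<Longrightarrow>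
      \<bar>expected_corank (Suc k) g - expected_corank k (corank_transfer q g)\<bar> \<le> err"
    and "m \<le> n" and g: "\<And>r. g r \<in> {0..1}"
  shows "\<bar>expected_corank n g - expected_corank m ((corank_transfer q ^^ (n - m)) g)\<bar> \<le> real (n - m) * err"
  using assms(2) step g
proof (induction n arbitrary: g rule: dec_induct)
  case (step n)
  let ?K = "corank_transfer q"
  have Kg: "?K g r \<in> {0..1}" for r by (rule corank_transfer_unit[where g = g, OF q_ge_2 step.prems(2)])
  have "\<bar>expected_corank n (?K g) - expected_corank m ((?K ^^ (n - m)) (?K g))\<bar> \<le> real (n - m) * err"
    using step.prems(1) Kg by (intro step.IH) auto
  moreover have "(?K ^^ (n - m)) (?K g) = (?K ^^ (Suc n - m)) g"
    using step.hyps by (simp add: Suc_diff_le funpow_swap1)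
  moreover have "\<bar>expected_corank (Suc n) g - expected_corank n (?K g)\<bar> \<le> err"
    using step.hyps step.prems(2) by (intro step.prems(1)) auto
  moreover have "real (Suc n - m) * err = real (n - m) * err + err"
    using step.hyps by (simp add: Suc_diff_le algebra_simps)
  ultimately show ?case by (smt (verit))
qed simp

text \<open>
  The corank of an \<open>m \<times> m\<close> alternating matrix is at most \<open>m\<close> and has the parity of \<open>m\<close>; both facts make it
  comparable to the deterministic start \<open>m mod 2\<close>.
\<close>

lemma expected_corank_mixing:
  assumes g: "\<And>r. g r \<in> {0..1}"
  shows "\<bar>expected_corank m ((corank_transfer q ^^ T) g) - (corank_transfer q ^^ T) g (m mod 2)\<bar>
    \<le> real q ^ m / real q ^ T"
proof -
  let ?h = "(corank_transfer q ^^ T) g" and ?M = "entries (upper_pairs m)"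
  have q1: "1 \<le> real q" using q_ge_2 by linarith
  have hb: "\<bar>?h r\<bar> \<le> 1" for r using corank_transfer_funpow_unit[where g = g, OF q_ge_2 g, of T r] by auto
  have pt: "\<bar>?h (corank R m (alt_matrix U)) - ?h (m mod 2)\<bar> \<le> real q ^ m / real q ^ T"
    if U: "U \<in> set_pmf ?M" for U
  proof -
    let ?r = "corank R m (alt_matrix U)"
    have "alternating_matrix R m (alt_matrix U)"
      by (intro alternating_alt_matrix entries_carrier[OF finite_upper_pairs U])
    then have "even (m + ?r)" by (rule corank_parity)
    moreover have "r = m mod 2 + 2 * (r div 2)" if "even (m + r)" for r using that by presburger
    ultimately have "?r = m mod 2 + 2 * (?r div 2)" by blast
    then have "\<bar>?h ?r - ?h (m mod 2)\<bar> \<le> real q ^ ?r / (real q * real q ^ T)"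
      using corank_transfer_funpow_mixing[where g = g, OF q_ge_2 g, of T "m mod 2" "?r div 2"] by simp
    also have "\<dots> \<le> real q ^ m / (1 * real q ^ T)"
      using q1 by (intro frac_le mult_mono power_increasing) (auto simp: corank_def)
    finally show ?thesis by simp
  qed
  have int: "integrable ?M (\<lambda>U. ?h (corank R m (alt_matrix U)))"
    by (rule integrable_pmf_bounded[where B = 1]) (rule hb)
  have "\<bar>expected_corank m ?h - ?h (m mod 2)\<bar>
      = \<bar>measure_pmf.expectation ?M (\<lambda>U. ?h (corank R m (alt_matrix U)) - ?h (m mod 2))\<bar>"
    unfolding expected_corank_def using int by (simp add: measure_pmf.prob_space)
  also have "\<dots> \<le> measure_pmf.expectation ?M (\<lambda>U. \<bar>?h (corank R m (alt_matrix U)) - ?h (m mod 2)\<bar>)"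
    by (rule integral_abs_bound)
  also have "\<dots> \<le> measure_pmf.expectation ?M (\<lambda>U. real q ^ m / real q ^ T)"
  proof (rule integral_mono_AE)
    show "integrable ?M (\<lambda>U. \<bar>?h (corank R m (alt_matrix U)) - ?h (m mod 2)\<bar>)"
      using int by (intro integrable_abs Bochner_Integration.integrable_diff) auto
    show "AE U in ?M. \<bar>?h (corank R m (alt_matrix U)) - ?h (m mod 2)\<bar> \<le> real q ^ m / real q ^ T"
      using pt by (simp only: AE_measure_pmf_iff) blast
  qed simp
  also have "\<dots> = real q ^ m / real q ^ T" by (simp add: measure_pmf.prob_space)
  finally show ?thesis .
qed

lemma corank_limit_mixing:
  assumes q: "3 \<le> q" and g: "\<And>r. g r \<in> {0..1}"
  shows "\<bar>measure_pmf.expectation (corank_limit q (m + T)) g - (corank_transfer q ^^ T) g (m mod 2)\<bar>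
    \<le> 18 / real q ^ T"
proof -
  let ?h = "(corank_transfer q ^^ T) g"
  have "\<bar>measure_pmf.expectation (corank_limit q m) ?h - ?h (m mod 2)\<bar> \<le> 18 * (1 / (real q * real q ^ T)) * real q"
  proof (rule corank_limit_near_parity[OF q])
    show "\<bar>?h r\<bar> \<le> 1" for r using corank_transfer_funpow_unit[where g = g, OF q_ge_2 g, of T r] by auto
    fix r assume "even (m + r)"
    then have "r = m mod 2 + 2 * (r div 2)" by presburger
    then show "\<bar>?h r - ?h (m mod 2)\<bar> \<le> 1 / (real q * real q ^ T) * real q ^ r"
      using corank_transfer_funpow_mixing[where g = g, OF q_ge_2 g, of T "m mod 2" "r div 2"] by simp
  qed simp
  also have "18 * (1 / (real q * real q ^ T)) * real q = 18 / real q ^ T" using carrier_not_empty by simp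
  finally show ?thesis using expectation_corank_limit_transfer[where g = g, OF q_ge_2 g, of m T] by simp
qed

text \<open>
  The two mixing bounds compare the true corank at time \<open>m\<close> and the equilibrium with the same deterministic
  start \<open>m mod 2\<close>.
\<close>

lemma expected_corank_limit:
  assumes step: "\<And>k g. m \<le> k \<Longrightarrow> k < n \<Longrightarrow> (\<And>r. g r \<in> {0..1}) \<Longrightarrow>
      \<bar>expected_corank (Suc k) g - expected_corank k (corank_transfer q g)\<bar> \<le> err"
    and mn: "m \<le> n" and g: "\<And>r. g r \<in> {0..1}" and q: "3 \<le> q"
  shows "\<bar>expected_corank n g - measure_pmf.expectation (corank_limit q n) g\<bar>
    \<le> real (n - m) * err + real q ^ m / real q ^ (n - m) + 18 / real q ^ (n - m)"
proof -
  have n: "m + (n - m) = n" using mn by simp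
  have "\<bar>expected_corank n g - expected_corank m ((corank_transfer q ^^ (n - m)) g)\<bar> \<le> real (n - m) * err"
    by (rule expected_corank_telescope[OF step mn g])
  then show ?thesis
    using expected_corank_mixing[where g = g, OF g, of m "n - m"]
      corank_limit_mixing[where g = g, OF q g, of m "n - m", unfolded n] by linarith
qed

end

text \<open>
  The left side is \<open>C\<close> to the power \<open>3 * k / 2 - 1\<close> times \<open>q\<close> to the power \<open>3 * f / 2 - k / 2\<close>. From \<open>k \<ge> n / 5\<close>
  and \<open>f \<le> n / 60\<close> the exponent of \<open>q\<close> is at most \<open>n / 40 - n / 10 = - 3 * n / 40\<close>.
\<close>

lemma step_error_le:
  fixes q C :: real
  assumes q: "1 \<le> q" and C: "1 \<le> C" and k: "1 \<le> k" "k \<le> n" "n \<le> 5 * k" and f: "60 * f \<le> n"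
  shows "((C / q) ^ (k - 1) * q ^ f) * q ^ k * sqrt ((C / q) ^ k * q ^ f) / q
    \<le> C ^ (2 * n) * q powr (- real n / 20)"
proof -
  obtain j where j: "k = Suc j" using k(1) by (cases k) auto
  have q0: "0 < q" "0 < C" using q C by auto
  have "((C / q) ^ (k - 1) * q ^ f) * q ^ k * sqrt ((C / q) ^ k * q ^ f) / q
      = C powr (real j + real k / 2) * q powr (3/2 * real f - real k / 2)"
  proof -
    have eq: "((C / q) ^ (k - 1) * q ^ f) * q ^ k / q = C ^ j * q ^ f"
      using q0 by (simp add: j power_divide)
    have root: "sqrt ((C / q) ^ k * q ^ f) = C powr (real k / 2) * q powr (real f / 2 - real k / 2)"
    proof -
      have "(C / q) ^ k * q ^ f = C powr real k * q powr (real f - real k)"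
        using q0 by (simp add: power_divide powr_realpow powr_diff)
      then have "sqrt ((C / q) ^ k * q ^ f) = (C powr real k * q powr (real f - real k)) powr (1/2)"
        using q0 by (simp add: powr_half_sqrt)
      also have "\<dots> = C powr (real k / 2) * q powr (real f / 2 - real k / 2)"
        using q0 by (simp add: powr_mult powr_powr diff_divide_distrib)
      finally show ?thesis .
    qed
    have "((C / q) ^ (k - 1) * q ^ f) * q ^ k * sqrt ((C / q) ^ k * q ^ f) / q
        = (((C / q) ^ (k - 1) * q ^ f) * q ^ k / q) * sqrt ((C / q) ^ k * q ^ f)"
      by simp
    also have "\<dots> = C ^ j * q ^ f * (C powr (real k / 2) * q powr (real f / 2 - real k / 2))"
      unfolding eq root ..
    also have "\<dots> = (C powr real j * C powr (real k / 2)) * (q powr real f * q powr (real f / 2 - real k / 2))"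
      using q0 by (simp add: powr_realpow)
    also have "\<dots> = C powr (real j + real k / 2) * q powr (real f + (real f / 2 - real k / 2))"
      by (simp only: powr_add)
    also have "real f + (real f / 2 - real k / 2) = 3/2 * real f - real k / 2" by simp
    finally show ?thesis .
  qed
  also have "\<dots> \<le> C powr real (2 * n) * q powr (- real n / 20)"
  proof -
    have r: "real k = real j + 1" "real k \<le> real n" "real n \<le> 5 * real k" "60 * real f \<le> real n"
      using j k f by linarith+
    have "real j + real k / 2 \<le> real (2 * n)"
      using r(1,2) unfolding of_nat_mult of_nat_numeral by linarith
    moreover have "3/2 * real f - real k / 2 \<le> - real n / 20" using r by linarith
    ultimately show ?thesis using q C by (intro mult_mono powr_mono) auto
  qed
  also have "C powr real (2 * n) = C ^ (2 * n)" using q0 by (simp only: powr_realpow)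
  finally show ?thesis .
qed

text \<open>
  All three terms carry at least the factor \<open>q\<close> to the power \<open>- n / 20\<close>; the numerical factors and the powers of
  \<open>C\<close> are exponential in \<open>n\<close> and go into the base.
\<close>

lemma total_error_le:
  fixes q C :: real
  assumes q: "1 \<le> q" and C: "1 \<le> C" and n: "1 \<le> n"
  defines "m \<equiv> n div 3"
  shows "real (n - m) * (C ^ (2 * n) * q powr (- real n / 20)) + q ^ m / q ^ (n - m) + 18 / q ^ (n - m)
    \<le> ((20 * C\<^sup>2) ^ 20 / q) powr (1/20 * real n)"
proof -
  let ?e = "q powr (- real n / 20)"
  have q0: "0 < q" "0 < C" using q C by auto
  have m: "m \<le> n" "3 * real m \<le> real n" by (auto simp: m_def)
  have C2: "1 \<le> C ^ (2 * n)" using C by (rule one_le_power)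
  have e0: "0 < ?e" using q0 by simp
  have "q ^ m / q ^ (n - m) = q powr (real m - real (n - m))"
    using q0 by (simp only: powr_diff powr_realpow)
  also have "\<dots> \<le> ?e" using q m by (intro powr_mono) (auto simp: of_nat_diff)
  also have "\<dots> \<le> C ^ (2 * n) * ?e" using C2 e0 by simp
  finally have t1: "q ^ m / q ^ (n - m) \<le> C ^ (2 * n) * ?e" .
  have "1 / q ^ (n - m) = q powr (- real (n - m))"
    using q0 by (simp only: powr_minus_divide powr_realpow)
  also have "\<dots> \<le> ?e" using q m by (intro powr_mono) (auto simp: of_nat_diff)
  also have "\<dots> \<le> C ^ (2 * n) * ?e" using C2 e0 by simp
  finally have t2: "18 / q ^ (n - m) \<le> 18 * (C ^ (2 * n) * ?e)" by simp
  have t3: "real (n - m) * (C ^ (2 * n) * ?e) \<le> real n * (C ^ (2 * n) * ?e)"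
    using C2 e0 by (intro mult_right_mono) auto
  (* The sum of the three bounds is n + 19 times their common factor. *)
  have "real n + 19 \<le> 1 + real n * 19" using n by simp
  also have "\<dots> \<le> (1 + 19) ^ n" by (rule Bernoulli_inequality) simp
  finally have n20: "real n + 19 \<le> 20 ^ n" by simp
  have "real (n - m) * (C ^ (2 * n) * ?e) + q ^ m / q ^ (n - m) + 18 / q ^ (n - m)
      \<le> (real n + 19) * (C ^ (2 * n) * ?e)"
    using t1 t2 t3 by (simp add: algebra_simps)
  also have "\<dots> \<le> 20 ^ n * (C ^ (2 * n) * ?e)"
    using n20 C2 e0 by (intro mult_right_mono) auto
  also have "\<dots> = ((20 * C\<^sup>2) ^ 20 / q) powr (1/20 * real n)"
  proof -
    have "((20 * C\<^sup>2) ^ 20) powr (1/20 * real n) = ((20 * C\<^sup>2) powr 20) powr (1/20 * real n)"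
      using q0 by (simp add: powr_numeral)
    also have "\<dots> = (20 * C\<^sup>2) powr real n" unfolding powr_powr by simp
    also have "\<dots> = 20 ^ n * C ^ (2 * n)"
      using q0 by (simp add: powr_realpow power_mult_distrib power_mult)
    finally have "((20 * C\<^sup>2) ^ 20) powr (1/20 * real n) = 20 ^ n * C ^ (2 * n)" .
    moreover have "((20 * C\<^sup>2) ^ 20 / q) powr (1/20 * real n)
        = ((20 * C\<^sup>2) ^ 20) powr (1/20 * real n) * q powr (- real n / 20)"
      using q0 by (simp add: powr_divide powr_minus_divide)
    ultimately show ?thesis by simp
  qed
  finally show ?thesis .
qed

section \<open>The law of a random alternating matrix\<close>

context finite_field begin

definition upper_part :: "nat \<Rightarrow> (nat \<Rightarrow> nat \<Rightarrow> 'a) \<Rightarrow> nat \<times> nat \<Rightarrow> 'a" where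
  "upper_part n A e = (if e \<in> upper_pairs n then A (fst e) (snd e) else undefined)"

lemma map_upper_part:
  assumes ind: "upper_entries_indep n P"
    and law: "\<And>i j. (i, j) \<in> upper_pairs n \<Longrightarrow> law (i, j) = entry_law P i j"
  shows "map_pmf (upper_part n) P = Pi_pmf (upper_pairs n) undefined law"
proof (rule pmf_eqI)
  fix U
  let ?I = "upper_pairs n"
  show "pmf (map_pmf (upper_part n) P) U = pmf (Pi_pmf ?I undefined law) U"
  proof (cases "\<forall>e. e \<notin> ?I \<longrightarrow> U e = undefined")
    case False
    then have "upper_part n A \<noteq> U" for A by (auto simp: upper_part_def)
    then have "pmf (map_pmf (upper_part n) P) U = 0" by (auto simp: pmf_eq_0_set_pmf)
    then show ?thesis using False by (subst pmf_Pi_outside) auto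
  next
    case True
    have ev: "upper_part n -` {U} = {A. \<forall>e\<in>?I. A (fst e) (snd e) = U e}"
    proof (rule Set.set_eqI)
      fix A
      have "upper_part n A = U \<longleftrightarrow> (\<forall>e. upper_part n A e = U e)" by (rule fun_eq_iff)
      also have "\<dots> \<longleftrightarrow> (\<forall>e\<in>?I. A (fst e) (snd e) = U e)"
        unfolding upper_part_def using True by metis
      finally show "A \<in> upper_part n -` {U} \<longleftrightarrow> A \<in> {A. \<forall>e\<in>?I. A (fst e) (snd e) = U e}" by simp
    qed
    have "pmf (map_pmf (upper_part n) P) U = measure_pmf.prob P {A. \<forall>e\<in>?I. A (fst e) (snd e) = U e}"
      unfolding pmf_map ev ..
    also have "\<dots> = (\<Prod>e\<in>?I. measure_pmf.prob P {A. A (fst e) (snd e) = U e})"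
    proof (cases "?I = {}")
      case False
      have I: "?I = {(i, j). 1 \<le> i \<and> i < j \<and> j \<le> n}" by (simp add: upper_pairs_def)
      have "measure_pmf.prob P (\<Inter>e\<in>?I. (\<lambda>(i, j) A. A i j) e -` {U e} \<inter> space (measure_pmf P))
          = (\<Prod>e\<in>?I. measure_pmf.prob P ((\<lambda>(i, j) A. A i j) e -` {U e} \<inter> space (measure_pmf P)))"
        using ind False unfolding upper_entries_indep_def I[symmetric]
        by (intro prob_space.indep_varsD[OF measure_pmf.prob_space_axioms, where I = ?I and M' = "\<lambda>_. count_space UNIV"]) auto
      moreover have "(\<Inter>e\<in>?I. (\<lambda>(i, j) A. A i j) e -` {U e} \<inter> space (measure_pmf P))
          = {A. \<forall>e\<in>?I. A (fst e) (snd e) = U e}"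
        using False by (auto simp: case_prod_unfold)
      moreover have "(\<lambda>(i, j) A. A i j) e -` {U e} \<inter> space (measure_pmf P) = {A. A (fst e) (snd e) = U e}" for e
        by (auto simp: case_prod_unfold)
      ultimately show ?thesis by simp
    qed simp
    also have "\<dots> = (\<Prod>e\<in>?I. pmf (law e) (U e))"
    proof (rule prod.cong[OF refl])
      fix e assume e: "e \<in> ?I"
      then have "law e = entry_law P (fst e) (snd e)" using law[of "fst e" "snd e"] by simp
      then show "measure_pmf.prob P {A. A (fst e) (snd e) = U e} = pmf (law e) (U e)"
        by (simp add: entry_law_def pmf_map vimage_def)
    qed
    also have "\<dots> = pmf (Pi_pmf ?I undefined law) U" using True by (simp add: pmf_Pi)
    finally show ?thesis .
  qed
qed

text \<open>
  The comparison with the chain starts at \<open>n div 3\<close>: late enough for the step errors to be small, and early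
  enough for the remaining steps of the chain to forget the corank at that time.
\<close>

lemma corank_alternating_tv:
  assumes q: "3 \<le> q" and C: "1 \<le> C" and n: "1 \<le> n"
    and F: "\<And>i. i \<in> {1..n} \<Longrightarrow> finite (F i) \<and> card (F i) \<le> f" and f: "60 * f \<le> n"
    and sym: "\<And>i j. i \<in> {1..n} \<Longrightarrow> j \<in> {1..n} \<Longrightarrow> i \<in> F j \<longleftrightarrow> j \<in> F i"
    and P: "random_alternating R C n F P"
  shows "tv_dist (map_pmf (corank R n) P) (corank_limit q n) \<le> ((20 * C\<^sup>2) ^ 20 / real q) powr (1/20 * real n)"
proof -
  let ?I = "upper_pairs n"
  define law where "law = (\<lambda>e. if e \<in> ?I then entry_law P (fst e) (snd e) else return_pmf \<zero>)"
  (* The trivial bound 1 on point masses stands for "no assumption". *)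
  define cap where "cap = (\<lambda>e. if e \<in> ?I \<and> fst e \<notin> F (snd e) then C / real q else 1)"
  have alt: "alternating_matrix R n A" if "A \<in> set_pmf P" for A
    using P that by (simp add: random_alternating_def)
  have law_R: "set_pmf (law e) \<subseteq> carrier R" for e
  proof (cases "e \<in> ?I")
    case True
    then have "fst e \<in> {1..n}" "snd e \<in> {1..n}" by (auto simp: upper_pairs_def)
    then show ?thesis using True alternating_square[OF alt]
      by (auto simp: law_def entry_law_def square_matrix_def)
  qed (simp add: law_def)
  interpret random_upper_entries R law cap
  proof unfold_locales
    show "set_pmf (law e) \<subseteq> carrier R" for e by (rule law_R)
    show "pmf (law e) x \<le> cap e" for e x
    proof (cases "e \<in> ?I \<and> fst e \<notin> F (snd e)")
      case True
      then have nu: "near_uniform R C (law e)"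
        using P by (auto simp: random_alternating_def upper_pairs_def law_def)
      show ?thesis
      proof (cases "x \<in> carrier R")
        case True
        then show ?thesis using nu \<open>e \<in> ?I \<and> fst e \<notin> F (snd e)\<close> by (simp add: near_uniform_def cap_def)
      next
        case False
        then have "pmf (law e) x = 0" using law_R[of e] by (auto simp: pmf_eq_0_set_pmf)
        then show ?thesis using C by (simp add: cap_def)
      qed
    qed (auto simp: cap_def pmf_le_1)
  qed
  have q1: "1 \<le> real q" using q by linarith
  have cap_sym: "cap (min t s, max t s) = (if t \<in> F s then 1 else C / real q)"
    if "t \<in> {1..n}" "s \<in> {1..n}" "t \<noteq> s" for t s
    using that sym[of s t] by (auto simp: cap_def upper_pairs_def min_def max_def)
  have cardF: "card (T \<inter> F s) \<le> f" if "s \<in> {1..n}" for T s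
    using F[OF that] card_mono[of "F s" "T \<inter> F s"] by auto
  have column: "pmf (random_column k) x \<le> (C / real q) ^ k * real q ^ f" if k: "k < n" for k x
  proof -
    have "pmf (random_column k) x \<le> (\<Prod>i\<in>{1..k}. cap (i, Suc k))" by (rule pmf_random_column)
    also have "\<dots> = (\<Prod>i\<in>{1..k}. if i \<in> F (Suc k) then 1 else C / real q)"
      using k by (intro prod.cong refl) (auto simp: cap_def upper_pairs_def)
    also have "\<dots> \<le> (C / real q) ^ card {1..k} * real q ^ f"
      using k by (intro prod_cap_le cardF C q1) auto
    finally show ?thesis by simp
  qed
  have kernel: "measure_pmf.prob (entries (upper_pairs k)) {U. v \<in> kernel_vecs k (alt_matrix U)}
      \<le> (C / real q) ^ (k - 1) * real q ^ f"
    if k: "k \<le> n" and v: "v \<in> vecs k" "v \<noteq> zero_vec k" for k v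
  proof -
    obtain s where s: "s \<in> {1..k}" "v s \<noteq> \<zero>" using v eq_zero_vec_iff by blast
    have "measure_pmf.prob (entries (upper_pairs k)) {U. v \<in> kernel_vecs k (alt_matrix U)}
        \<le> (\<Prod>t\<in>{1..k} - {s}. cap (min t s, max t s))" by (rule prob_kernel[OF v(1) s])
    also have "\<dots> = (\<Prod>t\<in>{1..k} - {s}. if t \<in> F s then 1 else C / real q)"
      using k s(1) by (intro prod.cong refl cap_sym) auto
    also have "\<dots> \<le> (C / real q) ^ card ({1..k} - {s}) * real q ^ f"
      using k s(1) by (intro prod_cap_le cardF C q1) auto
    finally show ?thesis using s(1) by (simp add: card_Diff_singleton)
  qed
  define err where "err = C ^ (2 * n) * real q powr (- real n / 20)"
  have step: "\<bar>expected_corank (Suc k) g - expected_corank k (corank_transfer q g)\<bar> \<le> err"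
    if k: "n div 3 \<le> k" "k < n" and g: "\<And>r. g r \<in> {0..1}" for k g
    (* The empty block has no nonzero vectors, so the step from it is exact. It occurs only for n < 3. *)
  proof (cases "k = 0")
    case True
    have "v = zero_vec k" if "v \<in> vecs k" for v using that eq_zero_vec_iff True by simp
    then have "\<bar>expected_corank (Suc k) g - expected_corank k (corank_transfer q g)\<bar>
        \<le> 0 * real q ^ k * sqrt ((C / real q) ^ k * real q ^ f) / real q"
      using k by (intro expected_corank_step column g) auto
    also have "\<dots> \<le> err" using C by (simp add: err_def)
    finally show ?thesis .
  next
    case False
    have "\<bar>expected_corank (Suc k) g - expected_corank k (corank_transfer q g)\<bar>
        \<le> ((C / real q) ^ (k - 1) * real q ^ f) * real q ^ k * sqrt ((C / real q) ^ k * real q ^ f) / real q"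
      using k C by (intro expected_corank_step column kernel g) auto
    also have "\<dots> \<le> err"
      unfolding err_def using False k by (intro step_error_le q1 C f) linarith+
    finally show ?thesis .
  qed
  have law_P: "map_pmf (upper_part n) P = entries ?I"
    unfolding entries_def using P
    by (intro map_upper_part) (auto simp: random_alternating_def law_def)
  show ?thesis
  proof (rule tv_dist_le)
    fix g :: "nat \<Rightarrow> real" assume g: "\<And>r. g r \<in> {0..1}"
    have "measure_pmf.expectation (map_pmf (corank R n) P) g
        = measure_pmf.expectation P (\<lambda>A. g (corank R n (alt_matrix (upper_part n A))))"
      unfolding integral_map_pmf
    proof (rule integral_cong_AE)
      have "corank R n A = corank R n (alt_matrix (upper_part n A))" if "A \<in> set_pmf P" for A
      proof (rule corank_cong)
        fix i j assume ij: "i \<in> {1..n}" "j \<in> {1..n}"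
        have "A i i = \<zero>" "A i j = \<ominus> A j i"
          using alt[OF that] ij unfolding alternating_matrix_def by blast+
        then show "A i j = alt_matrix (upper_part n A) i j"
          using ij by (cases i j rule: linorder_cases) (auto simp: alt_matrix_def upper_part_def upper_pairs_def)
      qed
      then show "AE A in P. g (corank R n A) = g (corank R n (alt_matrix (upper_part n A)))"
        by (simp add: AE_measure_pmf_iff)
    qed simp_all
    also have "\<dots> = expected_corank n g"
      unfolding expected_corank_def law_P[symmetric] by simp
    finally have E: "measure_pmf.expectation (map_pmf (corank R n) P) g = expected_corank n g" .
    have "\<bar>expected_corank n g - measure_pmf.expectation (corank_limit q n) g\<bar>
        \<le> real (n - n div 3) * err + real q ^ (n div 3) / real q ^ (n - n div 3) + 18 / real q ^ (n - n div 3)"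
      by (rule expected_corank_limit[OF step _ g q]) auto
    also have "\<dots> \<le> ((20 * C\<^sup>2) ^ 20 / real q) powr (1/20 * real n)"
      unfolding err_def by (rule total_error_le[OF q1 C n])
    finally show "\<bar>measure_pmf.expectation (map_pmf (corank R n) P) g
        - measure_pmf.expectation (corank_limit q n) g\<bar> \<le> ((20 * C\<^sup>2) ^ 20 / real q) powr (1/20 * real n)"
      unfolding E .
  qed
qed

end

theorem theorem1p12:
  shows "\<exists>\<alpha>0::real. 0 < \<alpha>0 \<and>
    (\<forall>(\<alpha>::real) (C::real). 0 < \<alpha> \<and> \<alpha> \<le> \<alpha>0 \<and> 1 \<le> C \<longrightarrow>
      (\<exists>(c::real) (C'::real). 0 < c \<and> 0 < C' \<and>
        (\<forall>(q::nat) (K::nat ring) (n::nat) (F :: nat \<Rightarrow> nat set) (P :: (nat \<Rightarrow> nat \<Rightarrow> nat) pmf).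
          field K \<and> finite (carrier K) \<and> card (carrier K) = q \<and> odd q \<and> 1 \<le> n \<and>
          (\<forall>i\<in>{1..n}. F i \<subseteq> {1..n} \<and> real (card (F i)) < \<alpha> * real n) \<and>
          (\<forall>i\<in>{1..n}. \<forall>j\<in>{1..n}. i \<in> F j \<longleftrightarrow> j \<in> F i) \<and>
          random_alternating K C n F P \<longrightarrow>
            (even n \<longrightarrow> tv_dist (map_pmf (corank K n) P) (Q_alt_e q) \<le> (C' / real q) powr (c * real n)) \<and>
            (odd n \<longrightarrow> tv_dist (map_pmf (corank K n) P) (Q_alt_o q) \<le> (C' / real q) powr (c * real n)))))"
proof (rule exI[of _ "1/60"], intro conjI allI impI)
  fix \<alpha> C :: real assume aC: "0 < \<alpha> \<and> \<alpha> \<le> 1/60 \<and> 1 \<le> C"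
  have main: "tv_dist (map_pmf (corank K n) P) (corank_limit q n) \<le> ((20 * C\<^sup>2) ^ 20 / real q) powr (1/20 * real n)"
    if H: "field K \<and> finite (carrier K) \<and> card (carrier K) = q \<and> odd q \<and> 1 \<le> n \<and>
          (\<forall>i\<in>{1..n}. F i \<subseteq> {1..n} \<and> real (card (F i)) < \<alpha> * real n) \<and>
          (\<forall>i\<in>{1..n}. \<forall>j\<in>{1..n}. i \<in> F j \<longleftrightarrow> j \<in> F i) \<and>
          random_alternating K C n F P"
    for q :: nat and K :: "nat ring" and n :: nat and F :: "nat \<Rightarrow> nat set" and P :: "(nat \<Rightarrow> nat \<Rightarrow> nat) pmf"
  proof -
    interpret K: finite_field K
      using H by (simp add: finite_field_def finite_field_axioms_def)
    have card: "card (carrier K) = q" using H by simp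
    have q: "3 \<le> card (carrier K)"
    proof -
      have "odd (card (carrier K))" using H by simp
      then have "card (carrier K) \<noteq> 2" by (metis even_numeral)
      then show ?thesis using K.q_ge_2 by linarith
    qed
    (* The cardinalities are integers, so their bound may be rounded down. *)
    define f where "f = nat \<lfloor>\<alpha> * real n\<rfloor>"
    have f: "60 * f \<le> n"
    proof -
      have "0 \<le> \<alpha> * real n" using aC by simp
      then have "real f \<le> \<alpha> * real n" by (simp add: f_def)
      also have "\<dots> \<le> 1/60 * real n" using aC by (intro mult_right_mono) auto
      finally show ?thesis by linarith
    qed
    have F: "finite (F i) \<and> card (F i) \<le> f" if "i \<in> {1..n}" for i
    proof -
      have "F i \<subseteq> {1..n}" "real (card (F i)) < \<alpha> * real n" using H that by blast+
      then show ?thesis unfolding f_def using finite_subset[of "F i" "{1..n}"] by (auto simp: le_nat_floor)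
    qed
    have sym: "i \<in> F j \<longleftrightarrow> j \<in> F i" if "i \<in> {1..n}" "j \<in> {1..n}" for i j
      using H that by blast
    have C: "1 \<le> C" and n: "1 \<le> n" and P: "random_alternating K C n F P" using aC H by blast+
    show ?thesis using K.corank_alternating_tv[OF q C n F f sym P] unfolding card .
  qed
  show "\<exists>(c::real) (C'::real). 0 < c \<and> 0 < C' \<and>
        (\<forall>(q::nat) (K::nat ring) (n::nat) (F :: nat \<Rightarrow> nat set) (P :: (nat \<Rightarrow> nat \<Rightarrow> nat) pmf).
          field K \<and> finite (carrier K) \<and> card (carrier K) = q \<and> odd q \<and> 1 \<le> n \<and>
          (\<forall>i\<in>{1..n}. F i \<subseteq> {1..n} \<and> real (card (F i)) < \<alpha> * real n) \<and>
          (\<forall>i\<in>{1..n}. \<forall>j\<in>{1..n}. i \<in> F j \<longleftrightarrow> j \<in> F i) \<and>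
          random_alternating K C n F P \<longrightarrow>
            (even n \<longrightarrow> tv_dist (map_pmf (corank K n) P) (Q_alt_e q) \<le> (C' / real q) powr (c * real n)) \<and>
            (odd n \<longrightarrow> tv_dist (map_pmf (corank K n) P) (Q_alt_o q) \<le> (C' / real q) powr (c * real n)))"
  proof (rule exI[of _ "1/20"], rule exI[of _ "(20 * C\<^sup>2) ^ 20"], intro conjI allI impI, goal_cases)
    case 1
    show ?case by simp
  next
    case 2
    show ?case using aC by simp
  next
    case (3 q K n F P)
    show ?case using main[OF 3(1)] 3(2) by (simp only: corank_limit_def if_True)
  next
    case (4 q K n F P)
    show ?case using main[OF 4(1)] 4(2) by (simp only: corank_limit_def if_False)
  qed
qed simp

end
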